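(* Let $-1<\gamma<-1/2$. As $(\gamma_1,\gamma_2)\to(-1/2,\gamma)$ or $(\gamma_1,\gamma_2)\to(\gamma,-1/2)$ with $(\gamma_1,\gamma_2)\in\boldsymbol{\Delta}$, one has $$Z_{\gamma_1,\gamma_2}(t)\Rightarrow W\,B_{\gamma+3/2}(t),$$ where $B_{\gamma+3/2}(t)$ is a standard fractional Brownian motion with self-similarity parameter $\gamma+3/2$, and $W$ is a standard normal random variable independent of $B_{\gamma+3/2}$.
   Context: Let $\boldsymbol{\Delta}=\{(\gamma_1,\gamma_2): -1<\gamma_1<-1/2,\ -1<\gamma_2<-1/2,\ \gamma_1+\gamma_2>-3/2\}$. Write $u_+^{\gamma}=u^\gamma$ if $u>0$ and $0$ otherwise. For $(\gamma_1,\gamma_2)\in\boldsymbol{\Delta}$, the standardized generalized Rosenblatt process is $$Z_{\gamma_1,\gamma_2}(t)=\frac{A}{2}\int_{\mathbb{R}^2}'\left[\int_0^t\big[(s-x_1)_+^{\gamma_1}(s-x_2)_+^{\gamma_2}+(s-x_1)_+^{\gamma_2}(s-x_2)_+^{\gamma_1}\big]ds\right]B(dx_1)B(dx_2),$$ where $B(\cdot)$ is a Brownian random measure on $\mathbb{R}$ (Gaussian white noise with Lebesgue control measure) and $\int'$ denotes the double Wiener-Itô integral (diagonals $x_1=x_2$ excluded). The constant $A=A(\gamma_1,\gamma_2)>0$ is chosen so that $\mathrm{Var}[Z_{\gamma_1,\gamma_2}(1)]=1$; explicitly, with $\mathrm{B}(x,y)=\int_0^1u^{x-1}(1-u)^{y-1}du$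 the beta function, $$A(\gamma_1,\gamma_2)=\big[(\gamma_1+\gamma_2+2)(2(\gamma_1+\gamma_2)+3)\big]^{1/2}\big[\mathrm{B}(\gamma_1+1,-\gamma_1-\gamma_2-1)\mathrm{B}(\gamma_2+1,-\gamma_1-\gamma_2-1)+\mathrm{B}(\gamma_1+1,-2\gamma_1-1)\mathrm{B}(\gamma_2+1,-2\gamma_2-1)\big]^{-1/2}.$$ The process is taken in its continuous version, and $\Rightarrow$ denotes weak convergence in the space $C[0,1]$ with the uniform metric. A standard fractional Brownian motion $B_H$ with self-similarity parameter (Hurst index) $H$ is the centered Gaussian process with covariance $\mathbb{E}B_H(s)B_H(t)=\frac12(|s|^{2H}+|t|^{2H}-|s-t|^{2H})$. *)

theory Defs
  imports "HOL-Probability.Probability"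
begin

section \<open>Gaussian families\<close>

text \<open>Degenerate (almost surely constant) variables count as Gaussian; the library's
  \<^const>\<open>normal_density\<close> only describes the case of positive variance.\<close>

definition gaussian_variable :: "'a measure \<Rightarrow> ('a \<Rightarrow> real) \<Rightarrow> bool" where
  "gaussian_variable M X \<longleftrightarrow> X \<in> borel_measurable M \<and>
     ((\<exists>m \<sigma>. \<sigma> > 0 \<and> distributed M lborel X (\<lambda>x. ennreal (normal_density m \<sigma> x))) \<or>
      (\<exists>m. AE \<omega> in M. X \<omega> = m))"

definition centered_gaussian_family ::
    "'a measure \<Rightarrow> 'i set \<Rightarrow> ('i \<Rightarrow> 'a \<Rightarrow> real) \<Rightarrow> ('i \<Rightarrow> 'i \<Rightarrow> real) \<Rightarrow> bool" where
  "centered_gaussian_family M T X K \<longleftrightarrow>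
     (\<forall>I c. finite I \<and> I \<subseteq> T \<longrightarrow> gaussian_variable M (\<lambda>\<omega>. \<Sum>t\<in>I. c t * X t \<omega>)) \<and>
     (\<forall>t\<in>T. (\<integral>\<omega>. X t \<omega> \<partial>M) = 0) \<and>
     (\<forall>s\<in>T. \<forall>t\<in>T. (\<integral>\<omega>. X s \<omega> * X t \<omega> \<partial>M) = K s t)"

text \<open>Gaussian white noise on the real line with Lebesgue control measure, indexed by the
  Borel sets of finite measure.  Independence on disjoint sets and almost sure countable
  additivity follow from joint Gaussianity and the covariance.\<close>

definition brownian_random_measure :: "'a measure \<Rightarrow> (real set \<Rightarrow> 'a \<Rightarrow> real) \<Rightarrow> bool" where
  "brownian_random_measure M B \<longleftrightarrow>
     centered_gaussian_family M (fmeasurable lborel) B (\<lambda>S T. measure lborel (S \<inter> T))"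

definition fractional_brownian_motion ::
    "'a measure \<Rightarrow> real \<Rightarrow> (real \<Rightarrow> 'a \<Rightarrow> real) \<Rightarrow> bool" where
  "fractional_brownian_motion M H X \<longleftrightarrow>
     centered_gaussian_family M {0..} X
       (\<lambda>s t. (\<bar>s\<bar> powr (2 * H) + \<bar>t\<bar> powr (2 * H) - \<bar>s - t\<bar> powr (2 * H)) / 2)"

text \<open>Independence of \<open>\<sigma>(W)\<close> and \<open>\<sigma>(X\<^sub>t : t \<ge> 0)\<close>; the library's \<open>indep_var\<close> does not apply because
  it needs both variables to have values in the same type.\<close>

definition independent_of_process ::
    "'a measure \<Rightarrow> ('a \<Rightarrow> real) \<Rightarrow> (real \<Rightarrow> 'a \<Rightarrow> real) \<Rightarrow> bool" where
  "independent_of_process M W X \<longleftrightarrow>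
     prob_space.indep_set M
       (sets (vimage_algebra (space M) W borel))
       (sets (vimage_algebra (space M) (\<lambda>\<omega>. \<lambda>t\<in>{0..}. X t \<omega>) (Pi\<^sub>M {0..} (\<lambda>_. borel))))"


section \<open>The double Wiener-Ito integral\<close>

text \<open>Off-diagonal simple functions are \<open>\<Sum>\<^sub>i\<^sub>j c\<^sub>i\<^sub>j 1\<^bsub>A i \<times> A j\<^esub>\<close> with disjoint \<open>A i\<close> of finite measure
  and \<open>c\<^sub>i\<^sub>i = 0\<close>; the integral is the mean-square extension of
  \<open>\<Sum>\<^sub>i\<^sub>j c\<^sub>i\<^sub>j B(A i) B(A j)\<close>.  It is determined only up to almost sure equality,
  hence it is a relation between the integrand and a random variable.\<close>

definition off_diagonal_data :: "nat \<Rightarrow> (nat \<Rightarrow> nat \<Rightarrow> real) \<Rightarrow> (nat \<Rightarrow> real set) \<Rightarrow> bool" where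
  "off_diagonal_data n c A \<longleftrightarrow>
     (\<forall>i<n. A i \<in> fmeasurable lborel) \<and> disjoint_family_on A {..<n} \<and> (\<forall>i<n. c i i = 0)"

definition off_diagonal_simple ::
    "nat \<Rightarrow> (nat \<Rightarrow> nat \<Rightarrow> real) \<Rightarrow> (nat \<Rightarrow> real set) \<Rightarrow> real \<times> real \<Rightarrow> real" where
  "off_diagonal_simple n c A x = (\<Sum>i<n. \<Sum>j<n. c i j * indicator (A i \<times> A j) x)"

definition simple_double_integral ::
    "(real set \<Rightarrow> 'a \<Rightarrow> real) \<Rightarrow> nat \<Rightarrow> (nat \<Rightarrow> nat \<Rightarrow> real) \<Rightarrow> (nat \<Rightarrow> real set) \<Rightarrow> 'a \<Rightarrow> real" where
  "simple_double_integral B n c A \<omega> = (\<Sum>i<n. \<Sum>j<n. c i j * B (A i) \<omega> * B (A j) \<omega>)"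

definition has_double_wiener_ito_integral ::
    "'a measure \<Rightarrow> (real set \<Rightarrow> 'a \<Rightarrow> real) \<Rightarrow> (real \<times> real \<Rightarrow> real) \<Rightarrow> ('a \<Rightarrow> real) \<Rightarrow> bool" where
  "has_double_wiener_ito_integral M B f X \<longleftrightarrow>
     f \<in> borel_measurable lborel \<and> X \<in> borel_measurable M \<and>
     (\<exists>n c A. (\<forall>k. off_diagonal_data (n k) (c k) (A k)) \<and>
        (\<lambda>k. \<integral>\<^sup>+x. ennreal ((f x - off_diagonal_simple (n k) (c k) (A k) x)\<^sup>2) \<partial>lborel)
          \<longlonglongrightarrow> 0 \<and>
        (\<lambda>k. \<integral>\<^sup>+\<omega>. ennreal ((X \<omega> - simple_double_integral B (n k) (c k) (A k) \<omega>)\<^sup>2) \<partial>M)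
          \<longlonglongrightarrow> 0)"


section \<open>The generalized Rosenblatt process\<close>

definition rosenblatt_region :: "(real \<times> real) set" where
  "rosenblatt_region =
     {(g1, g2). -1 < g1 \<and> g1 < -1/2 \<and> -1 < g2 \<and> g2 < -1/2 \<and> g1 + g2 > -3/2}"

definition pos_powr :: "real \<Rightarrow> real \<Rightarrow> real" where
  "pos_powr u g = (if u > 0 then u powr g else 0)"

definition rosenblatt_kernel :: "real \<Rightarrow> real \<Rightarrow> real \<Rightarrow> real \<times> real \<Rightarrow> real" where
  "rosenblatt_kernel g1 g2 t = (\<lambda>(x1, x2).
     LINT s:{0..t}|lborel.
       pos_powr (s - x1) g1 * pos_powr (s - x2) g2 + pos_powr (s - x1) g2 * pos_powr (s - x2) g1)"

definition rosenblatt_const :: "real \<Rightarrow> real \<Rightarrow> real" where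
  "rosenblatt_const g1 g2 =
     ((g1 + g2 + 2) * (2 * (g1 + g2) + 3)) powr (1/2) *
     (Beta (g1 + 1) (- g1 - g2 - 1) * Beta (g2 + 1) (- g1 - g2 - 1) +
      Beta (g1 + 1) (- 2 * g1 - 1) * Beta (g2 + 1) (- 2 * g2 - 1)) powr (-1/2)"

definition generalized_rosenblatt_process ::
    "'a measure \<Rightarrow> (real set \<Rightarrow> 'a \<Rightarrow> real) \<Rightarrow> real \<Rightarrow> real \<Rightarrow> (real \<Rightarrow> 'a \<Rightarrow> real) \<Rightarrow> bool" where
  "generalized_rosenblatt_process M B g1 g2 Z \<longleftrightarrow>
     (\<forall>t\<ge>0. \<exists>Y. has_double_wiener_ito_integral M B (rosenblatt_kernel g1 g2 t) Y \<and>
        Z t \<in> borel_measurable M \<and>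
        (AE \<omega> in M. Z t \<omega> = rosenblatt_const g1 g2 / 2 * Y \<omega>)) \<and>
     (\<forall>\<omega>\<in>space M. continuous_on {0..} (\<lambda>t. Z t \<omega>))"


section \<open>Weak convergence in \<open>C[0,1]\<close>\<close>

text \<open>Points of this metric space are continuous functions on \<open>[0,1]\<close>, extended by
  \<^const>\<open>undefined\<close> outside; the distance is the supremum distance.\<close>

definition C01 :: "(real \<Rightarrow> real) metric" where
  "C01 = cfunspace (top_of_set {0..1}) euclidean_metric"

lemma mspace_C01: "mspace C01 = {f \<in> extensional {0..1}. continuous_on {0..1} f}"
proof -
  have "bounded (f ` {0..1})" if "continuous_on {0..1} f" for f :: "real \<Rightarrow> real"
    using compact_continuous_image[OF that] compact_imp_bounded by auto
  then show ?thesis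
    by (auto simp: C01_def Met_TC.fspace_def)
qed

lemma mdist_C01:
  assumes "f \<in> mspace C01" "g \<in> mspace C01"
  shows "mdist C01 f g = (SUP t\<in>{0..1}. \<bar>f t - g t\<bar>)"
  using assms by (auto simp: C01_def cfunspace_def Met_TC.fdist_def dist_real_def)

definition path01 :: "(real \<Rightarrow> 'a \<Rightarrow> real) \<Rightarrow> 'a \<Rightarrow> real \<Rightarrow> real" where
  "path01 X \<omega> = (\<lambda>t\<in>{0..1}. X t \<omega>)"

definition borel_of :: "'c topology \<Rightarrow> 'c measure" where
  "borel_of T = sigma (topspace T) {U. openin T U}"

definition converges_weakly ::
    "'c topology \<Rightarrow> 'a measure \<Rightarrow> ('i \<Rightarrow> 'a \<Rightarrow> 'c) \<Rightarrow> 'b measure \<Rightarrow> ('b \<Rightarrow> 'c) \<Rightarrow> 'i filter \<Rightarrow> bool" where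
  "converges_weakly T M X N Y F \<longleftrightarrow>
     (\<forall>\<^sub>F i in F. X i \<in> M \<rightarrow>\<^sub>M borel_of T) \<and> Y \<in> N \<rightarrow>\<^sub>M borel_of T \<and>
     (\<forall>\<Phi>. continuous_map T euclideanreal \<Phi> \<and> bounded (\<Phi> ` topspace T) \<longrightarrow>
        ((\<lambda>i. \<integral>\<omega>. \<Phi> (X i \<omega>) \<partial>M) \<longlongrightarrow> (\<integral>\<omega>. \<Phi> (Y \<omega>) \<partial>N)) F)"

end

theory Submission
  imports Defs "HOL-Real_Asymp.Real_Asymp"
begin

text \<open>As \<open>\<gamma>\<^sub>1 \<rightarrow> -1/2\<close> the factor \<open>(s - x\<^sub>1)\<^sub>+\<close> to the power \<open>\<gamma>\<^sub>1\<close> barely fails to be square integrable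
  at \<open>x\<^sub>1 = -\<infinity>\<close>, and after normalisation the kernel concentrates at \<open>x\<^sub>1 \<le> -L\<close> with \<open>L \<rightarrow> \<infinity>\<close>, where that
  factor no longer depends on \<open>s\<close>.  The kernel thus approaches a product \<open>v(x\<^sub>1) g\<^sub>t(x\<^sub>2)\<close>, symmetrised,
  where \<open>g\<^sub>t\<close> is the Mandelbrot-Van Ness kernel of fractional Brownian motion, and the double integral
  approaches the product of two independent Gaussian variables.  Replacing \<open>v\<close> and \<open>g\<^sub>t\<close> by step functions
  with disjoint supports makes this product an exact double integral, so that no Wiener integrals
  have to be constructed.  Laws of Gaussian vectors are compared by characteristic functions, turned
  into weak convergence by Stone-Weierstrass; tightness needs only second moments, since
  \<open>E(Z(t) - Z(s))\<^sup>2\<close> is of order \<open>|t - s|\<close> to a power larger than 1.\<close>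

section \<open>Trigonometric polynomials and finite-dimensional convergence\<close>


text \<open>The normalisation carries the kernel estimate. Write K for the unsymmetrised kernel on
  [0,t], q = A K with A the normalising constant, and v for the rank-one candidate. In the
  denominator of A^2 one Beta product stays bounded while the other blows up like 1/(-2 \<gamma>_1 -
  1). Dropping the bounded one gives |q|^2 <= t^(2(\<gamma>_1 + \<gamma>_2 + 2)), and |v|^2 tends to
  the same limit t^(2 \<gamma> + 3). Hence |q - v|^2 = |q|^2 + |v|^2 - 2 <q,v> vanishes as soon as q
  >= \<rho> v pointwise with \<rho> -> 1, which is monotonicity of powers. Independence of the two
  limiting factors has a geometric source: the step functions live on (-\<infinity>, -L] and (-L,
  \<infinity>), so their Gaussian integrals are uncorrelated already before the limit. Constants in
  the L^2 bounds are crude (8 where 2 is sharp), because only vanishing errors and the exponent of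
  |t - s| matter.\<close>

inductive trig_poly :: "nat \<Rightarrow> ((nat \<Rightarrow> real) \<Rightarrow> real) \<Rightarrow> bool" for k where
  cos: "trig_poly k (\<lambda>x. cos (\<Sum>i<k. c i * x i))"
| sin: "trig_poly k (\<lambda>x. sin (\<Sum>i<k. c i * x i))"
| add: "trig_poly k f \<Longrightarrow> trig_poly k g \<Longrightarrow> trig_poly k (\<lambda>x. f x + g x)"
| scale: "trig_poly k f \<Longrightarrow> trig_poly k (\<lambda>x. a * f x)"

lemma trig_poly_diff: "trig_poly k f \<Longrightarrow> trig_poly k g \<Longrightarrow> trig_poly k (\<lambda>x. f x - g x)"
  using trig_poly.add[of k f "\<lambda>x. (-1) * g x"] trig_poly.scale[of k g "-1"] by simp

lemma trig_poly_const: "trig_poly k (\<lambda>x. a)"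
  using trig_poly.scale[OF trig_poly.cos[of k "\<lambda>_. 0"], of a] by simp

text \<open>The product-to-sum formulas turn a product of two waves with frequency vectors c and d
  into waves with frequencies c + d and c - d; the general case is then linear.\<close>

lemma trig_poly_mult_atom:
  assumes "trig_poly k f"
  shows "trig_poly k (\<lambda>x. cos (\<Sum>i<k. c i * x i) * f x) \<and>
         trig_poly k (\<lambda>x. sin (\<Sum>i<k. c i * x i) * f x)"
  using assms
proof induction
  case (cos d)
  have eq: "cos u * cos v = (1/2) * (cos (u - v) + cos (u + v))"
    "sin u * cos v = (1/2) * (sin (u + v) + sin (u - v))" for u v :: real
    by (simp_all add: cos_times_cos sin_times_cos)
  have s: "(\<Sum>i<k. c i * x i) + (\<Sum>i<k. d i * x i) = (\<Sum>i<k. (c i + d i) * x i)"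
    "(\<Sum>i<k. c i * x i) - (\<Sum>i<k. d i * x i) = (\<Sum>i<k. (c i - d i) * x i)" for x
    by (simp_all add: sum.distrib[symmetric] sum_subtractf[symmetric] algebra_simps)
  show ?case unfolding eq s
    by (intro conjI trig_poly.intros)
next
  case (sin d)
  have eq: "cos u * sin v = (1/2) * (sin (u + v) - sin (u - v))"
    "sin u * sin v = (1/2) * (cos (u - v) - cos (u + v))" for u v :: real
    by (simp_all add: cos_times_sin sin_times_sin)
  have s: "(\<Sum>i<k. c i * x i) + (\<Sum>i<k. d i * x i) = (\<Sum>i<k. (c i + d i) * x i)"
    "(\<Sum>i<k. c i * x i) - (\<Sum>i<k. d i * x i) = (\<Sum>i<k. (c i - d i) * x i)" for x
    by (simp_all add: sum.distrib[symmetric] sum_subtractf[symmetric] algebra_simps)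
  show ?case unfolding eq s
    by (intro conjI trig_poly.scale trig_poly_diff trig_poly.sin trig_poly.cos)
next
  case (add f g)
  then show ?case by (auto simp: distrib_left intro: trig_poly.add)
next
  case (scale f a)
  then show ?case by (simp only: mult.left_commute[of _ a]) (auto intro: trig_poly.scale)
qed

text \<open>With this closure the class is an algebra, as Stone-Weierstrass demands, while
  expectations of its members remain linear combinations of real and imaginary parts of
  characteristic functions.\<close>

lemma trig_poly_mult:
  assumes "trig_poly k f" "trig_poly k g"
  shows "trig_poly k (\<lambda>x. f x * g x)"
  using assms(1)
proof induction
  case (scale f a)
  then show ?case using trig_poly.scale[of k "\<lambda>x. f x * g x" a] by (simp add: mult.assoc)
qed (use trig_poly_mult_atom[OF assms(2)] in \<open>auto simp: distrib_right intro: trig_poly.add\<close>)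

lemma trig_poly_measurable:
  assumes "trig_poly k f" "\<And>i. i < k \<Longrightarrow> V i \<in> borel_measurable M"
  shows "(\<lambda>\<omega>. f (\<lambda>i. if i < k then V i \<omega> else 0)) \<in> borel_measurable M"
  using assms by induction auto

lemma trig_poly_bounded:
  assumes "trig_poly k f" shows "\<exists>K. \<forall>x. \<bar>f x\<bar> \<le> K"
  using assms
proof induction
  case (add f g)
  then obtain K L where "\<forall>x. \<bar>f x\<bar> \<le> K" "\<forall>x. \<bar>g x\<bar> \<le> L" by auto
  then have "\<forall>x. \<bar>f x + g x\<bar> \<le> K + L" by (metis abs_triangle_ineq add_mono order_trans)
  then show ?case by blast
next
  case (scale f a)
  then obtain K where "\<forall>x. \<bar>f x\<bar> \<le> K" by auto
  then have "\<forall>x. \<bar>a * f x\<bar> \<le> \<bar>a\<bar> * K" by (simp add: abs_mult mult_left_mono)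
  then show ?case by blast
qed (auto intro!: exI[of _ 1])

lemma trig_poly_integrable:
  assumes "prob_space M" "trig_poly k f" "\<And>i. i < k \<Longrightarrow> V i \<in> borel_measurable M"
  shows "integrable M (\<lambda>\<omega>. f (\<lambda>i. if i < k then V i \<omega> else 0))"
proof -
  interpret prob_space M by fact
  obtain K where "\<forall>x. \<bar>f x\<bar> \<le> K" using trig_poly_bounded[OF assms(2)] by auto
  then show ?thesis
    using trig_poly_measurable[OF assms(2,3)] by (intro integrable_const_bound[of _ K]) auto
qed

lemma trig_poly_tendsto:
  fixes X :: "'i \<Rightarrow> nat \<Rightarrow> 'a \<Rightarrow> real"
  assumes "prob_space M" "prob_space N" "trig_poly k f"
    and X: "\<forall>\<^sub>F p in F. \<forall>i<k. X p i \<in> borel_measurable M"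
    and Y: "\<And>i. i < k \<Longrightarrow> Y i \<in> borel_measurable N"
    and c: "\<And>c. ((\<lambda>p. \<integral>\<omega>. cos (\<Sum>i<k. c i * X p i \<omega>) \<partial>M) \<longlongrightarrow> (\<integral>\<omega>. cos (\<Sum>i<k. c i * Y i \<omega>) \<partial>N)) F"
    and s: "\<And>c. ((\<lambda>p. \<integral>\<omega>. sin (\<Sum>i<k. c i * X p i \<omega>) \<partial>M) \<longlongrightarrow> (\<integral>\<omega>. sin (\<Sum>i<k. c i * Y i \<omega>) \<partial>N)) F"
  shows "((\<lambda>p. \<integral>\<omega>. f (\<lambda>i. if i < k then X p i \<omega> else 0) \<partial>M) \<longlongrightarrow>
      (\<integral>\<omega>. f (\<lambda>i. if i < k then Y i \<omega> else 0) \<partial>N)) F"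
  using assms(3)
proof induction
  case (cos d) then show ?case using c[of d] by simp
next
  case (sin d) then show ?case using s[of d] by simp
next
  case (add f g)
  have "\<forall>\<^sub>F p in F. (\<integral>\<omega>. f (\<lambda>i. if i < k then X p i \<omega> else 0) \<partial>M) + (\<integral>\<omega>. g (\<lambda>i. if i < k then X p i \<omega> else 0) \<partial>M)
     = (\<integral>\<omega>. f (\<lambda>i. if i < k then X p i \<omega> else 0) + g (\<lambda>i. if i < k then X p i \<omega> else 0) \<partial>M)"
    using X by eventually_elim (auto intro!: Bochner_Integration.integral_add[symmetric] trig_poly_integrable[OF assms(1)] add.hyps)
  moreover have "(\<integral>\<omega>. f (\<lambda>i. if i < k then Y i \<omega> else 0) \<partial>N) + (\<integral>\<omega>. g (\<lambda>i. if i < k then Y i \<omega> else 0) \<partial>N)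
     = (\<integral>\<omega>. f (\<lambda>i. if i < k then Y i \<omega> else 0) + g (\<lambda>i. if i < k then Y i \<omega> else 0) \<partial>N)"
    using Y by (auto intro!: Bochner_Integration.integral_add[symmetric] trig_poly_integrable[OF assms(2)] add.hyps)
  ultimately show ?case
    using tendsto_add[OF add.IH] Lim_transform_eventually by fastforce
next
  case (scale f a)
  then show ?case by (auto intro: tendsto_mult_left)
qed

lemma compact_unit_cube: "compact {y::nat \<Rightarrow> real. \<forall>i. y i \<in> (if i < k then {-1..1} else {0})}"
proof -
  have "compactin (product_topology (\<lambda>_. euclidean) UNIV) (PiE UNIV (\<lambda>i. if i < k then {-1..1::real} else {0}))"
    unfolding compactin_PiE by (auto simp: compactin_euclidean_iff)
  then show ?thesis
    by (simp add: euclidean_product_topology compactin_euclidean_iff PiE_def Pi_def extensional_def)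
qed

text \<open>The substitution y_i = sin (\<theta> x_i) with \<theta> = pi/(2R) is invertible on
  [-R, R] and maps all of space into the unit cube. Stone-Weierstrass is applied on that cube to
  functions whose pullback is a trigonometric polynomial, so the approximant stays bounded by K + e
  even where it no longer resembles g.\<close>

lemma trig_poly_approx:
  fixes g :: "(nat \<Rightarrow> real) \<Rightarrow> real"
  assumes g: "continuous_on UNIV g" and K: "\<And>x. \<bar>g x\<bar> \<le> K" and e: "e > 0" and R: "R > 0"
  obtains f where "trig_poly k f" "\<And>x. \<bar>f (\<lambda>i. if i < k then x i else 0)\<bar> \<le> K + e"
    "\<And>x. (\<And>i. i < k \<Longrightarrow> \<bar>x i\<bar> \<le> R) \<Longrightarrow>
       \<bar>g (\<lambda>i. if i < k then x i else 0) - f (\<lambda>i. if i < k then x i else 0)\<bar> \<le> e"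
proof -
  define \<theta> where "\<theta> = pi / (2 * R)"
  have \<theta>: "\<theta> > 0" using R by (simp add: \<theta>_def)
  \<comment> \<open>Freezing the coordinates from k on at 0 lets the coordinates below k separate
    the points.\<close>
  define S where "S = {y::nat \<Rightarrow> real. \<forall>i. y i \<in> (if i < k then {-1..1} else {0})}"
  define w where "w x = (\<lambda>i. if i < k then sin (\<theta> * x i) else 0)" for x :: "nat \<Rightarrow> real"
  define RR where "RR = {P. continuous_on S P \<and> trig_poly k (\<lambda>x. P (w x))}"
  define h where "h y = g (\<lambda>i. if i < k then arcsin (y i) / \<theta> else 0)" for y
  have coord: "(\<lambda>y. y i) \<in> RR" if "i < k" for i
  proof -
    have "(\<Sum>j<k. (if j = i then \<theta> else 0) * x j) = \<theta> * x i" for x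
      using that by (simp add: if_distrib[of "\<lambda>u. u * _"] sum.delta cong: if_cong)
    then have "trig_poly k (\<lambda>x. sin (\<theta> * x i))"
      using trig_poly.sin[of k "\<lambda>j. if j = i then \<theta> else 0"] by simp
    moreover have "continuous_on S (\<lambda>y. y i)"
      by (rule continuous_on_product_then_coordinatewise[OF continuous_on_id])
    ultimately show ?thesis using that by (simp add: RR_def w_def)
  qed
  interpret function_ring_on RR S
  proof
    show "compact S" unfolding S_def by (rule compact_unit_cube)
    show "\<exists>f\<in>RR. f x \<noteq> f y" if xy: "x \<in> S" "y \<in> S" "x \<noteq> y" for x y
    proof -
      obtain i where i: "x i \<noteq> y i" using xy by auto
      have "i < k"
      proof (rule ccontr)
        assume "\<not> i < k"
        then have "x i = 0" "y i = 0" using xy by (auto simp: S_def dest!: spec[of _ i])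
        then show False using i by simp
      qed
      then show ?thesis using coord i by (intro bexI[of _ "\<lambda>y. y i"]) auto
    qed
  qed (auto simp: RR_def trig_poly_const intro!: trig_poly.add trig_poly_mult continuous_intros)
  have ch: "continuous_on S h"
  proof -
    have 1: "continuous_on S (\<lambda>y. \<lambda>i. if i < k then arcsin (y i) / \<theta> else 0)"
    proof (rule continuous_on_coordinatewise_then_product)
      fix i
      show "continuous_on S (\<lambda>y. if i < k then arcsin (y i) / \<theta> else 0)"
      proof (cases "i < k")
        case True
        have "continuous_on S (\<lambda>y. y i)"
          by (rule continuous_on_product_then_coordinatewise[OF continuous_on_id])
        moreover have "-1 \<le> y i \<and> y i \<le> 1" if "y \<in> S" for y
          using that True by (auto simp: S_def dest: spec[of _ i])
        ultimately have "continuous_on S (\<lambda>y. arcsin (y i))"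
          by (intro continuous_on_arcsin) auto
        then show ?thesis using True by (auto intro!: continuous_intros simp: \<theta>_def R less_imp_neq)
      qed simp
    qed
    show ?thesis
      unfolding h_def
      by (rule continuous_on_compose2[OF g 1]) auto
  qed
  obtain P where P: "P \<in> RR" "\<And>y. y \<in> S \<Longrightarrow> \<bar>h y - P y\<bar> < e"
    using Stone_Weierstrass_basic[OF ch e] by auto
  show ?thesis
  proof (rule that[of "\<lambda>x. P (w x)"])
    show "trig_poly k (\<lambda>x. P (w x))" using P by (simp add: RR_def)
    have wS: "w x \<in> S" for x by (auto simp: w_def S_def)
    show "\<bar>P (w (\<lambda>i. if i < k then x i else 0))\<bar> \<le> K + e" for x
    proof -
      have "\<bar>h (w (\<lambda>i. if i < k then x i else 0))\<bar> \<le> K" by (simp add: h_def K)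
      then show ?thesis using P(2)[OF wS[of "\<lambda>i. if i < k then x i else 0"]] by linarith
    qed
    show "\<bar>g (\<lambda>i. if i < k then x i else 0) - P (w (\<lambda>i. if i < k then x i else 0))\<bar> \<le> e"
      if x: "\<And>i. i < k \<Longrightarrow> \<bar>x i\<bar> \<le> R" for x
    proof -
      have "arcsin (sin (\<theta> * x i)) / \<theta> = x i" if "i < k" for i
      proof -
        have "\<bar>\<theta> * x i\<bar> \<le> \<theta> * R" using x[OF that] \<theta> by (simp add: abs_mult)
        also have "\<theta> * R = pi / 2" using R by (simp add: \<theta>_def)
        finally have "arcsin (sin (\<theta> * x i)) = \<theta> * x i" by (intro arcsin_sin) auto
        then show ?thesis using \<theta> by simp
      qed
      then have "(\<lambda>i. if i < k then arcsin (w (\<lambda>i. if i < k then x i else 0) i) / \<theta> else 0) =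
          (\<lambda>i. if i < k then x i else 0)"
        by (auto simp: w_def)
      then have "h (w (\<lambda>i. if i < k then x i else 0)) = g (\<lambda>i. if i < k then x i else 0)"
        by (simp only: h_def)
      then show ?thesis using P(2)[OF wS[of "\<lambda>i. if i < k then x i else 0"]] by linarith
    qed
  qed
qed

lemma measurable_continuous_coordinates:
  fixes g :: "(nat \<Rightarrow> real) \<Rightarrow> real"
  assumes g: "continuous_on UNIV g" and V: "\<And>i. i < k \<Longrightarrow> V i \<in> borel_measurable M"
  shows "(\<lambda>\<omega>. g (\<lambda>i. if i < k then V i \<omega> else 0)) \<in> borel_measurable M"
proof -
  have 1: "(\<lambda>\<omega> i. if i < k then V i \<omega> else 0) \<in> borel_measurable M"
  proof (rule measurable_coordinatewise_then_product)
    show "(\<lambda>\<omega>. if i < k then V i \<omega> else 0) \<in> borel_measurable M" for i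
      by (cases "i < k") (use V in auto)
  qed
  have "g \<in> borel_measurable borel" using g by (rule borel_measurable_continuous_onI)
  with 1 show ?thesis by (rule measurable_compose)
qed

text \<open>On the box the error is at most e. Off the box it is at most 2K + e, and there the sum
  of squares exceeds R^2, so Chebyshev's inequality bounds this contribution by second
  moments.\<close>

lemma trig_poly_approx_integral:
  fixes g f :: "(nat \<Rightarrow> real) \<Rightarrow> real"
  assumes "prob_space M" and g: "continuous_on UNIV g" and K: "\<And>x. \<bar>g x\<bar> \<le> K" and e: "e > 0" and R: "R > 0"
    and f: "trig_poly k f" "\<And>x. \<bar>f (\<lambda>i. if i < k then x i else 0)\<bar> \<le> K + e"
    "\<And>x. (\<And>i. i < k \<Longrightarrow> \<bar>x i\<bar> \<le> R) \<Longrightarrow>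
       \<bar>g (\<lambda>i. if i < k then x i else 0) - f (\<lambda>i. if i < k then x i else 0)\<bar> \<le> e"
    and V: "\<And>i. i < k \<Longrightarrow> V i \<in> borel_measurable M" "\<And>i. i < k \<Longrightarrow> integrable M (\<lambda>\<omega>. (V i \<omega>)\<^sup>2)"
    "\<And>i. i < k \<Longrightarrow> (\<integral>\<omega>. (V i \<omega>)\<^sup>2 \<partial>M) \<le> C"
  shows "\<bar>(\<integral>\<omega>. g (\<lambda>i. if i < k then V i \<omega> else 0) \<partial>M) - (\<integral>\<omega>. f (\<lambda>i. if i < k then V i \<omega> else 0) \<partial>M)\<bar>
     \<le> e + (2 * K + e) * (real k * C) / R\<^sup>2"
proof -
  interpret prob_space M by fact
  let ?v = "\<lambda>\<omega>. (\<lambda>i. if i < k then V i \<omega> else 0)"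
  have K0: "K \<ge> 0" using K[of undefined] by linarith
  have ig: "integrable M (\<lambda>\<omega>. g (?v \<omega>))"
    using measurable_continuous_coordinates[OF g, of k V M] V K by (intro integrable_const_bound[of _ K]) auto
  have if': "integrable M (\<lambda>\<omega>. f (?v \<omega>))"
    using trig_poly_integrable[OF assms(1) f(1)] V by auto
  have pt: "\<bar>g (?v \<omega>) - f (?v \<omega>)\<bar> \<le> e + (2 * K + e) / R\<^sup>2 * (\<Sum>i<k. (V i \<omega>)\<^sup>2)" for \<omega>
  proof (cases "\<forall>i<k. \<bar>V i \<omega>\<bar> \<le> R")
    case True
    then have "\<bar>g (?v \<omega>) - f (?v \<omega>)\<bar> \<le> e" by (intro f) auto
    moreover have "0 \<le> (2 * K + e) / R\<^sup>2 * (\<Sum>i<k. (V i \<omega>)\<^sup>2)"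
      using K0 e by (intro mult_nonneg_nonneg sum_nonneg) auto
    ultimately show ?thesis by linarith
  next
    case False
    then obtain j where j: "j < k" "R < \<bar>V j \<omega>\<bar>" by (auto simp: not_le)
    have "R\<^sup>2 \<le> (V j \<omega>)\<^sup>2" using j R by (metis less_imp_le abs_le_square_iff abs_of_pos)
    also have "\<dots> \<le> (\<Sum>i<k. (V i \<omega>)\<^sup>2)" using j by (intro member_le_sum) auto
    finally have "1 \<le> (\<Sum>i<k. (V i \<omega>)\<^sup>2) / R\<^sup>2" using R by simp
    then have "(2 * K + e) * 1 \<le> (2 * K + e) * ((\<Sum>i<k. (V i \<omega>)\<^sup>2) / R\<^sup>2)"
      using K0 e by (intro mult_left_mono) auto
    moreover have "\<bar>g (?v \<omega>) - f (?v \<omega>)\<bar> \<le> 2 * K + e"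
      using K[of "?v \<omega>"] f(2)[of "\<lambda>i. V i \<omega>"] by linarith
    ultimately show ?thesis using e by simp
  qed
  have "\<bar>(\<integral>\<omega>. g (?v \<omega>) \<partial>M) - (\<integral>\<omega>. f (?v \<omega>) \<partial>M)\<bar> = \<bar>\<integral>\<omega>. g (?v \<omega>) - f (?v \<omega>) \<partial>M\<bar>"
    using ig if' by simp
  also have "\<dots> \<le> (\<integral>\<omega>. \<bar>g (?v \<omega>) - f (?v \<omega>)\<bar> \<partial>M)" by (rule integral_abs_bound)
  also have "\<dots> \<le> (\<integral>\<omega>. e + (2 * K + e) / R\<^sup>2 * (\<Sum>i<k. (V i \<omega>)\<^sup>2) \<partial>M)"
    using ig if' V pt by (intro integral_mono integrable_abs Bochner_Integration.integrable_diff
        Bochner_Integration.integrable_add integrable_mult_right Bochner_Integration.integrable_sum) auto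
  also have "\<dots> = e + (2 * K + e) / R\<^sup>2 * (\<Sum>i<k. \<integral>\<omega>. (V i \<omega>)\<^sup>2 \<partial>M)"
    using V by (subst Bochner_Integration.integral_add)
      (auto simp: prob_space intro!: integrable_divide integrable_mult_right Bochner_Integration.integrable_sum)
  also have "\<dots> \<le> e + (2 * K + e) / R\<^sup>2 * (\<Sum>i<k. C)"
    using K0 e V by (intro add_left_mono mult_left_mono sum_mono) auto
  finally show ?thesis by simp
qed

text \<open>The common second moment bound C plays the part of tightness: it fixes the box radius R,
  hence one trigonometric polynomial, before the filter is used. The filter is arbitrary since the
  parameters move in the plane rather than along a sequence.\<close>

lemma cramer_wold:
  fixes X :: "'i \<Rightarrow> nat \<Rightarrow> 'a \<Rightarrow> real" and g :: "(nat \<Rightarrow> real) \<Rightarrow> real"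
  assumes MN: "prob_space M" "prob_space N"
    and X: "\<forall>\<^sub>F p in F. \<forall>i<k. X p i \<in> borel_measurable M \<and> integrable M (\<lambda>\<omega>. (X p i \<omega>)\<^sup>2) \<and> (\<integral>\<omega>. (X p i \<omega>)\<^sup>2 \<partial>M) \<le> C"
    and Y: "\<And>i. i < k \<Longrightarrow> Y i \<in> borel_measurable N" "\<And>i. i < k \<Longrightarrow> integrable N (\<lambda>\<omega>. (Y i \<omega>)\<^sup>2)"
      "\<And>i. i < k \<Longrightarrow> (\<integral>\<omega>. (Y i \<omega>)\<^sup>2 \<partial>N) \<le> C"
    and c: "\<And>c. ((\<lambda>p. \<integral>\<omega>. cos (\<Sum>i<k. c i * X p i \<omega>) \<partial>M) \<longlongrightarrow> (\<integral>\<omega>. cos (\<Sum>i<k. c i * Y i \<omega>) \<partial>N)) F"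
    and s: "\<And>c. ((\<lambda>p. \<integral>\<omega>. sin (\<Sum>i<k. c i * X p i \<omega>) \<partial>M) \<longlongrightarrow> (\<integral>\<omega>. sin (\<Sum>i<k. c i * Y i \<omega>) \<partial>N)) F"
    and g: "continuous_on UNIV g" and K: "\<And>x. \<bar>g x\<bar> \<le> K"
  shows "((\<lambda>p. \<integral>\<omega>. g (\<lambda>i. if i < k then X p i \<omega> else 0) \<partial>M) \<longlongrightarrow>
      (\<integral>\<omega>. g (\<lambda>i. if i < k then Y i \<omega> else 0) \<partial>N)) F"
proof (rule tendstoI)
  fix e' :: real assume "e' > 0"
  \<comment> \<open>The two comparisons of g with f cost 2e each, and the convergence for f costs
    e.\<close>
  define e where "e = e' / 5"
  have e: "e > 0" using \<open>e' > 0\<close> by (simp add: e_def)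
  have K0: "K \<ge> 0" using K[of undefined] by linarith
  \<comment> \<open>R is at least 1, so (2K + e) k C <= e R <= e R^2.\<close>
  define R where "R = 1 + (2 * K + e) * (real k * \<bar>C\<bar>) / e"
  have R1: "R \<ge> 1" using K0 e by (simp add: R_def)
  have "(2 * K + e) * (real k * C) \<le> (2 * K + e) * (real k * \<bar>C\<bar>)"
    using K0 e by (intro mult_left_mono) auto
  also have "\<dots> \<le> e * R" using e by (simp add: R_def field_simps)
  also have "\<dots> \<le> e * R\<^sup>2" using e R1 by (simp add: power2_eq_square)
  finally have small: "(2 * K + e) * (real k * C) / R\<^sup>2 \<le> e" using R1 by (simp add: divide_le_eq)
  obtain f where f: "trig_poly k f" "\<And>x. \<bar>f (\<lambda>i. if i < k then x i else 0)\<bar> \<le> K + e"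
    "\<And>x. (\<And>i. i < k \<Longrightarrow> \<bar>x i\<bar> \<le> R) \<Longrightarrow>
       \<bar>g (\<lambda>i. if i < k then x i else 0) - f (\<lambda>i. if i < k then x i else 0)\<bar> \<le> e"
    using trig_poly_approx[OF g K e, of R k] R1 by auto
  have R0: "R > 0" using R1 by simp
  have "\<forall>\<^sub>F p in F. \<forall>i<k. X p i \<in> borel_measurable M" using X by eventually_elim auto
  note trig_poly_tendsto[OF MN f(1) this Y(1) c s]
  then have "\<forall>\<^sub>F p in F. dist (\<integral>\<omega>. f (\<lambda>i. if i < k then X p i \<omega> else 0) \<partial>M) (\<integral>\<omega>. f (\<lambda>i. if i < k then Y i \<omega> else 0) \<partial>N) < e"
    using e by (auto dest: tendstoD)
  with X show "\<forall>\<^sub>F p in F. dist (\<integral>\<omega>. g (\<lambda>i. if i < k then X p i \<omega> else 0) \<partial>M) (\<integral>\<omega>. g (\<lambda>i. if i < k then Y i \<omega> else 0) \<partial>N) < e'"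
  proof eventually_elim
    case (elim p)
    have a: "\<bar>(\<integral>\<omega>. g (\<lambda>i. if i < k then X p i \<omega> else 0) \<partial>M) - (\<integral>\<omega>. f (\<lambda>i. if i < k then X p i \<omega> else 0) \<partial>M)\<bar>
        \<le> e + (2 * K + e) * (real k * C) / R\<^sup>2"
      by (rule trig_poly_approx_integral[OF MN(1) g K e R0 f]) (use elim in auto)
    have b: "\<bar>(\<integral>\<omega>. g (\<lambda>i. if i < k then Y i \<omega> else 0) \<partial>N) - (\<integral>\<omega>. f (\<lambda>i. if i < k then Y i \<omega> else 0) \<partial>N)\<bar>
        \<le> e + (2 * K + e) * (real k * C) / R\<^sup>2"
      by (rule trig_poly_approx_integral[OF MN(2) g K e R0 f]) (use Y in auto)
    show ?case using a b small elim(2) unfolding dist_real_def e_def by linarith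
  qed
qed


section \<open>Weak convergence in the space of continuous paths\<close>

abbreviation sq_integral :: "'z measure \<Rightarrow> ('z \<Rightarrow> real) \<Rightarrow> ennreal" where
  "sq_integral M f \<equiv> \<integral>\<^sup>+x. ennreal ((f x)\<^sup>2) \<partial>M"

section \<open>Piecewise linear interpolation at dyadic points\<close>

lemma hat_sum:
  assumes "0 \<le> u" "u \<le> real n"
  shows "(\<Sum>i\<le>n. max 0 (1 - \<bar>u - real i\<bar>)) = 1"
  using assms
proof (induction n)
  case (Suc n)
  show ?case
  proof (cases "u \<le> real n")
    case True
    then show ?thesis using Suc by simp
  next
    case False
    have "(\<Sum>i<n. max 0 (1 - \<bar>u - real i\<bar>)) = 0"
    proof (rule sum.neutral, safe)
      fix i assume "i < n"
      then have "real i + 1 \<le> real n" by linarith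
      then show "max 0 (1 - \<bar>u - real i\<bar>) = 0" using False by simp
    qed
    then show ?thesis using Suc.prems False by (simp add: lessThan_Suc_atMost[symmetric])
  qed
qed simp

definition interp :: "nat \<Rightarrow> (nat \<Rightarrow> real) \<Rightarrow> real \<Rightarrow> real" where
  "interp m x = (\<lambda>t\<in>{0..1}. \<Sum>i\<le>2^m. x i * max 0 (1 - \<bar>2^m * t - real i\<bar>))"

lemma interp_in_C01: "interp m x \<in> mspace C01"
proof -
  have "continuous_on {0..1} (\<lambda>t. \<Sum>i\<le>2^m. x i * max 0 (1 - \<bar>2^m * t - real i\<bar>))"
    by (intro continuous_intros)
  then have "continuous_on {0..1} (interp m x)"
    by (rule continuous_on_cong[THEN iffD1, rotated 2]) (auto simp: interp_def)
  then show ?thesis by (simp add: mspace_C01 interp_def)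
qed

lemma interp_cong: "(\<And>i. i \<le> 2^m \<Longrightarrow> x i = y i) \<Longrightarrow> interp m x = interp m y"
  unfolding interp_def by (intro restrict_ext sum.cong) auto

lemma mdist_C01_le:
  assumes "f \<in> mspace C01" "g \<in> mspace C01" "\<And>t. t \<in> {0..1} \<Longrightarrow> \<bar>f t - g t\<bar> \<le> c"
  shows "mdist C01 f g \<le> c"
  unfolding mdist_C01[OF assms(1,2)] by (rule cSUP_least) (use assms(3) in auto)

lemma mdist_interp_le: "mdist C01 (interp m x) (interp m y) \<le> (\<Sum>i<2^m+1. \<bar>x i - y i\<bar>)"
proof (rule mdist_C01_le[OF interp_in_C01 interp_in_C01])
  fix t :: real assume t: "t \<in> {0..1}"
  have "\<bar>interp m x t - interp m y t\<bar> = \<bar>\<Sum>i\<le>2^m. (x i - y i) * max 0 (1 - \<bar>2^m * t - real i\<bar>)\<bar>"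
    using t by (simp add: interp_def sum_subtractf[symmetric] algebra_simps)
  also have "\<dots> \<le> (\<Sum>i\<le>2^m. \<bar>(x i - y i) * max 0 (1 - \<bar>2^m * t - real i\<bar>)\<bar>)" by (rule sum_abs)
  also have "\<dots> \<le> (\<Sum>i\<le>2^m. \<bar>x i - y i\<bar>)"
    by (intro sum_mono) (auto simp: abs_mult intro: mult_left_le)
  finally show "\<bar>interp m x t - interp m y t\<bar> \<le> (\<Sum>i<2^m+1. \<bar>x i - y i\<bar>)"
    by (simp add: lessThan_Suc_atMost)
qed

text \<open>The hats sum to 1, so the error is a convex combination of the differences f(t) -
  f(i/2^m), and only grid points within 2^-m of t carry weight.\<close>

lemma interp_error:
  assumes t: "t \<in> {0..1}"
    and B: "\<And>i. i \<le> 2^m \<Longrightarrow> \<bar>2^m * t - real i\<bar> < 1 \<Longrightarrow> \<bar>f t - f (real i / 2^m)\<bar> \<le> B"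
  shows "\<bar>f t - interp m (\<lambda>i. f (real i / 2^m)) t\<bar> \<le> B"
proof -
  define h where "h i = max 0 (1 - \<bar>2^m * t - real i\<bar>)" for i
  have h1: "(\<Sum>i\<le>2^m. h i) = 1" unfolding h_def by (rule hat_sum) (use t in auto)
  have "f t - interp m (\<lambda>i. f (real i / 2^m)) t = (\<Sum>i\<le>2^m. h i) * f t - (\<Sum>i\<le>2^m. f (real i / 2^m) * h i)"
    using t by (simp add: h1) (simp add: interp_def h_def)
  also have "\<dots> = (\<Sum>i\<le>2^m. (f t - f (real i / 2^m)) * h i)"
    unfolding left_diff_distrib sum_subtractf sum_distrib_right by (simp add: mult.commute)
  also have "\<bar>\<dots>\<bar> \<le> (\<Sum>i\<le>2^m. \<bar>(f t - f (real i / 2^m)) * h i\<bar>)" by (rule sum_abs)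
  also have "\<dots> \<le> (\<Sum>i\<le>2^m. B * h i)"
  proof (rule sum_mono)
    fix i assume i: "i \<in> {..2^m::nat}"
    show "\<bar>(f t - f (real i / 2^m)) * h i\<bar> \<le> B * h i"
    proof (cases "\<bar>2^m * t - real i\<bar> < 1")
      case True
      then show ?thesis using B[of i] i by (auto simp: abs_mult h_def intro!: mult_right_mono)
    qed (auto simp: h_def)
  qed
  also have "\<dots> = B" by (simp add: sum_distrib_left[symmetric] h1)
  finally show ?thesis .
qed

lemma restrict_in_C01:
  assumes "continuous_on {0..1} f" shows "restrict f {0..1} \<in> mspace C01"
proof -
  have "continuous_on {0..1} (restrict f {0..1})"
    using assms by (rule continuous_on_cong[THEN iffD1, rotated 2]) auto
  then show ?thesis by (simp add: mspace_C01)
qed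

lemma interp_tendsto:
  assumes f: "continuous_on {0..1} f"
  shows "(\<lambda>m. mdist C01 (restrict f {0..1}) (interp m (\<lambda>i. f (real i / 2^m)))) \<longlonglongrightarrow> 0"
proof (rule LIMSEQ_I)
  note fC = restrict_in_C01[OF f]
  fix e :: real assume e: "e > 0"
  have "uniformly_continuous_on {0..1} f" using f by (intro compact_uniformly_continuous) auto
  then obtain d where d: "d > 0" "\<And>s t. s \<in> {0..1} \<Longrightarrow> t \<in> {0..1} \<Longrightarrow> \<bar>t - s\<bar> < d \<Longrightarrow> \<bar>f t - f s\<bar> < e / 2"
    using e unfolding uniformly_continuous_on_def dist_real_def by (metis half_gt_zero)
  obtain n0 where n0: "(1/2::real)^n0 < d" using real_arch_pow_inv[of d "1/2"] d by auto
  show "\<exists>no. \<forall>m\<ge>no. norm (mdist C01 (restrict f {0..1}) (interp m (\<lambda>i. f (real i / 2^m))) - 0) < e"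
  proof (intro exI allI impI)
    fix m assume m: "n0 \<le> m"
    have dm: "1 / 2^m < d"
      using n0 power_decreasing[OF m, of "1/2::real"] by (simp add: power_one_over)
    have "mdist C01 (restrict f {0..1}) (interp m (\<lambda>i. f (real i / 2^m))) \<le> e / 2"
    proof (rule mdist_C01_le[OF fC interp_in_C01])
      fix t :: real assume t: "t \<in> {0..1}"
      have "\<bar>f t - interp m (\<lambda>i. f (real i / 2^m)) t\<bar> \<le> e / 2"
      proof (rule interp_error[OF t])
        fix i :: nat assume i: "i \<le> 2^m" "\<bar>2^m * t - real i\<bar> < 1"
        have "t - real i / 2^m = (2^m * t - real i) / 2^m" by (simp add: field_simps)
        then have "\<bar>t - real i / 2^m\<bar> = \<bar>2^m * t - real i\<bar> / 2^m" by (simp add: abs_divide)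
        also have "\<dots> < d" using i(2) dm by (smt (verit) divide_strict_right_mono zero_less_power)
        finally have "\<bar>t - real i / 2^m\<bar> < d" .
        moreover have "real i / 2^m \<in> {0..1}" using i(1) by (auto simp: divide_le_eq)
        ultimately show "\<bar>f t - f (real i / 2^m)\<bar> \<le> e / 2" using d(2)[of "real i / 2^m" t] t by auto
      qed
      then show "\<bar>restrict f {0..1} t - interp m (\<lambda>i. f (real i / 2^m)) t\<bar> \<le> e / 2" using t by simp
    qed
    then show "norm (mdist C01 (restrict f {0..1}) (interp m (\<lambda>i. f (real i / 2^m))) - 0) < e"
      using e by simp
  qed
qed

section \<open>Chaining along dyadic levels\<close>

definition dyadic_variation :: "(real \<Rightarrow> real) \<Rightarrow> nat \<Rightarrow> real" where
  "dyadic_variation f n = (\<Sum>i<2^n. (f (real (i + 1) / 2^n) - f (real i / 2^n))\<^sup>2)"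

text \<open>The maximal increment of level n is dominated by a sum of squares, whose expectation is
  controlled by second moments. The inequality 2xy <= x^2 + y^2 replaces a square root, so that the
  bound is linear in the variation and can be integrated termwise.\<close>

lemma increment_le_variation:
  assumes "i < 2^n" "r > 0"
  shows "\<bar>f (real (i + 1) / 2^n) - f (real i / 2^n)\<bar> \<le> (r^n + dyadic_variation f n / r^n) / 2"
proof -
  define d where "d = \<bar>f (real (i + 1) / 2^n) - f (real i / 2^n)\<bar>"
  have rn: "r^n > 0" using assms by simp
  have "d\<^sup>2 \<le> dyadic_variation f n"
    unfolding dyadic_variation_def d_def power2_abs by (rule member_le_sum) (use assms in auto)
  moreover have "2 * r^n * d \<le> (r^n)\<^sup>2 + d\<^sup>2"
    using sum_squares_bound[of "r^n" d] by simp
  moreover have "r^n * (r^n + dyadic_variation f n / r^n) = (r^n)\<^sup>2 + dyadic_variation f n"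
    using rn by (simp add: power2_eq_square distrib_left del: power_eq_0_iff)
  ultimately have "r^n * (2 * d) \<le> r^n * (r^n + dyadic_variation f n / r^n)"
    by (simp add: mult.left_commute mult.commute)
  then have "2 * d \<le> r^n + dyadic_variation f n / r^n" using rn by (rule mult_left_le_imp_le)
  then show ?thesis unfolding d_def[symmetric] by simp
qed

text \<open>The point t is the limit of its dyadic floors j(n)/2^n, and consecutive floors differ by
  at most one step of the finer grid, so the increments telescope along the levels. The sum is taken
  in \<open>ennreal\<close>, so divergence on exceptional paths is harmless.\<close>

lemma chaining:
  assumes f: "continuous_on {0..1} f" and r: "r > 0" and t: "t \<in> {0..1}"
    and i: "i \<le> 2^m" "\<bar>2^m * t - real i\<bar> < 1"
  shows "ennreal \<bar>f t - f (real i / 2^m)\<bar> \<le>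
     (\<Sum>n. ennreal ((r^(n+m) + dyadic_variation f (n+m) / r^(n+m)) / 2))"
proof -
  define b where "b n = (r^n + dyadic_variation f n / r^n) / 2" for n
  have b0: "b n \<ge> 0" for n unfolding b_def dyadic_variation_def using r by (auto intro!: add_nonneg_nonneg divide_nonneg_pos sum_nonneg)
  have b: "\<bar>f (real (i + 1) / 2^n) - f (real i / 2^n)\<bar> \<le> b n" if "i < 2^n" for i n
    unfolding b_def by (rule increment_le_variation[OF that r])
  define j where "j n = nat \<lfloor>2^n * t\<rfloor>" for n
  have jle: "real (j n) \<le> 2^n * t" "2^n * t < real (j n) + 1" for n
    using t by (auto simp: j_def)
  have j2: "j n \<le> 2^n" for n
  proof -
    have "real (j n) \<le> 2^n" by (rule order_trans[OF jle(1)]) (use t in simp)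
    then show ?thesis by simp
  qed
  have tend: "(\<lambda>n. real (j n) / 2^n) \<longlonglongrightarrow> t"
  proof (rule LIMSEQ_I)
    fix e :: real assume "e > 0"
    then obtain n0 where n0: "(1/2::real)^n0 < e" using real_arch_pow_inv[of e "1/2"] by auto
    have "\<bar>real (j n) / 2^n - t\<bar> < e" if "n \<ge> n0" for n
    proof -
      have "\<bar>real (j n) / 2^n - t\<bar> = \<bar>real (j n) - 2^n * t\<bar> / 2^n"
      proof -
        have "real (j n) / 2^n - t = (real (j n) - 2^n * t) / 2^n" by (simp add: diff_divide_distrib)
        then show ?thesis by simp
      qed
      also have "\<dots> \<le> 1 / 2^n" using jle[of n] by (intro divide_right_mono) auto
      also have "\<dots> \<le> (1/2)^n0" using power_decreasing[OF that, of "1/2::real"] by (simp add: power_one_over)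
      finally show ?thesis using n0 by simp
    qed
    then show "\<exists>no. \<forall>n\<ge>no. norm (real (j n) / 2^n - t) < e" by auto
  qed
  have mem: "real (j n) / 2^n \<in> {0..1}" for n
    using j2[of n] by (auto simp: divide_le_eq)
  have step: "\<bar>f (real (j (Suc n)) / 2^(Suc n)) - f (real (j n) / 2^n)\<bar> \<le> b (Suc n)" for n
  proof -
    have eq: "real (j n) / 2^n = real (2 * j n) / 2^(Suc n)" by simp
    have "real (j (Suc n)) < real (2 * j n + 2)" "real (2 * j n) < real (j (Suc n)) + 1"
      using jle[of n] jle[of "Suc n"] by auto
    then have "j (Suc n) = 2 * j n \<or> j (Suc n) = 2 * j n + 1" by linarith
    then show ?thesis
    proof
      assume "j (Suc n) = 2 * j n" then show ?thesis using b0[of "Suc n"] by simp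
    next
      assume a: "j (Suc n) = 2 * j n + 1"
      then have "2 * j n < 2^(Suc n)" using j2[of "Suc n"] by simp
      from b[OF this] show ?thesis unfolding eq a by simp
    qed
  qed
  \<comment> \<open>The term of level m pays for the passage from i to the floor \<open>j m\<close>,
    since i may be the right neighbour of t.\<close>
  have partial: "\<bar>f (real (j (q + m)) / 2^(q + m)) - f (real i / 2^m)\<bar> \<le> (\<Sum>n<Suc q. b (n + m))" for q
  proof (induction q)
    case 0
    have "real i < real (j m + 2)" "real (j m) < real i + 1" using i(2) jle[of m] by auto
    then have "i = j m \<or> i = j m + 1" by linarith
    then show ?case
    proof
      assume "i = j m" then show ?thesis using b0[of m] by simp
    next
      assume a: "i = j m + 1"
      then have "j m < 2^m" using i(1) by simp
      from b[OF this] show ?thesis unfolding a by (simp add: abs_minus_commute)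
    qed
  next
    case (Suc q)
    then show ?case using step[of "q + m"] by simp
  qed
  have "(\<lambda>q. f (real (j (q + m)) / 2^(q + m))) \<longlonglongrightarrow> f t"
    using LIMSEQ_ignore_initial_segment[OF continuous_on_tendsto_compose[OF f tend t], of m] mem by simp
  then have A: "(\<lambda>q. ennreal \<bar>f (real (j (q + m)) / 2^(q + m)) - f (real i / 2^m)\<bar>) \<longlonglongrightarrow> ennreal \<bar>f t - f (real i / 2^m)\<bar>"
    by (intro tendsto_ennrealI tendsto_intros)
  have "ennreal \<bar>f (real (j (q + m)) / 2^(q + m)) - f (real i / 2^m)\<bar> \<le> (\<Sum>n. ennreal (b (n + m)))" for q
  proof -
    have "ennreal \<bar>f (real (j (q + m)) / 2^(q + m)) - f (real i / 2^m)\<bar> \<le> ennreal (\<Sum>n<Suc q. b (n + m))"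
      using partial by (rule ennreal_leI)
    also have "\<dots> = (\<Sum>n<Suc q. ennreal (b (n + m)))" using b0 by (subst sum_ennreal) auto
    also have "\<dots> \<le> (\<Sum>n. ennreal (b (n + m)))" by (rule sum_le_suminf) auto
    finally show ?thesis .
  qed
  then show ?thesis unfolding b_def[symmetric] by (intro LIMSEQ_le_const2[OF A]) blast
qed

lemma interp_chaining:
  assumes f: "continuous_on {0..1} f" and r: "r > 0"
  shows "ennreal (mdist C01 (restrict f {0..1}) (interp m (\<lambda>i. f (real i / 2^m)))) \<le>
     (\<Sum>n. ennreal ((r^(n+m) + dyadic_variation f (n+m) / r^(n+m)) / 2))" (is "_ \<le> ?S")
proof (cases ?S)
  case (real c)
  note fC = restrict_in_C01[OF f]
  have "mdist C01 (restrict f {0..1}) (interp m (\<lambda>i. f (real i / 2^m))) \<le> c"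
  proof (rule mdist_C01_le[OF fC interp_in_C01])
    fix t :: real assume t: "t \<in> {0..1}"
    have "\<bar>f t - interp m (\<lambda>i. f (real i / 2^m)) t\<bar> \<le> c"
    proof (rule interp_error[OF t])
      fix i :: nat assume i: "i \<le> 2^m" "\<bar>2^m * t - real i\<bar> < 1"
      have "ennreal \<bar>f t - f (real i / 2^m)\<bar> \<le> ennreal c"
        unfolding real(2)[symmetric] by (rule chaining[OF f r t i])
      then show "\<bar>f t - f (real i / 2^m)\<bar> \<le> c" using real by simp
    qed
    then show "\<bar>restrict f {0..1} t - interp m (\<lambda>i. f (real i / 2^m)) t\<bar> \<le> c" using t by simp
  qed
  then show ?thesis using real by (simp add: ennreal_leI)
qed simp

section \<open>Lipschitz functionals of continuous paths\<close>

lemma continuous_on_coordinate_lipschitz: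
  fixes g :: "(nat \<Rightarrow> real) \<Rightarrow> real"
  assumes g: "\<And>x y. \<bar>g x - g y\<bar> \<le> L * (\<Sum>i<k. \<bar>x i - y i\<bar>)"
  shows "continuous_on UNIV g"
  unfolding continuous_on_def
proof
  fix a :: "nat \<Rightarrow> real"
  have c: "continuous_on UNIV (\<lambda>x::nat \<Rightarrow> real. x i)" for i
    by (rule continuous_on_product_then_coordinatewise[OF continuous_on_id])
  have "continuous_on UNIV (\<lambda>x::nat \<Rightarrow> real. L * (\<Sum>i<k. \<bar>x i - a i\<bar>))"
    using c by (intro continuous_intros)
  then have "((\<lambda>x. L * (\<Sum>i<k. \<bar>x i - a i\<bar>)) \<longlongrightarrow> L * (\<Sum>i<k. \<bar>a i - a i\<bar>)) (at a)"
    unfolding continuous_on_def by blast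
  then have "((\<lambda>x. L * (\<Sum>i<k. \<bar>x i - a i\<bar>)) \<longlongrightarrow> 0) (at a)" by simp
  then have "((\<lambda>x. g x - g a) \<longlongrightarrow> 0) (at a)"
    by (rule Lim_null_comparison[rotated]) (use g in auto)
  then show "(g \<longlongrightarrow> g a) (at a within UNIV)" by (simp add: LIM_zero_iff)
qed

text \<open>Lipschitz functionals suffice as test functions and behave well under interpolation: on
  interpolated paths they become continuous functions of finitely many coordinates, and their error
  is linear in the uniform distance.\<close>

definition lipschitz_C01 :: "real \<Rightarrow> ((real \<Rightarrow> real) \<Rightarrow> real) \<Rightarrow> bool" where
  "lipschitz_C01 L \<Phi> \<longleftrightarrow> L \<ge> 0 \<and> (\<forall>f\<in>mspace C01. \<forall>g\<in>mspace C01. \<bar>\<Phi> f - \<Phi> g\<bar> \<le> L * mdist C01 f g)"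

lemma lipschitz_interp:
  assumes "lipschitz_C01 L \<Phi>"
  shows "\<bar>\<Phi> (interp m x) - \<Phi> (interp m y)\<bar> \<le> L * (\<Sum>i<2^m+1. \<bar>x i - y i\<bar>)"
proof -
  have "\<bar>\<Phi> (interp m x) - \<Phi> (interp m y)\<bar> \<le> L * mdist C01 (interp m x) (interp m y)"
    using assms interp_in_C01 by (auto simp: lipschitz_C01_def)
  also have "\<dots> \<le> L * (\<Sum>i<2^m+1. \<bar>x i - y i\<bar>)"
    using mdist_interp_le assms by (intro mult_left_mono) (auto simp: lipschitz_C01_def)
  finally show ?thesis .
qed

locale continuous_process =
  fixes M :: "'a measure" and X :: "real \<Rightarrow> 'a \<Rightarrow> real"
  assumes measurable_coord: "\<And>t. t \<in> {0..1} \<Longrightarrow> X t \<in> borel_measurable M"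
    and continuous_path: "\<And>\<omega>. \<omega> \<in> space M \<Longrightarrow> continuous_on {0..1} (\<lambda>t. X t \<omega>)"
begin

lemma path_in_C01: "\<omega> \<in> space M \<Longrightarrow> path01 X \<omega> \<in> mspace C01"
  unfolding path01_def by (intro restrict_in_C01 continuous_path)

lemma grid_measurable: "i < 2^m + 1 \<Longrightarrow> X (real i / 2^m) \<in> borel_measurable M"
proof (rule measurable_coord)
  assume "i < 2^m + 1"
  then have "real i \<le> real (2^m)" by linarith
  then show "real i / 2^m \<in> {0..1}" by (auto simp: divide_le_eq)
qed

lemma interp_functional_measurable:
  assumes "lipschitz_C01 L \<Phi>"
  shows "(\<lambda>\<omega>. \<Phi> (interp m (\<lambda>i. X (real i / 2^m) \<omega>))) \<in> borel_measurable M"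
proof -
  have eq: "interp m (\<lambda>i. X (real i / 2^m) \<omega>) = interp m (\<lambda>i. if i < 2^m + 1 then X (real i / 2^m) \<omega> else 0)" for \<omega>
    by (rule interp_cong) auto
  show ?thesis unfolding eq
    by (rule measurable_continuous_coordinates[OF continuous_on_coordinate_lipschitz[OF lipschitz_interp[OF assms]] grid_measurable])
qed

lemma interp_functional_tendsto:
  assumes "lipschitz_C01 L \<Phi>" "\<omega> \<in> space M"
  shows "(\<lambda>m. \<Phi> (interp m (\<lambda>i. X (real i / 2^m) \<omega>))) \<longlonglongrightarrow> \<Phi> (path01 X \<omega>)"
proof -
  have "(\<lambda>m. L * mdist C01 (path01 X \<omega>) (interp m (\<lambda>i. X (real i / 2^m) \<omega>))) \<longlonglongrightarrow> L * 0"
    using interp_tendsto[OF continuous_path[OF assms(2)]] unfolding path01_def by (intro tendsto_mult_left)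
  then have "(\<lambda>m. L * mdist C01 (path01 X \<omega>) (interp m (\<lambda>i. X (real i / 2^m) \<omega>))) \<longlonglongrightarrow> 0" by simp
  then have "(\<lambda>m. \<Phi> (interp m (\<lambda>i. X (real i / 2^m) \<omega>)) - \<Phi> (path01 X \<omega>)) \<longlonglongrightarrow> 0"
  proof (rule Lim_null_comparison[rotated], intro always_eventually allI)
    fix m
    have "\<bar>\<Phi> (path01 X \<omega>) - \<Phi> (interp m (\<lambda>i. X (real i / 2^m) \<omega>))\<bar> \<le> L * mdist C01 (path01 X \<omega>) (interp m (\<lambda>i. X (real i / 2^m) \<omega>))"
      using assms(1) path_in_C01[OF assms(2)] interp_in_C01 unfolding lipschitz_C01_def by blast
    then show "norm (\<Phi> (interp m (\<lambda>i. X (real i / 2^m) \<omega>)) - \<Phi> (path01 X \<omega>)) \<le> L * mdist C01 (path01 X \<omega>) (interp m (\<lambda>i. X (real i / 2^m) \<omega>))"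
      by (simp add: abs_minus_commute)
  qed
  then show ?thesis by (simp add: LIM_zero_iff)
qed

text \<open>A Lipschitz functional of the path is a pointwise limit of functionals of the dyadic
  values; this is the source of all measurability on \<open>C01\<close>.\<close>

lemma lipschitz_functional_measurable:
  assumes "lipschitz_C01 L \<Phi>"
  shows "(\<lambda>\<omega>. \<Phi> (path01 X \<omega>)) \<in> borel_measurable M"
  by (rule borel_measurable_LIMSEQ_real[OF interp_functional_tendsto[OF assms] interp_functional_measurable[OF assms]])

end

lemma mdist_C01_simps:
  "0 \<le> mdist C01 f g" "mdist C01 f g = mdist C01 g f"
  "f \<in> mspace C01 \<Longrightarrow> g \<in> mspace C01 \<Longrightarrow> h \<in> mspace C01 \<Longrightarrow> mdist C01 f h \<le> mdist C01 f g + mdist C01 g h"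
  "f \<in> mspace C01 \<Longrightarrow> mdist C01 f f = 0"
  by (simp_all add: mdist_commute mdist_triangle)

text \<open>An infimal convolution: each map f -> h g + L d(f, g) is L-Lipschitz, and the lower
  bound -K makes the infimum finite, so the Lipschitz constant survives. With h = 0 it is a multiple
  of the distance to a set; with h a continuous functional it is an approximation from
  below.\<close>

lemma lipschitz_envelope:
  assumes A: "A \<noteq> {}" "A \<subseteq> mspace C01" and h: "\<And>g. g \<in> A \<Longrightarrow> h g \<ge> - K" and L: "L \<ge> 0"
  shows "lipschitz_C01 L (\<lambda>f. INF g\<in>A. h g + L * mdist C01 f g)"
proof -
  have bdd: "bdd_below ((\<lambda>g. h g + L * mdist C01 f g) ` A)" for f
  proof (rule bdd_belowI2)
    fix g assume "g \<in> A"
    then show "- K \<le> h g + L * mdist C01 f g" using h[of g] L mdist_C01_simps(1)[of f g]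
      by (smt (verit) mult_nonneg_nonneg)
  qed
  have 1: "(INF g\<in>A. h g + L * mdist C01 f g) - L * mdist C01 f f' \<le> (INF g\<in>A. h g + L * mdist C01 f' g)"
    if "f \<in> mspace C01" "f' \<in> mspace C01" for f f'
  proof (rule cINF_greatest[OF A(1)])
    fix g assume g: "g \<in> A"
    have "(INF g\<in>A. h g + L * mdist C01 f g) \<le> h g + L * mdist C01 f g" by (rule cINF_lower[OF bdd g])
    moreover have "L * mdist C01 f g \<le> L * (mdist C01 f f' + mdist C01 f' g)"
      using mdist_C01_simps(3)[of f f' g] that g A L by (intro mult_left_mono) auto
    ultimately show "(INF g\<in>A. h g + L * mdist C01 f g) - L * mdist C01 f f' \<le> h g + L * mdist C01 f' g"
      by (simp add: distrib_left)
  qed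
  show ?thesis
    unfolding lipschitz_C01_def
  proof (intro conjI ballI L)
    fix f f' assume "f \<in> mspace C01" "f' \<in> mspace C01"
    with 1[of f f'] 1[of f' f] show "\<bar>(INF g\<in>A. h g + L * mdist C01 f g) - (INF g\<in>A. h g + L * mdist C01 f' g)\<bar> \<le> L * mdist C01 f f'"
      by (simp add: mdist_C01_simps(2)[of f' f])
  qed
qed

lemma openin_C01:
  "openin (mtopology_of C01) U \<longleftrightarrow> U \<subseteq> mspace C01 \<and>
     (\<forall>f\<in>U. \<exists>e>0. \<forall>g\<in>mspace C01. mdist C01 f g < e \<longrightarrow> g \<in> U)"
proof -
  interpret Metric_space "mspace C01" "mdist C01" by (rule Metric_space_mspace_mdist)
  show ?thesis
    unfolding mtopology_of_def openin_mtopology by (fastforce simp: mball_def subset_iff)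
qed

text \<open>An open set is the region where the distance to its complement is positive, and this
  distance is a Lipschitz functional.\<close>

lemma (in continuous_process) path_measurable:
  "path01 X \<in> M \<rightarrow>\<^sub>M borel_of (mtopology_of C01)"
  unfolding borel_of_def
proof (rule measurable_measure_of)
  show "{U. openin (mtopology_of C01) U} \<subseteq> Pow (topspace (mtopology_of C01))"
    by (auto simp: openin_C01)
  show "path01 X \<in> space M \<rightarrow> topspace (mtopology_of C01)" using path_in_C01 by auto
  fix U assume "U \<in> {U. openin (mtopology_of C01) U}"
  then have U: "U \<subseteq> mspace C01" "\<And>f. f \<in> U \<Longrightarrow> \<exists>e>0. \<forall>g\<in>mspace C01. mdist C01 f g < e \<longrightarrow> g \<in> U"
    by (auto simp: openin_C01)
  show "path01 X -` U \<inter> space M \<in> sets M"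
  proof (cases "mspace C01 - U = {}")
    \<comment> \<open>An empty complement is treated apart, because the distance to it would be an
      infimum over the empty set.\<close>
    case True
    then have "path01 X -` U \<inter> space M = space M" using path_in_C01 U by auto
    then show ?thesis by simp
  next
    case False
    define d where "d f = (INF g\<in>mspace C01 - U. 0 + 1 * mdist C01 f g)" for f
    have "lipschitz_C01 1 d" unfolding d_def
      by (rule lipschitz_envelope[OF False, where K=0]) auto
    from lipschitz_functional_measurable[OF this]
    have "{\<omega> \<in> space M. d (path01 X \<omega>) > 0} \<in> sets M" by simp
    moreover have "d f > 0 \<longleftrightarrow> f \<in> U" if f: "f \<in> mspace C01" for f
    proof
      assume "f \<in> U"
      then obtain e where e: "e > 0" "\<And>g. g \<in> mspace C01 \<Longrightarrow> mdist C01 f g < e \<Longrightarrow> g \<in> U" using U(2) by blast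
      have "e \<le> d f" unfolding d_def by (rule cINF_greatest[OF False]) (use e in force)
      then show "d f > 0" using e by simp
    next
      assume d: "d f > 0"
      show "f \<in> U"
      proof (rule ccontr)
        assume "f \<notin> U"
        then have "d f \<le> 0 + 1 * mdist C01 f f" unfolding d_def
          by (intro cINF_lower bdd_belowI2[of _ 0]) (use f in auto)
        then show False using d mdist_C01_simps(4)[OF f] by simp
      qed
    qed
    then have "{\<omega> \<in> space M. d (path01 X \<omega>) > 0} = path01 X -` U \<inter> space M"
      using path_in_C01 by auto
    ultimately show ?thesis by simp
  qed
qed

text \<open>Infimal convolutions with slope n converge to a bounded continuous functional from
  below: near f continuity controls \<Phi>, and far from f the penalty exceeds the range of
  \<Phi>.\<close>

lemma continuous_functional_envelope:
  assumes \<Phi>: "continuous_map (mtopology_of C01) euclideanreal \<Phi>" and K: "\<And>f. f \<in> mspace C01 \<Longrightarrow> \<bar>\<Phi> f\<bar> \<le> K"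
  obtains \<Psi> where "\<And>n. lipschitz_C01 (real n) (\<Psi> n)"
    "\<And>n f. f \<in> mspace C01 \<Longrightarrow> \<Psi> n f \<le> \<Phi> f" "\<And>n f. f \<in> mspace C01 \<Longrightarrow> \<bar>\<Psi> n f\<bar> \<le> K"
    "\<And>f. f \<in> mspace C01 \<Longrightarrow> (\<lambda>n. \<Psi> n f) \<longlonglongrightarrow> \<Phi> f"
proof
  define \<Psi> where "\<Psi> n f = (INF g\<in>mspace C01. \<Phi> g + real n * mdist C01 f g)" for n f
  have ne: "mspace C01 \<noteq> {}" using interp_in_C01 by auto
  have K': "- K \<le> \<Phi> g" if "g \<in> mspace C01" for g using K[OF that] by linarith
  show "lipschitz_C01 (real n) (\<Psi> n)" for n
    unfolding \<Psi>_def using ne K' by (intro lipschitz_envelope[where K=K]) auto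
  have lb: "- K \<le> \<Phi> g + real n * mdist C01 f g" if "g \<in> mspace C01" for n f g
    using K'[OF that] by (smt (verit) mdist_C01_simps(1) mult_nonneg_nonneg of_nat_0_le_iff)
  show le: "\<Psi> n f \<le> \<Phi> f" if f: "f \<in> mspace C01" for n f
  proof -
    have "\<Psi> n f \<le> \<Phi> f + real n * mdist C01 f f" unfolding \<Psi>_def
      by (intro cINF_lower bdd_belowI2[of _ "-K"] lb f)
    then show ?thesis using mdist_C01_simps(4)[OF f] by simp
  qed
  have ge: "- K \<le> \<Psi> n f" for n f unfolding \<Psi>_def by (rule cINF_greatest[OF ne lb])
  show "\<bar>\<Psi> n f\<bar> \<le> K" if "f \<in> mspace C01" for n f using le[OF that, of n] ge[of n f] K[OF that] by linarith
  show "(\<lambda>n. \<Psi> n f) \<longlonglongrightarrow> \<Phi> f" if f: "f \<in> mspace C01" for f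
  proof (rule LIMSEQ_I)
    fix e :: real assume e: "e > 0"
    define U where "U = {g \<in> mspace C01. \<Phi> g \<in> {\<Phi> f - e/2<..<\<Phi> f + e/2}}"
    have "openin (mtopology_of C01) U" unfolding U_def
      using openin_continuous_map_preimage[OF \<Phi>, of "{\<Phi> f - e/2<..<\<Phi> f + e/2}"] by simp
    moreover have "f \<in> U" using f e by (auto simp: U_def)
    ultimately obtain d where d: "d > 0" "\<And>g. g \<in> mspace C01 \<Longrightarrow> mdist C01 f g < d \<Longrightarrow> g \<in> U"
      unfolding openin_C01 by blast
    \<comment> \<open>A competitor at distance at least d pays at least 2K, which is as much as
      \<Phi> can drop.\<close>
    obtain n0 :: nat where n0: "2 * K / d < real n0" using reals_Archimedean2 by blast
    have "norm (\<Psi> n f - \<Phi> f) < e" if n: "n \<ge> n0" for n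
    proof -
      have "\<Phi> f - e/2 \<le> \<Psi> n f" unfolding \<Psi>_def
      proof (rule cINF_greatest[OF ne])
        fix g assume g: "g \<in> mspace C01"
        show "\<Phi> f - e/2 \<le> \<Phi> g + real n * mdist C01 f g"
        proof (cases "mdist C01 f g < d")
          case True
          then have "\<Phi> f - e/2 \<le> \<Phi> g" using d(2)[OF g] by (auto simp: U_def)
          then show ?thesis by (smt (verit) mdist_C01_simps(1) mult_nonneg_nonneg of_nat_0_le_iff)
        next
          case False
          have "2 * K \<le> real n0 * d" using n0 d(1) by (simp add: divide_less_eq)
          also have "\<dots> \<le> real n * mdist C01 f g" using n False d(1) by (intro mult_mono) auto
          finally show ?thesis using K[OF f] K[OF g] e by linarith
        qed
      qed
      then show ?thesis using le[OF f, of n] e by simp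
    qed
    then show "\<exists>no. \<forall>n\<ge>no. norm (\<Psi> n f - \<Phi> f) < e" by blast
  qed
qed

text \<open>Testing against a Lipschitz minorant of \<Phi> gives the lower half of the limit; the
  upper half is the lower half for -\<Phi>.\<close>

lemma weak_convergence_from_lipschitz:
  assumes "prob_space M" "prob_space N"
    and X: "\<forall>\<^sub>F p in F. continuous_process M (X p)" and Y: "continuous_process N Y"
    and lip: "\<And>L K \<Phi>. lipschitz_C01 L \<Phi> \<Longrightarrow> (\<And>f. f \<in> mspace C01 \<Longrightarrow> \<bar>\<Phi> f\<bar> \<le> K) \<Longrightarrow>
       ((\<lambda>p. \<integral>\<omega>. \<Phi> (path01 (X p) \<omega>) \<partial>M) \<longlongrightarrow> (\<integral>\<omega>. \<Phi> (path01 Y \<omega>) \<partial>N)) F"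
  shows "converges_weakly (mtopology_of C01) M (\<lambda>p. path01 (X p)) N (path01 Y) F"
proof -
  interpret M: prob_space M by fact
  interpret N: prob_space N by fact
  interpret Y: continuous_process N Y by fact
  have lower: "\<forall>\<^sub>F p in F. (\<integral>\<omega>. \<Phi> (path01 Y \<omega>) \<partial>N) - e < (\<integral>\<omega>. \<Phi> (path01 (X p) \<omega>) \<partial>M)"
    if \<Phi>: "continuous_map (mtopology_of C01) euclideanreal \<Phi>" and K: "\<And>f. f \<in> mspace C01 \<Longrightarrow> \<bar>\<Phi> f\<bar> \<le> K"
      and e: "e > 0" for \<Phi> K e
  proof -
    obtain \<Psi> where \<Psi>: "\<And>n. lipschitz_C01 (real n) (\<Psi> n)"
      "\<And>n f. f \<in> mspace C01 \<Longrightarrow> \<Psi> n f \<le> \<Phi> f" "\<And>n f. f \<in> mspace C01 \<Longrightarrow> \<bar>\<Psi> n f\<bar> \<le> K"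
      "\<And>f. f \<in> mspace C01 \<Longrightarrow> (\<lambda>n. \<Psi> n f) \<longlonglongrightarrow> \<Phi> f"
      using continuous_functional_envelope[OF \<Phi> K] by metis
    have mY: "(\<lambda>\<omega>. \<Psi> n (path01 Y \<omega>)) \<in> borel_measurable N" for n
      by (rule Y.lipschitz_functional_measurable[OF \<Psi>(1)])
    have "(\<lambda>\<omega>. \<Phi> (path01 Y \<omega>)) \<in> borel_measurable N"
      by (rule borel_measurable_LIMSEQ_real[OF _ mY]) (auto intro: \<Psi> Y.path_in_C01)
    then have "(\<lambda>n. \<integral>\<omega>. \<Psi> n (path01 Y \<omega>) \<partial>N) \<longlonglongrightarrow> (\<integral>\<omega>. \<Phi> (path01 Y \<omega>) \<partial>N)"
      by (intro integral_dominated_convergence[where w="\<lambda>_. K"] mY AE_I2) (auto intro: \<Psi> Y.path_in_C01)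
    then have "\<forall>\<^sub>F n in sequentially. (\<integral>\<omega>. \<Phi> (path01 Y \<omega>) \<partial>N) - e/2 < (\<integral>\<omega>. \<Psi> n (path01 Y \<omega>) \<partial>N)"
      using e by (intro order_tendstoD) auto
    then obtain n where n: "(\<integral>\<omega>. \<Phi> (path01 Y \<omega>) \<partial>N) - e/2 < (\<integral>\<omega>. \<Psi> n (path01 Y \<omega>) \<partial>N)"
      by (auto simp: eventually_sequentially)
    have "\<forall>\<^sub>F p in F. (\<integral>\<omega>. \<Psi> n (path01 Y \<omega>) \<partial>N) - e/2 < (\<integral>\<omega>. \<Psi> n (path01 (X p) \<omega>) \<partial>M)"
      using lip[OF \<Psi>(1,3)] e by (intro order_tendstoD) auto
    with X show ?thesis
    proof eventually_elim
      case (elim p)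
      interpret X: continuous_process M "X p" by fact
      have mX: "(\<lambda>\<omega>. \<Psi> n (path01 (X p) \<omega>)) \<in> borel_measurable M" for n
        by (rule X.lipschitz_functional_measurable[OF \<Psi>(1)])
      have m\<Phi>: "(\<lambda>\<omega>. \<Phi> (path01 (X p) \<omega>)) \<in> borel_measurable M"
        by (rule borel_measurable_LIMSEQ_real[OF _ mX]) (auto intro: \<Psi> X.path_in_C01)
      have "(\<integral>\<omega>. \<Psi> n (path01 (X p) \<omega>) \<partial>M) \<le> (\<integral>\<omega>. \<Phi> (path01 (X p) \<omega>) \<partial>M)"
        using mX m\<Phi>
        by (intro integral_mono_AE M.integrable_const_bound[where B=K] AE_I2) (auto intro: \<Psi> K X.path_in_C01)
      with elim n show ?case by linarith
    qed
  qed
  show ?thesis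
    unfolding converges_weakly_def
  proof (intro conjI allI impI)
    show "\<forall>\<^sub>F p in F. path01 (X p) \<in> M \<rightarrow>\<^sub>M borel_of (mtopology_of C01)"
      using X by eventually_elim (rule continuous_process.path_measurable)
    show "path01 Y \<in> N \<rightarrow>\<^sub>M borel_of (mtopology_of C01)" by (rule Y.path_measurable)
    fix \<Phi> :: "(real \<Rightarrow> real) \<Rightarrow> real"
    assume \<Phi>: "continuous_map (mtopology_of C01) euclideanreal \<Phi> \<and> bounded (\<Phi> ` topspace (mtopology_of C01))"
    then obtain K where K: "\<And>f. f \<in> mspace C01 \<Longrightarrow> \<bar>\<Phi> f\<bar> \<le> K"
      by (auto simp: bounded_iff)
    show "((\<lambda>p. \<integral>\<omega>. \<Phi> (path01 (X p) \<omega>) \<partial>M) \<longlongrightarrow> (\<integral>\<omega>. \<Phi> (path01 Y \<omega>) \<partial>N)) F"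
    proof (rule tendstoI)
      fix e :: real assume e: "e > 0"
      have "\<forall>\<^sub>F p in F. (\<integral>\<omega>. \<Phi> (path01 Y \<omega>) \<partial>N) - e < (\<integral>\<omega>. \<Phi> (path01 (X p) \<omega>) \<partial>M)"
        using \<Phi> K e by (intro lower) auto
      moreover have "\<forall>\<^sub>F p in F. (\<integral>\<omega>. - \<Phi> (path01 Y \<omega>) \<partial>N) - e < (\<integral>\<omega>. - \<Phi> (path01 (X p) \<omega>) \<partial>M)"
        using \<Phi> K e by (intro lower[of _ K]) (auto intro: continuous_map_minus)
      ultimately show "\<forall>\<^sub>F p in F. dist (\<integral>\<omega>. \<Phi> (path01 (X p) \<omega>) \<partial>M) (\<integral>\<omega>. \<Phi> (path01 Y \<omega>) \<partial>N) < e"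
        by eventually_elim (auto simp: dist_real_def)
    qed
  qed
qed

text \<open>This is the expectation of the chaining bound. The moment hypothesis bounds the expected
  variation of level n by 2^n C 2^(-nq) = C r^(2n), and r = 2^((1-q)/2) is the ratio that makes both
  terms of the increment bound of order r^n; q > 1 makes the series converge.\<close>

lemma (in prob_space) interp_functional_close:
  assumes "continuous_process M X" and L: "lipschitz_C01 L \<Phi>" and K: "\<And>f. f \<in> mspace C01 \<Longrightarrow> \<bar>\<Phi> f\<bar> \<le> K"
    and mom: "\<And>s t. 0 \<le> s \<Longrightarrow> s \<le> t \<Longrightarrow> t \<le> 1 \<Longrightarrow> sq_integral M (\<lambda>\<omega>. X t \<omega> - X s \<omega>) \<le> ennreal (C * (t - s) powr q)"
    and C: "C \<ge> 0" and r: "r = 2 powr ((1 - q) / 2)" and q: "q > 1"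
  shows "\<bar>(\<integral>\<omega>. \<Phi> (path01 X \<omega>) \<partial>M) - (\<integral>\<omega>. \<Phi> (interp m (\<lambda>i. X (real i / 2^m) \<omega>)) \<partial>M)\<bar> \<le> L * ((1 + C) / 2 * r^m / (1 - r))"
proof -
  interpret X: continuous_process M X by fact
  have r01: "0 < r" "r < 1" using q unfolding r by (auto simp: powr_less_one)
  have rr: "2^n * (1 / 2^n) powr q = (r^n)\<^sup>2" for n
  proof -
    have "(2::real)^n * (1 / 2^n) powr q = 2 powr (real n) * 2 powr (- real n * q)"
    proof -
      have "1 / 2^n = (2::real) powr (- real n)" by (simp add: powr_minus_divide powr_realpow)
      then show ?thesis by (simp add: powr_powr powr_realpow)
    qed
    also have "\<dots> = 2 powr (real n * (1 - q))" by (simp add: powr_add[symmetric] algebra_simps)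
    also have "\<dots> = (r^n)\<^sup>2" unfolding r
      by (simp add: powr_realpow[symmetric] powr_powr power_mult[symmetric] mult.commute flip: powr_numeral)
    finally show ?thesis .
  qed
  have mv: "(\<lambda>\<omega>. dyadic_variation (\<lambda>t. X t \<omega>) n) \<in> borel_measurable M" for n
    unfolding dyadic_variation_def
    by (intro borel_measurable_sum borel_measurable_power borel_measurable_diff X.grid_measurable) auto
  have Ev: "(\<integral>\<^sup>+\<omega>. ennreal (dyadic_variation (\<lambda>t. X t \<omega>) n) \<partial>M) \<le> ennreal (C * (r^n)\<^sup>2)" for n
  proof -
    have gm: "X ((1 + real i) / 2^n) \<in> borel_measurable M" if "i < 2^n" for i
      using X.grid_measurable[of "Suc i" n] that by simp
    have "(\<integral>\<^sup>+\<omega>. ennreal (dyadic_variation (\<lambda>t. X t \<omega>) n) \<partial>M)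
        = (\<Sum>i<2^n. \<integral>\<^sup>+\<omega>. ennreal ((X (real (i+1) / 2^n) \<omega> - X (real i / 2^n) \<omega>)\<^sup>2) \<partial>M)"
      unfolding dyadic_variation_def
      by (subst nn_integral_sum[symmetric])
        (auto simp: sum_ennreal intro!: measurable_compose[OF _ measurable_ennreal] borel_measurable_power borel_measurable_diff X.grid_measurable gm)
    also have "\<dots> \<le> (\<Sum>i<(2::nat)^n. ennreal (C * (1 / 2^n) powr q))"
    proof (rule sum_mono)
      fix i assume "i \<in> {..<2^n::nat}"
      then have i: "i + 1 \<le> 2^n" by simp
      then have "real (i + 1) \<le> real (2^n)" by (simp only: of_nat_le_iff)
      moreover have "real (i+1) / 2^n - real i / 2^n = 1 / 2^n" by (simp add: diff_divide_distrib[symmetric])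
      ultimately show "sq_integral M (\<lambda>\<omega>. X (real (i+1) / 2^n) \<omega> - X (real i / 2^n) \<omega>) \<le> ennreal (C * (1 / 2^n) powr q)"
        using mom[of "real i / 2^n" "real (i+1) / 2^n"] by (simp add: divide_right_mono divide_le_eq)
    qed
    also have "\<dots> = ennreal (C * (2^n * (1 / 2^n) powr q))"
      using C by (simp add: ennreal_of_nat_eq_real_of_nat ennreal_mult[symmetric] mult.left_commute)
    finally show ?thesis unfolding rr .
  qed
  let ?d = "\<lambda>\<omega>. \<bar>\<Phi> (path01 X \<omega>) - \<Phi> (interp m (\<lambda>i. X (real i / 2^m) \<omega>))\<bar>"
  have m1: "(\<lambda>\<omega>. \<Phi> (path01 X \<omega>)) \<in> borel_measurable M" by (rule X.lipschitz_functional_measurable[OF L])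
  have m2: "(\<lambda>\<omega>. \<Phi> (interp m (\<lambda>i. X (real i / 2^m) \<omega>))) \<in> borel_measurable M" by (rule X.interp_functional_measurable[OF L])
  have i1: "integrable M (\<lambda>\<omega>. \<Phi> (path01 X \<omega>))"
    using m1 by (intro integrable_const_bound[where B=K] AE_I2) (auto intro: K X.path_in_C01)
  have i2: "integrable M (\<lambda>\<omega>. \<Phi> (interp m (\<lambda>i. X (real i / 2^m) \<omega>)))"
    using m2 by (intro integrable_const_bound[where B=K] AE_I2) (auto intro: K interp_in_C01)
  have L0: "L \<ge> 0" using L by (simp add: lipschitz_C01_def)
  have "(\<integral>\<^sup>+\<omega>. ennreal (?d \<omega>) \<partial>M) \<le> (\<integral>\<^sup>+\<omega>. ennreal L * (\<Sum>n. ennreal ((r^(n+m) + dyadic_variation (\<lambda>t. X t \<omega>) (n+m) / r^(n+m)) / 2)) \<partial>M)"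
  proof (rule nn_integral_mono)
    fix \<omega> assume \<omega>: "\<omega> \<in> space M"
    have "?d \<omega> \<le> L * mdist C01 (path01 X \<omega>) (interp m (\<lambda>i. X (real i / 2^m) \<omega>))"
      using L X.path_in_C01[OF \<omega>] interp_in_C01 by (auto simp: lipschitz_C01_def)
    then have "ennreal (?d \<omega>) \<le> ennreal L * ennreal (mdist C01 (path01 X \<omega>) (interp m (\<lambda>i. X (real i / 2^m) \<omega>)))"
      using L0 by (simp add: ennreal_mult'[symmetric] ennreal_leI)
    also have "\<dots> \<le> ennreal L * (\<Sum>n. ennreal ((r^(n+m) + dyadic_variation (\<lambda>t. X t \<omega>) (n+m) / r^(n+m)) / 2))"
      using interp_chaining[OF X.continuous_path[OF \<omega>] r01(1), of m] unfolding path01_def by (rule mult_left_mono) simp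
    finally show "ennreal (?d \<omega>) \<le> \<dots>" .
  qed
  also have "\<dots> = ennreal L * (\<Sum>n. \<integral>\<^sup>+\<omega>. ennreal ((r^(n+m) + dyadic_variation (\<lambda>t. X t \<omega>) (n+m) / r^(n+m)) / 2) \<partial>M)"
    using mv by (simp add: nn_integral_cmult nn_integral_suminf)
  also have "\<dots> \<le> ennreal L * (\<Sum>n. ennreal ((1 + C) / 2 * r^m * r^n))"
  proof (intro mult_left_mono suminf_le)
    fix n
    have v0: "dyadic_variation (\<lambda>t. X t \<omega>) (n+m) \<ge> 0" for \<omega> by (auto simp: dyadic_variation_def intro: sum_nonneg)
    have "(\<integral>\<^sup>+\<omega>. ennreal ((r^(n+m) + dyadic_variation (\<lambda>t. X t \<omega>) (n+m) / r^(n+m)) / 2) \<partial>M)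
      = (\<integral>\<^sup>+\<omega>. ennreal (r^(n+m) / 2) + ennreal (1 / (2 * r^(n+m))) * ennreal (dyadic_variation (\<lambda>t. X t \<omega>) (n+m)) \<partial>M)"
      using r01 v0 by (intro nn_integral_cong) (simp add: ennreal_mult'[symmetric] ennreal_plus[symmetric] add_divide_distrib del: ennreal_plus)
    also have "\<dots> = ennreal (r^(n+m) / 2) + ennreal (1 / (2 * r^(n+m))) * (\<integral>\<^sup>+\<omega>. ennreal (dyadic_variation (\<lambda>t. X t \<omega>) (n+m)) \<partial>M)"
      using mv by (subst nn_integral_add) (auto simp: nn_integral_cmult emeasure_space_1)
    also have "\<dots> \<le> ennreal (r^(n+m) / 2) + ennreal (1 / (2 * r^(n+m))) * ennreal (C * (r^(n+m))\<^sup>2)"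
      using Ev by (intro add_left_mono mult_left_mono) auto
    also have "\<dots> = ennreal (r^(n+m) / 2 + 1 / (2 * r^(n+m)) * (C * (r^(n+m))\<^sup>2))"
      using r01 C by (simp add: ennreal_mult'[symmetric] ennreal_plus[symmetric] del: ennreal_plus)
    also have "r^(n+m) / 2 + 1 / (2 * r^(n+m)) * (C * (r^(n+m))\<^sup>2) = (1 + C) / 2 * r^m * r^n"
      using r01 by (simp add: power2_eq_square power_add field_simps)
    finally show "(\<integral>\<^sup>+\<omega>. ennreal ((r^(n+m) + dyadic_variation (\<lambda>t. X t \<omega>) (n+m) / r^(n+m)) / 2) \<partial>M) \<le> ennreal ((1 + C) / 2 * r^m * r^n)" .
  qed auto
  also have "(\<Sum>n. ennreal ((1 + C) / 2 * r^m * r^n)) = ennreal (\<Sum>n. (1 + C) / 2 * r^m * r^n)"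
    using r01 C by (intro suminf_ennreal2) (auto intro!: summable_mult)
  also have "(\<Sum>n. (1 + C) / 2 * r^m * r^n) = (1 + C) / 2 * r^m / (1 - r)"
    using r01 by (subst suminf_mult) (auto simp: suminf_geometric)
  also have "ennreal L * ennreal ((1 + C) / 2 * r^m / (1 - r)) = ennreal (L * ((1 + C) / 2 * r^m / (1 - r)))"
    using L0 by (rule ennreal_mult'[symmetric])
  finally have le: "(\<integral>\<^sup>+\<omega>. ennreal (?d \<omega>) \<partial>M) \<le> ennreal (L * ((1 + C) / 2 * r^m / (1 - r)))" .
  have "\<bar>(\<integral>\<omega>. \<Phi> (path01 X \<omega>) \<partial>M) - (\<integral>\<omega>. \<Phi> (interp m (\<lambda>i. X (real i / 2^m) \<omega>)) \<partial>M)\<bar>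
     = \<bar>\<integral>\<omega>. \<Phi> (path01 X \<omega>) - \<Phi> (interp m (\<lambda>i. X (real i / 2^m) \<omega>)) \<partial>M\<bar>"
    using i1 i2 by simp
  also have "\<dots> \<le> (\<integral>\<omega>. ?d \<omega> \<partial>M)" by (rule integral_abs_bound)
  also have "ennreal \<dots> = (\<integral>\<^sup>+\<omega>. ennreal (?d \<omega>) \<partial>M)"
    using i1 i2 by (intro nn_integral_eq_integral[symmetric]) auto
  note this[THEN eq_refl, THEN order_trans, OF le]
  then have "(\<integral>\<omega>. ?d \<omega> \<partial>M) \<le> L * ((1 + C) / 2 * r^m / (1 - r))"
    using L0 C r01 by (subst (asm) ennreal_le_iff) (auto intro!: mult_nonneg_nonneg divide_nonneg_pos)
  finally show ?thesis by this
qed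

text \<open>C and q do not depend on p, so one dyadic level m makes the interpolation error small
  for all relevant p at once; for Y the same is achieved by dominated convergence. At level m only
  finitely many coordinates remain.\<close>

theorem weak_convergence_C01:
  assumes "prob_space M" "prob_space N"
    and X: "\<forall>\<^sub>F p in F. continuous_process M (X p)" and Y: "continuous_process N Y"
    and C: "C \<ge> 0" and q: "q > 1"
    and mom: "\<forall>\<^sub>F p in F. \<forall>s t. 0 \<le> s \<longrightarrow> s \<le> t \<longrightarrow> t \<le> 1 \<longrightarrow>
       sq_integral M (\<lambda>\<omega>. X p t \<omega> - X p s \<omega>) \<le> ennreal (C * (t - s) powr q)"
    and fdd: "\<And>m g L K. (\<And>x y. \<bar>g x - g y\<bar> \<le> L * (\<Sum>i<2^m+1. \<bar>x i - y i\<bar>)) \<Longrightarrow> (\<And>x. \<bar>g x\<bar> \<le> K) \<Longrightarrow>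
       ((\<lambda>p. \<integral>\<omega>. g (\<lambda>i. X p (real i / 2^m) \<omega>) \<partial>M) \<longlongrightarrow> (\<integral>\<omega>. g (\<lambda>i. Y (real i / 2^m) \<omega>) \<partial>N)) F"
  shows "converges_weakly (mtopology_of C01) M (\<lambda>p. path01 (X p)) N (path01 Y) F"
proof (rule weak_convergence_from_lipschitz[OF assms(1-4)])
  interpret M: prob_space M by fact
  interpret N: prob_space N by fact
  interpret Y: continuous_process N Y by fact
  fix L K \<Phi> assume L: "lipschitz_C01 L \<Phi>" and K: "\<And>f. f \<in> mspace C01 \<Longrightarrow> \<bar>\<Phi> f\<bar> \<le> K"
  define r where "r = 2 powr ((1 - q) / 2)"
  have r01: "0 < r" "r < 1" using q unfolding r_def by (auto simp: powr_less_one)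
  show "((\<lambda>p. \<integral>\<omega>. \<Phi> (path01 (X p) \<omega>) \<partial>M) \<longlongrightarrow> (\<integral>\<omega>. \<Phi> (path01 Y \<omega>) \<partial>N)) F"
  proof (rule tendstoI)
    fix e :: real assume e: "e > 0"
    have "(\<lambda>m. \<integral>\<omega>. \<Phi> (interp m (\<lambda>i. Y (real i / 2^m) \<omega>)) \<partial>N) \<longlonglongrightarrow> (\<integral>\<omega>. \<Phi> (path01 Y \<omega>) \<partial>N)"
      by (intro integral_dominated_convergence[where w="\<lambda>_. K"] Y.lipschitz_functional_measurable[OF L] Y.interp_functional_measurable[OF L])
        (auto intro!: AE_I2 K interp_in_C01 Y.interp_functional_tendsto[OF L])
    then have "\<forall>\<^sub>F m in sequentially. dist (\<integral>\<omega>. \<Phi> (interp m (\<lambda>i. Y (real i / 2^m) \<omega>)) \<partial>N) (\<integral>\<omega>. \<Phi> (path01 Y \<omega>) \<partial>N) < e/3"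
      using e by (intro tendstoD) auto
    moreover have "(\<lambda>m. L * ((1 + C) / 2 * r^m / (1 - r))) \<longlonglongrightarrow> L * ((1 + C) / 2 * 0 / (1 - r))"
      using r01 by (intro tendsto_intros LIMSEQ_realpow_zero) auto
    then have "\<forall>\<^sub>F m in sequentially. L * ((1 + C) / 2 * r^m / (1 - r)) < e/3"
      using e by (intro order_tendstoD(2)) auto
    ultimately have "\<forall>\<^sub>F m in sequentially. dist (\<integral>\<omega>. \<Phi> (interp m (\<lambda>i. Y (real i / 2^m) \<omega>)) \<partial>N) (\<integral>\<omega>. \<Phi> (path01 Y \<omega>) \<partial>N) < e/3 \<and> L * ((1 + C) / 2 * r^m / (1 - r)) < e/3"
      by eventually_elim auto
    then obtain m where m: "dist (\<integral>\<omega>. \<Phi> (interp m (\<lambda>i. Y (real i / 2^m) \<omega>)) \<partial>N) (\<integral>\<omega>. \<Phi> (path01 Y \<omega>) \<partial>N) < e/3"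
       "L * ((1 + C) / 2 * r^m / (1 - r)) < e/3" by (auto simp: eventually_sequentially)
    have "((\<lambda>p. \<integral>\<omega>. \<Phi> (interp m (\<lambda>i. X p (real i / 2^m) \<omega>)) \<partial>M) \<longlongrightarrow> (\<integral>\<omega>. \<Phi> (interp m (\<lambda>i. Y (real i / 2^m) \<omega>)) \<partial>N)) F"
      using fdd[of "\<lambda>x. \<Phi> (interp m x)" L m K] lipschitz_interp[OF L] K interp_in_C01 by auto
    then have "\<forall>\<^sub>F p in F. dist (\<integral>\<omega>. \<Phi> (interp m (\<lambda>i. X p (real i / 2^m) \<omega>)) \<partial>M) (\<integral>\<omega>. \<Phi> (interp m (\<lambda>i. Y (real i / 2^m) \<omega>)) \<partial>N) < e/3"
      using e by (intro tendstoD) auto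
    with X mom show "\<forall>\<^sub>F p in F. dist (\<integral>\<omega>. \<Phi> (path01 (X p) \<omega>) \<partial>M) (\<integral>\<omega>. \<Phi> (path01 Y \<omega>) \<partial>N) < e"
    proof eventually_elim
      case (elim p)
      have "\<bar>(\<integral>\<omega>. \<Phi> (path01 (X p) \<omega>) \<partial>M) - (\<integral>\<omega>. \<Phi> (interp m (\<lambda>i. X p (real i / 2^m) \<omega>)) \<partial>M)\<bar> \<le> L * ((1 + C) / 2 * r^m / (1 - r))"
        by (rule M.interp_functional_close[OF elim(1) L K _ C r_def q]) (use elim(2) in auto)
      then show ?case using elim(3) m unfolding dist_real_def by linarith
    qed
  qed
qed


section \<open>Gaussian families and double integrals of simple kernels\<close>


text \<open>Allowing \<sigma> = 0 puts degenerate and nondegenerate variables into one formula, so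
  that moments and characteristic functions are computed once.\<close>

lemma gaussian_variable_distr:
  assumes "prob_space M" and X: "gaussian_variable M X" and mean: "(\<integral>\<omega>. X \<omega> \<partial>M) = 0"
  obtains \<sigma> where "\<sigma> \<ge> 0" "distr M borel X = distr std_normal_distribution borel (\<lambda>x. \<sigma> * x)"
proof -
  interpret prob_space M by fact
  interpret std: real_distribution std_normal_distribution by (rule real_dist_normal_dist)
  have m[measurable]: "X \<in> borel_measurable M" using X by (simp add: gaussian_variable_def)
  from X consider m \<sigma> where "\<sigma> > 0" "distributed M lborel X (\<lambda>x. ennreal (normal_density m \<sigma> x))"
    | c where "AE \<omega> in M. X \<omega> = c" by (auto simp: gaussian_variable_def)
  then show thesis
  proof cases
    case 1
    have "m = 0"
      using mean distributed_integral[OF 1(2), of "\<lambda>x. x"] integral_normal_moment_nz_1[OF 1(1), of m] by simp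
    with 1 normal_standard_normal_convert[OF 1(1), of X m]
    have "distributed M lborel (\<lambda>x. X x / \<sigma>) (\<lambda>x. ennreal (std_normal_density x))" by simp
    then have "distr M lborel (\<lambda>x. X x / \<sigma>) = std_normal_distribution"
      by (rule distributed_distr_eq_density)
    then have "distr std_normal_distribution borel (\<lambda>x. \<sigma> * x) = distr (distr M lborel (\<lambda>x. X x / \<sigma>)) borel (\<lambda>x. \<sigma> * x)"
      by simp
    also have "\<dots> = distr M borel X"
      using 1(1) by (subst distr_distr) (auto simp: comp_def)
    finally show ?thesis using 1(1) by (intro that[of \<sigma>]) auto
  next
    case 2
    have "(\<integral>\<omega>. X \<omega> \<partial>M) = (\<integral>\<omega>. c \<partial>M)" using 2 by (intro integral_cong_AE) auto
    then have "c = 0" using mean by (simp add: prob_space)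
    then have "distr M borel X = distr M borel (\<lambda>_. 0)" using 2 by (intro distr_cong_AE) auto
    also have "\<dots> = distr std_normal_distribution borel (\<lambda>x. 0 * x)"
      by (simp add: distr_const std.distr_const)
    finally show ?thesis by (intro that[of 0]) auto
  qed
qed

lemma gaussian_variable_moments:
  assumes M: "prob_space M" and X: "gaussian_variable M X" and mean: "(\<integral>\<omega>. X \<omega> \<partial>M) = 0"
  shows "integrable M (\<lambda>\<omega>. (X \<omega>)\<^sup>2)" "integrable M (\<lambda>\<omega>. X \<omega> ^ 4)"
    "(\<integral>\<omega>. X \<omega> ^ 4 \<partial>M) = 3 * (\<integral>\<omega>. (X \<omega>)\<^sup>2 \<partial>M)\<^sup>2"
    "(CLINT \<omega>|M. iexp (X \<omega>)) = exp (- (\<integral>\<omega>. (X \<omega>)\<^sup>2 \<partial>M) / 2)"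
proof -
  have m[measurable]: "X \<in> borel_measurable M" using X by (simp add: gaussian_variable_def)
  obtain \<sigma> where \<sigma>: "\<sigma> \<ge> 0" "distr M borel X = distr std_normal_distribution borel (\<lambda>x. \<sigma> * x)"
    by (rule gaussian_variable_distr[OF assms])
  have integ: "integrable M (\<lambda>\<omega>. X \<omega> ^ k)" for k
  proof -
    have "integrable (distr M borel X) (\<lambda>x. x ^ k)"
      unfolding \<sigma>(2) by (subst integrable_distr_eq)
        (auto simp: power_mult_distrib integrable_std_normal_distribution_moment intro!: integrable_mult_right)
    then show ?thesis by (subst (asm) integrable_distr_eq) auto
  qed
  show "integrable M (\<lambda>\<omega>. (X \<omega>)\<^sup>2)" "integrable M (\<lambda>\<omega>. X \<omega> ^ 4)" by (rule integ)+
  have mom: "(\<integral>\<omega>. X \<omega> ^ k \<partial>M) = \<sigma>^k * (\<integral>x. x^k \<partial>std_normal_distribution)" for k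
  proof -
    have "(\<integral>\<omega>. X \<omega> ^ k \<partial>M) = (\<integral>x. x^k \<partial>distr M borel X)" by (subst integral_distr) auto
    also have "\<dots> = (\<integral>x. (\<sigma> * x)^k \<partial>std_normal_distribution)" unfolding \<sigma>(2) by (subst integral_distr) auto
    finally show ?thesis by (simp add: power_mult_distrib)
  qed
  have m2: "(\<integral>\<omega>. (X \<omega>)\<^sup>2 \<partial>M) = \<sigma>\<^sup>2"
    unfolding mom using std_normal_distribution_even_moments(1)[of 1] by simp
  have m4: "(\<integral>\<omega>. X \<omega> ^ 4 \<partial>M) = 3 * \<sigma> ^ 4"
    unfolding mom using std_normal_distribution_even_moments(1)[of 2] by (simp add: fact_numeral)
  show "(\<integral>\<omega>. X \<omega> ^ 4 \<partial>M) = 3 * (\<integral>\<omega>. (X \<omega>)\<^sup>2 \<partial>M)\<^sup>2" unfolding m2 m4 by simp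
  have "(CLINT \<omega>|M. iexp (X \<omega>)) = (CLINT x|distr M borel X. iexp x)" by (subst integral_distr) auto
  also have "\<dots> = (CLINT x|std_normal_distribution. iexp (\<sigma> * x))" unfolding \<sigma>(2) by (subst integral_distr) auto
  also have "\<dots> = exp (- \<sigma>\<^sup>2 / 2)"
    using fun_cong[OF char_std_normal_distribution, of \<sigma>] by (simp add: char_def)
  finally show "(CLINT \<omega>|M. iexp (X \<omega>)) = exp (- (\<integral>\<omega>. (X \<omega>)\<^sup>2 \<partial>M) / 2)" unfolding m2 .
qed

text \<open>Polarisation over the eight sign patterns with the sign of a fixed; 192 = 4! * 8. It
  reduces mixed fourth moments to fourth powers of single Gaussian variables.\<close>

lemma four_fold_polarization:
  fixes a b c d :: real
  shows "192 * (a * b * c * d) =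
    (a+b+c+d)^4 - (a+b+c-d)^4 - (a+b-c+d)^4 + (a+b-c-d)^4
    - (a-b+c+d)^4 + (a-b+c-d)^4 + (a-b-c+d)^4 - (a-b-c-d)^4"
proof -
  have p: "(x+y)^4 - (x-y)^4 = 8 * x * y * (x\<^sup>2 + y\<^sup>2)" for x y :: real by algebra
  have "(a+b+c+d)^4 - (a+b+c-d)^4 = 8 * (a+b+c) * d * ((a+b+c)\<^sup>2 + d\<^sup>2)"
    "(a+b-c+d)^4 - (a+b-c-d)^4 = 8 * (a+b-c) * d * ((a+b-c)\<^sup>2 + d\<^sup>2)"
    "(a-b+c+d)^4 - (a-b+c-d)^4 = 8 * (a-b+c) * d * ((a-b+c)\<^sup>2 + d\<^sup>2)"
    "(a-b-c+d)^4 - (a-b-c-d)^4 = 8 * (a-b-c) * d * ((a-b-c)\<^sup>2 + d\<^sup>2)"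
    by (rule p)+
  moreover have "192 * (a * b * c * d) = 8 * (a+b+c) * d * ((a+b+c)\<^sup>2 + d\<^sup>2) - 8 * (a+b-c) * d * ((a+b-c)\<^sup>2 + d\<^sup>2)
     - 8 * (a-b+c) * d * ((a-b+c)\<^sup>2 + d\<^sup>2) + 8 * (a-b-c) * d * ((a-b-c)\<^sup>2 + d\<^sup>2)"
    by algebra
  ultimately show ?thesis by linarith
qed

locale gaussian_family = prob_space M for M :: "'a measure" +
  fixes T :: "'i set" and X :: "'i \<Rightarrow> 'a \<Rightarrow> real" and K :: "'i \<Rightarrow> 'i \<Rightarrow> real"
  assumes family: "centered_gaussian_family M T X K"
begin

lemma family_gaussian: "finite I \<Longrightarrow> I \<subseteq> T \<Longrightarrow> gaussian_variable M (\<lambda>\<omega>. \<Sum>t\<in>I. c t * X t \<omega>)"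
  by (rule family[unfolded centered_gaussian_family_def, THEN conjunct1, rule_format, OF conjI])

lemma family_mean: "t \<in> T \<Longrightarrow> (\<integral>\<omega>. X t \<omega> \<partial>M) = 0"
  by (rule family[unfolded centered_gaussian_family_def, THEN conjunct2, THEN conjunct1, rule_format])

lemma covariance: "s \<in> T \<Longrightarrow> t \<in> T \<Longrightarrow> (\<integral>\<omega>. X s \<omega> * X t \<omega> \<partial>M) = K s t"
  by (rule family[unfolded centered_gaussian_family_def, THEN conjunct2, THEN conjunct2, rule_format])

lemma member:
  assumes "t \<in> T"
  shows "gaussian_variable M (X t)" "X t \<in> borel_measurable M" "(\<integral>\<omega>. X t \<omega> \<partial>M) = 0"
    "integrable M (\<lambda>\<omega>. (X t \<omega>)\<^sup>2)" "integrable M (X t)"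
proof -
  show 1: "gaussian_variable M (X t)"
    using family_gaussian[of "{t}" "\<lambda>_. 1"] assms by simp
  then show m: "X t \<in> borel_measurable M" by (simp add: gaussian_variable_def)
  show 2: "(\<integral>\<omega>. X t \<omega> \<partial>M) = 0" using assms by (rule family_mean)
  show "integrable M (\<lambda>\<omega>. (X t \<omega>)\<^sup>2)" by (rule gaussian_variable_moments[OF prob_space_axioms 1 2])
  then show "integrable M (X t)" by (rule square_integrable_imp_integrable[OF m])
qed

lemma integrable_product:
  assumes "s \<in> T" "t \<in> T"
  shows "integrable M (\<lambda>\<omega>. X s \<omega> * X t \<omega>)"
proof (rule Bochner_Integration.integrable_bound)
  show "integrable M (\<lambda>\<omega>. (X s \<omega>)\<^sup>2 + (X t \<omega>)\<^sup>2)" using assms member by auto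
  have "\<bar>x * y\<bar> \<le> x\<^sup>2 + y\<^sup>2" for x y :: real
  proof -
    have "2 * (\<bar>x\<bar> * \<bar>y\<bar>) \<le> x\<^sup>2 + y\<^sup>2" using sum_squares_bound[of "\<bar>x\<bar>" "\<bar>y\<bar>"] by (simp add: mult.assoc)
    moreover have "0 \<le> \<bar>x\<bar> * \<bar>y\<bar>" by simp
    ultimately show ?thesis unfolding abs_mult by linarith
  qed
  then show "AE \<omega> in M. norm (X s \<omega> * X t \<omega>) \<le> norm ((X s \<omega>)\<^sup>2 + (X t \<omega>)\<^sup>2)" by simp
qed (use assms member in auto)


text \<open>The defining property speaks of sums over sets of indices. Here indices may repeat, so
  equal ones are first collected into the fibres of s.\<close>

lemma combination:
  fixes a :: "'j \<Rightarrow> real"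
  assumes J: "finite J" and s: "\<And>j. j \<in> J \<Longrightarrow> s j \<in> T"
  defines "Y \<equiv> \<lambda>\<omega>. \<Sum>j\<in>J. a j * X (s j) \<omega>"
  shows "gaussian_variable M Y" "(\<integral>\<omega>. Y \<omega> \<partial>M) = 0" "integrable M (\<lambda>\<omega>. (Y \<omega>)\<^sup>2)"
    "(\<integral>\<omega>. (Y \<omega>)\<^sup>2 \<partial>M) = (\<Sum>i\<in>J. \<Sum>j\<in>J. a i * a j * K (s i) (s j))"
proof -
  have "Y = (\<lambda>\<omega>. \<Sum>t\<in>s ` J. (\<Sum>j\<in>{j\<in>J. s j = t}. a j) * X t \<omega>)"
  proof
    fix \<omega>
    have "Y \<omega> = (\<Sum>t\<in>s ` J. \<Sum>j\<in>{j\<in>J. s j = t}. a j * X (s j) \<omega>)"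
      unfolding Y_def by (rule sum.image_gen[OF J])
    also have "\<dots> = (\<Sum>t\<in>s ` J. (\<Sum>j\<in>{j\<in>J. s j = t}. a j) * X t \<omega>)"
      by (intro sum.cong) (auto simp: sum_distrib_right)
    finally show "Y \<omega> = \<dots>" .
  qed
  moreover have "finite (s ` J) \<and> s ` J \<subseteq> T" using J s by auto
  ultimately show 1: "gaussian_variable M Y"
    using family_gaussian[of "s ` J"] by simp
  show 2: "(\<integral>\<omega>. Y \<omega> \<partial>M) = 0"
    unfolding Y_def using s member by (subst Bochner_Integration.integral_sum) auto
  show "integrable M (\<lambda>\<omega>. (Y \<omega>)\<^sup>2)" by (rule gaussian_variable_moments[OF prob_space_axioms 1 2])
  have "(Y \<omega>)\<^sup>2 = (\<Sum>i\<in>J. \<Sum>j\<in>J. a i * a j * (X (s i) \<omega> * X (s j) \<omega>))" for \<omega>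
    unfolding Y_def power2_eq_square sum_product by (intro sum.cong refl) (simp add: mult_ac)
  then have "(\<integral>\<omega>. (Y \<omega>)\<^sup>2 \<partial>M) = (\<Sum>i\<in>J. \<Sum>j\<in>J. (\<integral>\<omega>. a i * a j * (X (s i) \<omega> * X (s j) \<omega>) \<partial>M))"
    using s by (simp add: Bochner_Integration.integral_sum integrable_product integrable_mult_right Bochner_Integration.integrable_sum)
  then show "(\<integral>\<omega>. (Y \<omega>)\<^sup>2 \<partial>M) = (\<Sum>i\<in>J. \<Sum>j\<in>J. a i * a j * K (s i) (s j))"
    using s by (simp add: covariance)
qed

lemma covariance_sym: "s \<in> T \<Longrightarrow> t \<in> T \<Longrightarrow> K s t = K t s"
  by (subst (1 2) covariance[symmetric]) (simp_all add: mult.commute)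

lemma combination4:
  assumes T: "t1 \<in> T" "t2 \<in> T" "t3 \<in> T" "t4 \<in> T"
  shows "has_bochner_integral M (\<lambda>\<omega>. (a1 * X t1 \<omega> + a2 * X t2 \<omega> + a3 * X t3 \<omega> + a4 * X t4 \<omega>) ^ 4)
    (3 * (a1\<^sup>2 * K t1 t1 + a2\<^sup>2 * K t2 t2 + a3\<^sup>2 * K t3 t3 + a4\<^sup>2 * K t4 t4
      + 2 * (a1 * a2 * K t1 t2 + a1 * a3 * K t1 t3 + a1 * a4 * K t1 t4 + a2 * a3 * K t2 t3 + a2 * a4 * K t2 t4 + a3 * a4 * K t3 t4))\<^sup>2)"
proof -
  define s where "s j = [t1,t2,t3,t4] ! j" for j
  define a where "a j = [a1,a2,a3,a4] ! j" for j
  have s: "s j \<in> T" if "j \<in> {..<4::nat}" for j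
    using that T unfolding s_def by (auto simp: less_Suc_eq numeral_eq_Suc)
  have Y: "(\<Sum>j<4. a j * X (s j) \<omega>) = a1 * X t1 \<omega> + a2 * X t2 \<omega> + a3 * X t3 \<omega> + a4 * X t4 \<omega>" for \<omega>
    by (simp add: a_def s_def eval_nat_numeral)
  have g: "gaussian_variable M (\<lambda>\<omega>. \<Sum>j<4. a j * X (s j) \<omega>)" "(\<integral>\<omega>. (\<Sum>j<4. a j * X (s j) \<omega>) \<partial>M) = 0"
    "(\<integral>\<omega>. (\<Sum>j<4. a j * X (s j) \<omega>)\<^sup>2 \<partial>M) = (\<Sum>i<4. \<Sum>j<4. a i * a j * K (s i) (s j))"
    by (rule combination(1,2,4)[OF finite_lessThan s], assumption)+
  note h = gaussian_variable_moments[OF prob_space_axioms g(1,2)]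
  have v: "(\<Sum>i<4. \<Sum>j<4. a i * a j * K (s i) (s j)) = a1\<^sup>2 * K t1 t1 + a2\<^sup>2 * K t2 t2 + a3\<^sup>2 * K t3 t3 + a4\<^sup>2 * K t4 t4
      + 2 * (a1 * a2 * K t1 t2 + a1 * a3 * K t1 t3 + a1 * a4 * K t1 t4 + a2 * a3 * K t2 t3 + a2 * a4 * K t2 t4 + a3 * a4 * K t3 t4)"
    using covariance_sym[OF T(2) T(1)] covariance_sym[OF T(3) T(1)] covariance_sym[OF T(4) T(1)]
       covariance_sym[OF T(3) T(2)] covariance_sym[OF T(4) T(2)] covariance_sym[OF T(4) T(3)]
    by (simp add: a_def s_def eval_nat_numeral)
  show ?thesis
    using h(2,3) unfolding g(3) v unfolding Y has_bochner_integral_iff by (rule conjI)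
qed

text \<open>Each of the eight signed sums is Gaussian with fourth moment three times its squared
  variance, and the polarised combination of these squares leaves the three pairings.\<close>

lemma isserlis:
  assumes T: "t1 \<in> T" "t2 \<in> T" "t3 \<in> T" "t4 \<in> T"
  shows "has_bochner_integral M (\<lambda>\<omega>. X t1 \<omega> * X t2 \<omega> * X t3 \<omega> * X t4 \<omega>)
    (K t1 t2 * K t3 t4 + K t1 t3 * K t2 t4 + K t1 t4 * K t2 t3)"
proof -
  note c = combination4[OF T]
  have "has_bochner_integral M (\<lambda>\<omega>. (1/192) * (
      (1 * X t1 \<omega> + 1 * X t2 \<omega> + 1 * X t3 \<omega> + 1 * X t4 \<omega>)^4 - (1 * X t1 \<omega> + 1 * X t2 \<omega> + 1 * X t3 \<omega> + (-1) * X t4 \<omega>)^4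
    - (1 * X t1 \<omega> + 1 * X t2 \<omega> + (-1) * X t3 \<omega> + 1 * X t4 \<omega>)^4 + (1 * X t1 \<omega> + 1 * X t2 \<omega> + (-1) * X t3 \<omega> + (-1) * X t4 \<omega>)^4
    - (1 * X t1 \<omega> + (-1) * X t2 \<omega> + 1 * X t3 \<omega> + 1 * X t4 \<omega>)^4 + (1 * X t1 \<omega> + (-1) * X t2 \<omega> + 1 * X t3 \<omega> + (-1) * X t4 \<omega>)^4
    + (1 * X t1 \<omega> + (-1) * X t2 \<omega> + (-1) * X t3 \<omega> + 1 * X t4 \<omega>)^4 - (1 * X t1 \<omega> + (-1) * X t2 \<omega> + (-1) * X t3 \<omega> + (-1) * X t4 \<omega>)^4))
    (K t1 t2 * K t3 t4 + K t1 t3 * K t2 t4 + K t1 t4 * K t2 t3)" (is "has_bochner_integral M ?f ?v")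
    by (rule has_bochner_integral_cong[THEN iffD1, OF refl refl _ has_bochner_integral_mult_right[of "1/192",
          OF has_bochner_integral_diff[OF has_bochner_integral_add[OF has_bochner_integral_add[OF has_bochner_integral_diff[OF
           has_bochner_integral_add[OF has_bochner_integral_diff[OF has_bochner_integral_diff[OF c[of 1 1 1 1] c[of 1 1 1 "-1"]]
            c[of 1 1 "-1" 1]] c[of 1 1 "-1" "-1"]] c[of 1 "-1" 1 1]] c[of 1 "-1" 1 "-1"]] c[of 1 "-1" "-1" 1]] c[of 1 "-1" "-1" "-1"]]]])
      (simp, algebra)
  moreover have "?f = (\<lambda>\<omega>. X t1 \<omega> * X t2 \<omega> * X t3 \<omega> * X t4 \<omega>)"
  proof
    fix \<omega> show "?f \<omega> = X t1 \<omega> * X t2 \<omega> * X t3 \<omega> * X t4 \<omega>"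
      using four_fold_polarization[of "X t1 \<omega>" "X t2 \<omega>" "X t3 \<omega>" "X t4 \<omega>"] by (simp add: algebra_simps)
  qed
  ultimately show ?thesis by simp
qed

end

section \<open>Square integrals, the reflection of the plane and rectangle sums\<close>

lemma ennreal_square_add: "ennreal ((a + b)\<^sup>2) \<le> 2 * ennreal (a\<^sup>2) + 2 * ennreal (b\<^sup>2)"
proof -
  have "(a + b)\<^sup>2 \<le> 2 * a\<^sup>2 + 2 * b\<^sup>2" using sum_squares_bound[of a b] by (simp add: power2_sum)
  then have "ennreal ((a + b)\<^sup>2) \<le> ennreal (2 * a\<^sup>2 + 2 * b\<^sup>2)" by (rule ennreal_leI)
  also have "\<dots> = 2 * ennreal (a\<^sup>2) + 2 * ennreal (b\<^sup>2)"
    by (simp add: ennreal_plus ennreal_mult')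
  finally show ?thesis .
qed

lemma nn_integral_square_add:
  fixes f g :: "'z \<Rightarrow> real"
  assumes [measurable]: "f \<in> borel_measurable M" "g \<in> borel_measurable M"
  shows "sq_integral M (\<lambda>x. f x + g x) \<le> 2 * sq_integral M f + 2 * sq_integral M g"
proof -
  have "sq_integral M (\<lambda>x. f x + g x) \<le> (\<integral>\<^sup>+x. 2 * ennreal ((f x)\<^sup>2) + 2 * ennreal ((g x)\<^sup>2) \<partial>M)"
    by (intro nn_integral_mono ennreal_square_add)
  also have "\<dots> = 2 * sq_integral M f + 2 * sq_integral M g"
    by (subst nn_integral_add) (auto simp: nn_integral_cmult)
  finally show ?thesis .
qed

lemma nn_integral_square_cmult:
  fixes f :: "'z \<Rightarrow> real"
  assumes [measurable]: "f \<in> borel_measurable M"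
  shows "sq_integral M (\<lambda>x. c * f x) = ennreal (c\<^sup>2) * sq_integral M f"
proof -
  have "sq_integral M (\<lambda>x. c * f x) = (\<integral>\<^sup>+x. ennreal (c\<^sup>2) * ennreal ((f x)\<^sup>2) \<partial>M)"
    by (simp add: power_mult_distrib ennreal_mult')
  also have "\<dots> = ennreal (c\<^sup>2) * sq_integral M f" by (rule nn_integral_cmult) simp
  finally show ?thesis .
qed

lemma distr_lborel_swap: "distr lborel lborel (\<lambda>z::real \<times> real. (snd z, fst z)) = lborel"
proof -
  have "(\<lambda>(x, y). (y, x)) = (\<lambda>z::real \<times> real. (snd z, fst z))" by auto
  then show ?thesis
    using lborel_pair.distr_pair_swap[where 'a=real and 'b=real, symmetric] by (simp add: lborel_prod)
qed

lemma measurable_swap[measurable]: "(\<lambda>z::real \<times> real. (snd z, fst z)) \<in> lborel \<rightarrow>\<^sub>M lborel"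
  by (simp add: measurable_lborel1 measurable_lborel2 borel_prod[symmetric])

lemma nn_integral_lborel_swap:
  fixes f :: "real \<times> real \<Rightarrow> ennreal"
  assumes "f \<in> borel_measurable lborel"
  shows "(\<integral>\<^sup>+z. f (snd z, fst z) \<partial>lborel) = (\<integral>\<^sup>+z. f z \<partial>lborel)"
proof -
  have "(\<integral>\<^sup>+z. f z \<partial>distr lborel lborel (\<lambda>z. (snd z, fst z))) = (\<integral>\<^sup>+z. f (snd z, fst z) \<partial>lborel)"
    by (rule nn_integral_distr[OF measurable_swap]) (use assms in simp)
  then show ?thesis by (simp only: distr_lborel_swap)
qed

text \<open>A list of weighted rectangles, each off the diagonal on its own, in place of a matrix
  over one disjoint partition: sums become concatenations and products of step functions become
  lists directly, while different rectangles may overlap arbitrarily.\<close>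

type_synonym rects = "(real \<times> real set \<times> real set) list"

definition rect_kernel :: "rects \<Rightarrow> real \<times> real \<Rightarrow> real" where
  "rect_kernel xs z = (\<Sum>(a, S, T)\<leftarrow>xs. a * (indicator S (fst z) * indicator T (snd z)))"

definition rect_integral :: "(real set \<Rightarrow> 'a \<Rightarrow> real) \<Rightarrow> rects \<Rightarrow> 'a \<Rightarrow> real" where
  "rect_integral B xs \<omega> = (\<Sum>(a, S, T)\<leftarrow>xs. a * (B S \<omega> * B T \<omega>))"

definition off_diagonal_rects :: "rects \<Rightarrow> bool" where
  "off_diagonal_rects xs \<longleftrightarrow>
     (\<forall>(a, S, T)\<in>set xs. S \<in> fmeasurable lborel \<and> T \<in> fmeasurable lborel \<and> S \<inter> T = {})"

lemma rect_simps [simp]: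
  "rect_kernel [] z = 0" "rect_kernel ((a, S, T) # xs) z = a * (indicator S (fst z) * indicator T (snd z)) + rect_kernel xs z"
  "rect_integral B [] \<omega> = 0" "rect_integral B ((a, S, T) # xs) \<omega> = a * (B S \<omega> * B T \<omega>) + rect_integral B xs \<omega>"
  "rect_kernel (xs @ ys) z = rect_kernel xs z + rect_kernel ys z"
  "rect_integral B (xs @ ys) \<omega> = rect_integral B xs \<omega> + rect_integral B ys \<omega>"
  "off_diagonal_rects []" "off_diagonal_rects ((a, S, T) # xs) \<longleftrightarrow>
     (S \<in> fmeasurable lborel \<and> T \<in> fmeasurable lborel \<and> S \<inter> T = {}) \<and> off_diagonal_rects xs"
  "off_diagonal_rects (xs @ ys) \<longleftrightarrow> off_diagonal_rects xs \<and> off_diagonal_rects ys"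
  by (auto simp: rect_kernel_def rect_integral_def off_diagonal_rects_def ball_Un)

lemma rect_scale:
  fixes c :: real
  defines "sc \<equiv> \<lambda>(a::real, S::real set, T::real set). (c * a, S, T)"
  shows "rect_kernel (map sc xs) z = c * rect_kernel xs z"
    "rect_integral B (map sc xs) \<omega> = c * rect_integral B xs \<omega>"
    "off_diagonal_rects xs \<Longrightarrow> off_diagonal_rects (map sc xs)"
  by (induction xs) (auto simp: sc_def algebra_simps)

lemma rect_swap:
  defines "sw \<equiv> \<lambda>(a::real, S::real set, T::real set). (a, T, S)"
  shows "rect_kernel (map sw xs) z = rect_kernel xs (snd z, fst z)"
    "rect_integral B (map sw xs) \<omega> = rect_integral B xs \<omega>"
    "off_diagonal_rects xs \<Longrightarrow> off_diagonal_rects (map sw xs)"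
  by (induction xs) (auto simp: sw_def algebra_simps)

lemma rect_kernel_measurable:
  assumes "off_diagonal_rects xs" shows "rect_kernel xs \<in> borel_measurable lborel"
  using assms
proof (induction xs)
  case (Cons x xs)
  obtain a S T where x: "x = (a, S, T)" by (cases x)
  then have [measurable]: "S \<in> sets borel" "T \<in> sets borel" "rect_kernel xs \<in> borel_measurable lborel"
    using Cons by (auto dest: fmeasurableD)
  then have [measurable]: "rect_kernel xs \<in> borel_measurable borel" by simp
  have "rect_kernel ((a, S, T) # xs) = (\<lambda>z. a * (indicator S (fst z) * indicator T (snd z)) + rect_kernel xs z)"
    by (simp add: fun_eq_iff)
  moreover have "(fst :: real \<times> real \<Rightarrow> real) \<in> lborel \<rightarrow>\<^sub>M borel" "(snd :: real \<times> real \<Rightarrow> real) \<in> lborel \<rightarrow>\<^sub>M borel"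
    by (auto intro!: borel_measurable_continuous_onI continuous_intros)
  then have "(\<lambda>z::real \<times> real. indicator S (fst z) :: real) \<in> borel_measurable lborel"
    "(\<lambda>z::real \<times> real. indicator T (snd z) :: real) \<in> borel_measurable lborel"
    by (auto intro: measurable_compose[OF _ borel_measurable_indicator])
  ultimately show ?case unfolding x
    by (auto intro!: borel_measurable_add borel_measurable_times)
qed (simp add: rect_kernel_def[abs_def])

lemma integral_rect_indicator:
  assumes [measurable]: "S \<in> fmeasurable lborel" "T \<in> fmeasurable lborel"
  shows "has_bochner_integral lborel (\<lambda>z::real \<times> real. indicator S (fst z) * indicator T (snd z) :: real)
     (measure lborel S * measure lborel T)"
proof -
  have s: "S \<in> sets lborel" "T \<in> sets lborel" using assms by (auto dest: fmeasurableD)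
  have e: "emeasure lborel (S \<times> T) = emeasure lborel S * emeasure lborel T"
    using lborel.emeasure_pair_measure_Times[of S lborel T] s by (simp add: lborel_prod)
  have f: "emeasure lborel S < \<infinity>" "emeasure lborel T < \<infinity>" using assms by (auto simp: fmeasurable_def)
  have "S \<times> T \<in> sets (lborel :: (real \<times> real) measure)"
    unfolding lborel_prod[symmetric] using s by (rule pair_measureI)
  then have "has_bochner_integral lborel (indicator (S \<times> T) :: _ \<Rightarrow> real) (measure lborel (S \<times> T))"
    using e f by (intro has_bochner_integral_real_indicator) (auto simp: ennreal_mult_less_top)
  moreover have "measure lborel (S \<times> T) = measure lborel S * measure lborel T"
    by (simp add: measure_def e enn2real_mult)
  moreover have "indicator (S \<times> T) = (\<lambda>z. indicator S (fst z) * indicator T (snd z) :: real)"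
    by (auto simp: indicator_def fun_eq_iff)
  ultimately show ?thesis by simp
qed

section \<open>Second moments of integrals of rectangle sums\<close>

locale white_noise = prob_space M for M :: "'a measure" +
  fixes B :: "real set \<Rightarrow> 'a \<Rightarrow> real"
  assumes noise: "brownian_random_measure M B"
begin

sublocale gaussian_family M "fmeasurable lborel" B "\<lambda>S T. measure lborel (S \<inter> T)"
proof
  show "centered_gaussian_family M (fmeasurable lborel) B (\<lambda>S T. measure lborel (S \<inter> T))"
    using noise unfolding brownian_random_measure_def .
qed

lemma rect_integral_measurable:
  assumes "off_diagonal_rects xs" shows "rect_integral B xs \<in> borel_measurable M"
  using assms
proof (induction xs)
  case (Cons x xs)
  obtain a S T where x: "x = (a, S, T)" by (cases x)
  then have [measurable]: "B S \<in> borel_measurable M" "B T \<in> borel_measurable M" "rect_integral B xs \<in> borel_measurable M"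
    using Cons by (auto intro: member)
  have "rect_integral B ((a, S, T) # xs) = (\<lambda>\<omega>. a * (B S \<omega> * B T \<omega>) + rect_integral B xs \<omega>)"
    by (simp add: fun_eq_iff)
  then show ?case unfolding x by simp
qed (simp add: rect_integral_def[abs_def])

text \<open>Of the three pairings in the Gaussian fourth moment, the one matching S with T and U
  with V vanishes by disjointness; the other two are the integrals against the kernel and against
  its transpose. Stating the existence of a common value v carries integrability along the
  induction.\<close>

lemma rect_isometry_atom:
  assumes "S \<in> fmeasurable lborel" "T \<in> fmeasurable lborel" "S \<inter> T = {}" "off_diagonal_rects ys"
  shows "\<exists>v. has_bochner_integral M (\<lambda>\<omega>. B S \<omega> * B T \<omega> * rect_integral B ys \<omega>) v \<and>
     has_bochner_integral lborel (\<lambda>z. indicator S (fst z) * indicator T (snd z) * (rect_kernel ys z + rect_kernel ys (snd z, fst z))) v"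
  using assms(4)
proof (induction ys)
  case Nil
  show ?case by (auto intro!: exI[of _ 0])
next
  case (Cons y ys)
  obtain b U V where y: "y = (b, U, V)" by (cases y)
  have UV: "U \<in> fmeasurable lborel" "V \<in> fmeasurable lborel" "U \<inter> V = {}" "off_diagonal_rects ys"
    using Cons.prems unfolding y by auto
  obtain v where v: "has_bochner_integral M (\<lambda>\<omega>. B S \<omega> * B T \<omega> * rect_integral B ys \<omega>) v"
     "has_bochner_integral lborel (\<lambda>z. indicator S (fst z) * indicator T (snd z) * (rect_kernel ys z + rect_kernel ys (snd z, fst z))) v"
    using Cons.IH[OF UV(4)] by blast
  let ?w = "measure lborel (S \<inter> U) * measure lborel (T \<inter> V) + measure lborel (S \<inter> V) * measure lborel (T \<inter> U)"
  have 1: "has_bochner_integral M (\<lambda>\<omega>. b * (B S \<omega> * B T \<omega> * B U \<omega> * B V \<omega>)) (b * ?w)"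
    using isserlis[OF assms(1,2) UV(1,2)] assms(3) by (intro has_bochner_integral_mult_right) simp
  have 2: "has_bochner_integral lborel (\<lambda>z. b * (indicator (S \<inter> U) (fst z) * indicator (T \<inter> V) (snd z) + indicator (S \<inter> V) (fst z) * indicator (T \<inter> U) (snd z))) (b * ?w)"
    using assms UV by (intro has_bochner_integral_mult_right has_bochner_integral_add integral_rect_indicator fmeasurable.Int)
  show ?case
    using has_bochner_integral_add[OF 1 v(1)] has_bochner_integral_add[OF 2 v(2)]
    by (intro exI[of _ "b * ?w + v"]) (simp add: y indicator_inter_arith algebra_simps)
qed

lemma rect_isometry:
  assumes "off_diagonal_rects xs" "off_diagonal_rects ys"
  shows "\<exists>v. has_bochner_integral M (\<lambda>\<omega>. rect_integral B xs \<omega> * rect_integral B ys \<omega>) v \<and>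
     has_bochner_integral lborel (\<lambda>z. rect_kernel xs z * (rect_kernel ys z + rect_kernel ys (snd z, fst z))) v"
  using assms(1)
proof (induction xs)
  case Nil
  show ?case by (auto intro!: exI[of _ 0])
next
  case (Cons x xs)
  obtain a S T where x: "x = (a, S, T)" by (cases x)
  have ST: "S \<in> fmeasurable lborel" "T \<in> fmeasurable lborel" "S \<inter> T = {}" "off_diagonal_rects xs"
    using Cons.prems unfolding x by auto
  obtain v where v: "has_bochner_integral M (\<lambda>\<omega>. rect_integral B xs \<omega> * rect_integral B ys \<omega>) v"
     "has_bochner_integral lborel (\<lambda>z. rect_kernel xs z * (rect_kernel ys z + rect_kernel ys (snd z, fst z))) v"
    using Cons.IH[OF ST(4)] by blast
  obtain w where w: "has_bochner_integral M (\<lambda>\<omega>. B S \<omega> * B T \<omega> * rect_integral B ys \<omega>) w"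
     "has_bochner_integral lborel (\<lambda>z. indicator S (fst z) * indicator T (snd z) * (rect_kernel ys z + rect_kernel ys (snd z, fst z))) w"
    using rect_isometry_atom[OF ST(1-3) assms(2)] by blast
  show ?case
    using has_bochner_integral_add[OF has_bochner_integral_mult_right[of a, OF w(1)] v(1)]
       has_bochner_integral_add[OF has_bochner_integral_mult_right[of a, OF w(2)] v(2)]
    by (intro exI[of _ "a * w + v"]) (simp add: x algebra_simps)
qed

text \<open>The second moment is the integral of F (F + G) with G the transpose of F. Since F G <=
  (F^2 + G^2)/2 and G has the norm of F, the factor is 3/2 + 1/2 = 2.\<close>

lemma rect_integral_bound:
  assumes "off_diagonal_rects xs"
  shows "sq_integral M (rect_integral B xs) \<le> 2 * sq_integral lborel (rect_kernel xs)"
proof -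
  let ?F = "rect_kernel xs" let ?G = "\<lambda>z. rect_kernel xs (snd z, fst z)"
  have [measurable]: "?F \<in> borel_measurable lborel" by (rule rect_kernel_measurable[OF assms])
  then have [measurable]: "?G \<in> borel_measurable lborel" by (rule measurable_compose[OF measurable_swap])
  obtain v where v: "has_bochner_integral M (\<lambda>\<omega>. rect_integral B xs \<omega> * rect_integral B xs \<omega>) v"
     "has_bochner_integral lborel (\<lambda>z. ?F z * (?F z + ?G z)) v"
    using rect_isometry[OF assms assms] by blast
  have "sq_integral M (rect_integral B xs) = ennreal v"
    using v(1) unfolding power2_eq_square has_bochner_integral_iff
    by (subst nn_integral_eq_integral) auto
  \<comment> \<open>The integrand F (F + G) may be negative, hence the maximum with 0 before passing
    to nonnegative integrals.\<close>
  also have "\<dots> \<le> ennreal (\<integral>z. max 0 (?F z * (?F z + ?G z)) \<partial>lborel)"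
    using v(2) unfolding has_bochner_integral_iff
    by (intro ennreal_leI) (auto intro!: integral_mono integrable_max)
  also have "\<dots> = (\<integral>\<^sup>+z. ennreal (max 0 (?F z * (?F z + ?G z))) \<partial>lborel)"
    using v(2) unfolding has_bochner_integral_iff
    by (intro nn_integral_eq_integral[symmetric] integrable_max) auto
  also have "\<dots> \<le> (\<integral>\<^sup>+z. ennreal (3/2) * ennreal ((?F z)\<^sup>2) + ennreal (1/2) * ennreal ((?G z)\<^sup>2) \<partial>lborel)"
  proof (rule nn_integral_mono)
    fix z
    have "max 0 (?F z * (?F z + ?G z)) \<le> 3/2 * (?F z)\<^sup>2 + 1/2 * (?G z)\<^sup>2"
      using sum_squares_bound[of "?F z" "?G z"] by (simp add: power2_eq_square distrib_left)
    then have "ennreal (max 0 (?F z * (?F z + ?G z))) \<le> ennreal (3/2 * (?F z)\<^sup>2 + 1/2 * (?G z)\<^sup>2)"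
      by (rule ennreal_leI)
    also have "\<dots> = ennreal (3/2) * ennreal ((?F z)\<^sup>2) + ennreal (1/2) * ennreal ((?G z)\<^sup>2)"
      by (subst ennreal_plus) (simp_all only: ennreal_mult', auto)
    finally show "ennreal (max 0 (?F z * (?F z + ?G z))) \<le> \<dots>" .
  qed
  also have "\<dots> = ennreal (3/2) * sq_integral lborel ?F + ennreal (1/2) * sq_integral lborel ?G"
    by (subst nn_integral_add) (auto simp: nn_integral_cmult)
  also have "sq_integral lborel ?G = sq_integral lborel ?F"
    by (rule nn_integral_lborel_swap[of "\<lambda>z. ennreal ((?F z)\<^sup>2)"]) simp
  also have "ennreal (3/2) * sq_integral lborel ?F + ennreal (1/2) * sq_integral lborel ?F
     = (ennreal (3/2) + ennreal (1/2)) * sq_integral lborel ?F" by (rule distrib_right[symmetric])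
  also have "ennreal (3/2) + ennreal (1/2) = 2"
    by (subst ennreal_plus[symmetric]) auto
  finally show ?thesis .
qed

end

text \<open>The same mean-square closure with rectangle lists as approximants, so that linear
  combinations and transposes can be formed termwise; every double Wiener-Ito integral is one of
  these.\<close>

definition has_rect_integral :: "'a measure \<Rightarrow> (real set \<Rightarrow> 'a \<Rightarrow> real) \<Rightarrow> (real \<times> real \<Rightarrow> real) \<Rightarrow> ('a \<Rightarrow> real) \<Rightarrow> bool" where
  "has_rect_integral M B f X \<longleftrightarrow> f \<in> borel_measurable lborel \<and> X \<in> borel_measurable M \<and>
     (\<exists>xs. (\<forall>k. off_diagonal_rects (xs k)) \<and>
       (\<lambda>k. \<integral>\<^sup>+z. ennreal ((f z - rect_kernel (xs k) z)\<^sup>2) \<partial>lborel) \<longlonglongrightarrow> 0 \<and>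
       (\<lambda>k. \<integral>\<^sup>+\<omega>. ennreal ((X \<omega> - rect_integral B (xs k) \<omega>)\<^sup>2) \<partial>M) \<longlonglongrightarrow> 0)"

lemma has_double_imp_has_rect_integral:
  assumes "has_double_wiener_ito_integral M B f X"
  shows "has_rect_integral M B f X"
proof -
  obtain n c A where A: "\<And>k. off_diagonal_data (n k) (c k) (A k)"
    and lim: "(\<lambda>k. \<integral>\<^sup>+x. ennreal ((f x - off_diagonal_simple (n k) (c k) (A k) x)\<^sup>2) \<partial>lborel) \<longlonglongrightarrow> 0"
      "(\<lambda>k. \<integral>\<^sup>+\<omega>. ennreal ((X \<omega> - simple_double_integral B (n k) (c k) (A k) \<omega>)\<^sup>2) \<partial>M) \<longlonglongrightarrow> 0"
    and m: "f \<in> borel_measurable lborel" "X \<in> borel_measurable M"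
    using assms unfolding has_double_wiener_ito_integral_def by blast
  \<comment> \<open>The diagonal squares A_i x A_i have coefficient 0 but are not off-diagonal
    rectangles, so they are replaced by empty ones.\<close>
  define D where "D k i = (\<lambda>j. if i = j then {} else A k i)" for k i
  define xs where "xs k = map (\<lambda>(i, j). (c k i j, D k i j, D k j i)) (List.product [0..<n k] [0..<n k])" for k
  have cd: "c k i i = 0" if "i < n k" for k i using A[of k] that by (auto simp: off_diagonal_data_def)
  have sumeq: "sum_list (map h (List.product [0..<n k] [0..<n k])) = (\<Sum>i<n k. \<Sum>j<n k. h (i, j))" for h :: "nat \<times> nat \<Rightarrow> real" and k
    by (subst sum_list_distinct_conv_sum_set)
      (auto simp: distinct_product sum.cartesian_product lessThan_atLeast0)
  have "rect_kernel (xs k) z = off_diagonal_simple (n k) (c k) (A k) z" for k z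
  proof -
    have "rect_kernel (xs k) z = (\<Sum>i<n k. \<Sum>j<n k. c k i j * (indicator (D k i j) (fst z) * indicator (D k j i) (snd z)))"
      unfolding rect_kernel_def xs_def map_map comp_def
      by (simp add: case_prod_beta sumeq)
    also have "\<dots> = off_diagonal_simple (n k) (c k) (A k) z"
      unfolding off_diagonal_simple_def
      by (intro sum.cong refl) (use cd in \<open>auto simp: D_def indicator_def mem_Times_iff\<close>)
    finally show ?thesis .
  qed
  moreover have "rect_integral B (xs k) \<omega> = simple_double_integral B (n k) (c k) (A k) \<omega>" for k \<omega>
  proof -
    have "rect_integral B (xs k) \<omega> = (\<Sum>i<n k. \<Sum>j<n k. c k i j * (B (D k i j) \<omega> * B (D k j i) \<omega>))"
      unfolding rect_integral_def xs_def map_map comp_def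
      by (simp add: case_prod_beta sumeq)
    also have "\<dots> = simple_double_integral B (n k) (c k) (A k) \<omega>"
      unfolding simple_double_integral_def
      by (intro sum.cong refl) (use cd in \<open>auto simp: D_def\<close>)
    finally show ?thesis .
  qed
  moreover have "off_diagonal_rects (xs k)" for k
    using A[of k] unfolding off_diagonal_rects_def xs_def off_diagonal_data_def disjoint_family_on_def
    by (auto simp: D_def split: if_splits)
  ultimately show ?thesis
    unfolding has_rect_integral_def using lim m by (intro conjI exI[of _ xs]) auto
qed

lemma ennreal_tendsto_0_bound:
  assumes "\<And>k. f k \<le> c * g k + d * h k" "g \<longlonglongrightarrow> 0" "h \<longlonglongrightarrow> 0" "c \<noteq> \<top>" "d \<noteq> \<top>"
  shows "f \<longlonglongrightarrow> (0::ennreal)"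
proof (rule tendsto_sandwich[of "\<lambda>_. 0" f _ "\<lambda>k. c * g k + d * h k"])
  have "(\<lambda>k. c * g k + d * h k) \<longlonglongrightarrow> c * 0 + d * 0"
    using assms by (intro tendsto_add ennreal_tendsto_cmult) (auto simp: top.not_eq_extremum)
  then show "(\<lambda>k. c * g k + d * h k) \<longlonglongrightarrow> 0" by simp
qed (use assms in auto)

context white_noise begin

lemma has_rect_integral_add_scaled:
  assumes "has_rect_integral M B f X" "has_rect_integral M B g Y"
  shows "has_rect_integral M B (\<lambda>z. f z + c * g z) (\<lambda>\<omega>. X \<omega> + c * Y \<omega>)"
proof -
  obtain xs where f[measurable]: "f \<in> borel_measurable lborel" and X[measurable]: "X \<in> borel_measurable M" and xs: "\<And>k. off_diagonal_rects (xs k)"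
      "(\<lambda>k. \<integral>\<^sup>+z. ennreal ((f z - rect_kernel (xs k) z)\<^sup>2) \<partial>lborel) \<longlonglongrightarrow> 0"
      "(\<lambda>k. \<integral>\<^sup>+\<omega>. ennreal ((X \<omega> - rect_integral B (xs k) \<omega>)\<^sup>2) \<partial>M) \<longlonglongrightarrow> 0"
    using assms(1) unfolding has_rect_integral_def by blast
  obtain ys where g[measurable]: "g \<in> borel_measurable lborel" and Y[measurable]: "Y \<in> borel_measurable M" and ys: "\<And>k. off_diagonal_rects (ys k)"
      "(\<lambda>k. \<integral>\<^sup>+z. ennreal ((g z - rect_kernel (ys k) z)\<^sup>2) \<partial>lborel) \<longlonglongrightarrow> 0"
      "(\<lambda>k. \<integral>\<^sup>+\<omega>. ennreal ((Y \<omega> - rect_integral B (ys k) \<omega>)\<^sup>2) \<partial>M) \<longlonglongrightarrow> 0"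
    using assms(2) unfolding has_rect_integral_def by blast
  note [measurable] = rect_kernel_measurable[OF xs(1)] rect_kernel_measurable[OF ys(1)]
    rect_integral_measurable[OF xs(1)] rect_integral_measurable[OF ys(1)]
  define zs where "zs k = xs k @ map (\<lambda>(a, S, T). (c * a, S, T)) (ys k)" for k
  have zs: "off_diagonal_rects (zs k)" for k
    unfolding zs_def using xs(1) ys(1) rect_scale(3)[of "ys k" c] by simp
  have "(\<lambda>k. \<integral>\<^sup>+z. ennreal ((f z + c * g z - rect_kernel (zs k) z)\<^sup>2) \<partial>lborel) \<longlonglongrightarrow> 0"
  proof (rule ennreal_tendsto_0_bound[OF _ xs(2) ys(2)])
    fix k
    have "sq_integral lborel (\<lambda>z. f z + c * g z - rect_kernel (zs k) z)
       = sq_integral lborel (\<lambda>z. (f z - rect_kernel (xs k) z) + c * (g z - rect_kernel (ys k) z))"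
      by (simp only: zs_def rect_simps rect_scale) (simp add: algebra_simps)
    also have "\<dots> \<le> 2 * sq_integral lborel (\<lambda>z. f z - rect_kernel (xs k) z)
        + 2 * sq_integral lborel (\<lambda>z. c * (g z - rect_kernel (ys k) z))"
      by (rule nn_integral_square_add) auto
    also have "\<dots> = 2 * sq_integral lborel (\<lambda>z. f z - rect_kernel (xs k) z)
        + (2 * ennreal (c\<^sup>2)) * sq_integral lborel (\<lambda>z. g z - rect_kernel (ys k) z)"
      by (subst nn_integral_square_cmult) (auto simp: mult.assoc)
    finally show "sq_integral lborel (\<lambda>z. f z + c * g z - rect_kernel (zs k) z) \<le> \<dots>" .
  qed (auto simp: ennreal_mult_eq_top_iff)
  moreover have "(\<lambda>k. \<integral>\<^sup>+\<omega>. ennreal ((X \<omega> + c * Y \<omega> - rect_integral B (zs k) \<omega>)\<^sup>2) \<partial>M) \<longlonglongrightarrow> 0"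
  proof (rule ennreal_tendsto_0_bound[OF _ xs(3) ys(3)])
    fix k
    have "sq_integral M (\<lambda>\<omega>. X \<omega> + c * Y \<omega> - rect_integral B (zs k) \<omega>)
       = sq_integral M (\<lambda>\<omega>. (X \<omega> - rect_integral B (xs k) \<omega>) + c * (Y \<omega> - rect_integral B (ys k) \<omega>))"
      by (simp only: zs_def rect_simps rect_scale) (simp add: algebra_simps)
    also have "\<dots> \<le> 2 * sq_integral M (\<lambda>\<omega>. X \<omega> - rect_integral B (xs k) \<omega>)
        + 2 * sq_integral M (\<lambda>\<omega>. c * (Y \<omega> - rect_integral B (ys k) \<omega>))"
      by (rule nn_integral_square_add) auto
    also have "\<dots> = 2 * sq_integral M (\<lambda>\<omega>. X \<omega> - rect_integral B (xs k) \<omega>)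
        + (2 * ennreal (c\<^sup>2)) * sq_integral M (\<lambda>\<omega>. Y \<omega> - rect_integral B (ys k) \<omega>)"
      by (subst nn_integral_square_cmult) (auto simp: mult.assoc)
    finally show "sq_integral M (\<lambda>\<omega>. X \<omega> + c * Y \<omega> - rect_integral B (zs k) \<omega>) \<le> \<dots>" .
  qed (auto simp: ennreal_mult_eq_top_iff)
  ultimately show ?thesis
    unfolding has_rect_integral_def using zs by (intro conjI exI[of _ zs]) auto
qed

lemma has_rect_integral_rects:
  "off_diagonal_rects xs \<Longrightarrow> has_rect_integral M B (rect_kernel xs) (rect_integral B xs)"
  unfolding has_rect_integral_def
  by (intro conjI exI[of _ "\<lambda>_. xs"] rect_kernel_measurable rect_integral_measurable) auto

text \<open>The factor 8 is 2 * 2 * 2: the bound for rectangle sums, and one splitting of a square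
  for X and one for f.\<close>

lemma has_rect_integral_bound:
  assumes "has_rect_integral M B f X"
  shows "sq_integral M X \<le> 8 * sq_integral lborel f"
proof -
  obtain xs where f[measurable]: "f \<in> borel_measurable lborel" and X[measurable]: "X \<in> borel_measurable M" and xs: "\<And>k. off_diagonal_rects (xs k)"
      "(\<lambda>k. \<integral>\<^sup>+z. ennreal ((f z - rect_kernel (xs k) z)\<^sup>2) \<partial>lborel) \<longlonglongrightarrow> 0"
      "(\<lambda>k. \<integral>\<^sup>+\<omega>. ennreal ((X \<omega> - rect_integral B (xs k) \<omega>)\<^sup>2) \<partial>M) \<longlonglongrightarrow> 0"
    using assms(1) unfolding has_rect_integral_def by blast
  note [measurable] = rect_kernel_measurable[OF xs(1)] rect_integral_measurable[OF xs(1)]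
  have le: "sq_integral M X \<le> 2 * sq_integral M (\<lambda>\<omega>. X \<omega> - rect_integral B (xs k) \<omega>)
     + (8 * sq_integral lborel (\<lambda>z. f z - rect_kernel (xs k) z) + 8 * sq_integral lborel f)" for k
  proof -
    have "sq_integral M X = sq_integral M (\<lambda>\<omega>. (X \<omega> - rect_integral B (xs k) \<omega>) + rect_integral B (xs k) \<omega>)"
      by simp
    also have "\<dots> \<le> 2 * sq_integral M (\<lambda>\<omega>. X \<omega> - rect_integral B (xs k) \<omega>) + 2 * sq_integral M (rect_integral B (xs k))"
      by (rule nn_integral_square_add) auto
    also have "\<dots> \<le> 2 * sq_integral M (\<lambda>\<omega>. X \<omega> - rect_integral B (xs k) \<omega>) + 2 * (2 * sq_integral lborel (rect_kernel (xs k)))"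
      using rect_integral_bound[OF xs(1)] by (intro add_left_mono mult_left_mono) auto
    also have "sq_integral lborel (rect_kernel (xs k)) = sq_integral lborel (\<lambda>z. (-1) * (f z - rect_kernel (xs k) z) + f z)"
      by simp
    also have "2 * sq_integral M (\<lambda>\<omega>. X \<omega> - rect_integral B (xs k) \<omega>) + 2 * (2 * \<dots>) \<le>
       2 * sq_integral M (\<lambda>\<omega>. X \<omega> - rect_integral B (xs k) \<omega>) + 2 * (2 * (2 * sq_integral lborel (\<lambda>z. (-1) * (f z - rect_kernel (xs k) z)) + 2 * sq_integral lborel f))"
      by (intro add_left_mono mult_left_mono nn_integral_square_add) auto
    finally show ?thesis by (subst (asm) nn_integral_square_cmult) (auto simp: distrib_left mult.assoc[symmetric])
  qed
  have "(\<lambda>k. 2 * sq_integral M (\<lambda>\<omega>. X \<omega> - rect_integral B (xs k) \<omega>)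
     + (8 * sq_integral lborel (\<lambda>z. f z - rect_kernel (xs k) z) + 8 * sq_integral lborel f))
     \<longlonglongrightarrow> 2 * 0 + (8 * 0 + 8 * sq_integral lborel f)"
    by (intro tendsto_add ennreal_tendsto_cmult xs tendsto_const) auto
  then show ?thesis using le by (intro LIMSEQ_le_const) auto
qed

end

text \<open>The product B(S) B(T) does not see the order of its factors, so transposing every
  rectangle leaves the approximating variables unchanged.\<close>

lemma has_rect_integral_swap:
  assumes "has_rect_integral M B f X"
  shows "has_rect_integral M B (\<lambda>z. f (snd z, fst z)) X"
proof -
  obtain xs where f[measurable]: "f \<in> borel_measurable lborel" and X: "X \<in> borel_measurable M" and xs: "\<And>k. off_diagonal_rects (xs k)"
      "(\<lambda>k. \<integral>\<^sup>+z. ennreal ((f z - rect_kernel (xs k) z)\<^sup>2) \<partial>lborel) \<longlonglongrightarrow> 0"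
      "(\<lambda>k. \<integral>\<^sup>+\<omega>. ennreal ((X \<omega> - rect_integral B (xs k) \<omega>)\<^sup>2) \<partial>M) \<longlonglongrightarrow> 0"
    using assms(1) unfolding has_rect_integral_def by blast
  note [measurable] = rect_kernel_measurable[OF xs(1)]
  define ys where "ys k = map (\<lambda>(a, S, T). (a, T, S)) (xs k)" for k
  have "sq_integral lborel (\<lambda>z. f (snd z, fst z) - rect_kernel (ys k) z) = sq_integral lborel (\<lambda>z. f z - rect_kernel (xs k) z)" for k
    unfolding ys_def rect_swap by (rule nn_integral_lborel_swap[of "\<lambda>z. ennreal ((f z - rect_kernel (xs k) z)\<^sup>2)"]) simp
  then show ?thesis
    unfolding has_rect_integral_def using xs X measurable_compose[OF measurable_swap f]
    by (intro conjI exI[of _ ys]) (auto simp: ys_def rect_swap)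
qed


section \<open>Norms of the power kernels\<close>


lemma pos_powr_measurable[measurable]: "(\<lambda>u. pos_powr u a) \<in> borel_measurable borel"
  unfolding pos_powr_def by measurable

lemma pos_powr_nonneg[simp]: "0 \<le> pos_powr u a" by (simp add: pos_powr_def)

lemma pos_powr_eq: "pos_powr u a = indicator {0..} u * u powr a"
  by (auto simp: pos_powr_def indicator_def)

lemma nn_integral_shift:
  fixes f :: "real \<Rightarrow> ennreal"
  assumes "f \<in> borel_measurable borel"
  shows "(\<integral>\<^sup>+x. f x \<partial>lborel) = (\<integral>\<^sup>+x. f (t + x) \<partial>lborel)" "(\<integral>\<^sup>+x. f x \<partial>lborel) = (\<integral>\<^sup>+x. f (t - x) \<partial>lborel)"
  using nn_integral_real_affine[OF assms, of 1 t] nn_integral_real_affine[OF assms, of "-1" t] by simp_all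

lemma nn_integral_exp_powr:
  assumes s: "s > 0" and c: "c > 0"
  shows "(\<integral>\<^sup>+v. ennreal (pos_powr v (s - 1) * exp (- (c * v))) \<partial>lborel) = ennreal (Gamma s * c powr (- s))"
proof -
  let ?I = "\<integral>\<^sup>+v. ennreal (pos_powr v (s - 1) * exp (- (c * v))) \<partial>lborel"
  have "ennreal (Gamma s) = (\<integral>\<^sup>+t. ennreal (indicator {0..} t * t powr (s - 1) / exp t) \<partial>lborel)"
    by (rule Gamma_conv_nn_integral_real[OF s])
  also have "\<dots> = ennreal c * (\<integral>\<^sup>+t. ennreal (indicator {0..} (0 + c * t) * (0 + c * t) powr (s - 1) / exp (0 + c * t)) \<partial>lborel)"
    using c by (subst nn_integral_real_affine[where c=c and t=0]) auto
  also have "(\<integral>\<^sup>+t. ennreal (indicator {0..} (0 + c * t) * (0 + c * t) powr (s - 1) / exp (0 + c * t)) \<partial>lborel)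
      = (\<integral>\<^sup>+v. ennreal (c powr (s - 1)) * ennreal (pos_powr v (s - 1) * exp (- (c * v))) \<partial>lborel)"
  proof (rule nn_integral_cong)
    fix v
    show "ennreal (indicator {0..} (0 + c * v) * (0 + c * v) powr (s - 1) / exp (0 + c * v)) =
      ennreal (c powr (s - 1)) * ennreal (pos_powr v (s - 1) * exp (- (c * v)))"
      using c by (cases "v \<ge> 0") (auto simp: ennreal_mult'[symmetric] pos_powr_eq indicator_def powr_mult exp_minus field_simps zero_le_mult_iff)
  qed
  also have "\<dots> = ennreal (c powr (s - 1)) * ?I" by (subst nn_integral_cmult) auto
  finally have "ennreal (c powr (- s)) * ennreal (Gamma s) = ennreal (c powr (- s)) * (ennreal c * (ennreal (c powr (s - 1)) * ?I))" by simp
  also have "\<dots> = ennreal (c powr (- s) * (c * c powr (s - 1))) * ?I"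
    by (simp add: ennreal_mult' ennreal_mult'' mult.assoc c less_imp_le)
  also have "c powr (- s) * (c * c powr (s - 1)) = 1"
  proof -
    have "c * c powr (s - 1) = c powr s" using c powr_add[of c 1 "s - 1"] by simp
    then show ?thesis using c by (simp add: powr_minus)
  qed
  finally show ?thesis using s by (simp add: ennreal_mult'[symmetric] mult.commute Gamma_real_pos less_imp_le)
qed

text \<open>Value at lag 1 of the autocorrelation of the power kernel u_+^a. Through its second
  argument the Beta function has a pole at a = -1/2, which is the degeneration studied here.\<close>

definition energy_const :: "real \<Rightarrow> real" where
  "energy_const a = Beta (a + 1) (- 2 * a - 1)"

lemma energy_const_pos: "-1 < a \<Longrightarrow> a < -1/2 \<Longrightarrow> energy_const a > 0"
  unfolding energy_const_def Beta_def by (intro divide_pos_pos mult_pos_pos Gamma_real_pos) auto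

text \<open>Euler's integral writes Gamma(-a) (u + d)^a as the integral of v^(-a-1) exp(-(u + d) v)
  over v > 0. Integrating first in u gives Gamma(a + 1), then in v Gamma(-2a - 1) d^(2a + 1), and
  the three Gamma values form the Beta value.\<close>

lemma power_correlation_pos:
  assumes a: "-1 < a" "a < -1/2" and d: "d > 0"
  shows "(\<integral>\<^sup>+u. ennreal (pos_powr u a) * ennreal (pos_powr (u + d) a) \<partial>lborel) = ennreal (energy_const a * d powr (2 * a + 1))" (is "?I = _")
proof -
  define h where "h u v = ennreal (pos_powr u a) * ennreal (pos_powr v (- a - 1) * exp (- ((u + d) * v)))" for u v :: real
  have [measurable]: "case_prod h \<in> borel_measurable (lborel \<Otimes>\<^sub>M lborel)" unfolding h_def by measurable
  have 1: "ennreal (Gamma (- a)) * (ennreal (pos_powr u a) * ennreal (pos_powr (u + d) a)) = (\<integral>\<^sup>+v. h u v \<partial>lborel)" for u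
  proof (cases "u > 0")
    case True
    have "(\<integral>\<^sup>+v. h u v \<partial>lborel) = ennreal (pos_powr u a) * ennreal (Gamma (- a) * (u + d) powr a)"
      unfolding h_def using nn_integral_exp_powr[of "- a" "u + d"] a d True by (subst nn_integral_cmult) auto
    then show ?thesis using True d a
      by (simp add: pos_powr_def ennreal_mult' Gamma_real_pos less_imp_le mult_ac)
  next
    case False then show ?thesis by (simp add: h_def pos_powr_def)
  qed
  have 2: "(\<integral>\<^sup>+u. h u v \<partial>lborel) = ennreal (Gamma (a + 1)) * ennreal (pos_powr v ((- 2 * a - 1) - 1) * exp (- (d * v)))" for v
  proof (cases "v > 0")
    case True
    have "(\<integral>\<^sup>+u. h u v \<partial>lborel) = (\<integral>\<^sup>+u. ennreal (v powr (- a - 1) * exp (- (d * v))) * ennreal (pos_powr u ((a + 1) - 1) * exp (- (v * u))) \<partial>lborel)"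
    proof (rule nn_integral_cong)
      fix u
      have "exp (- ((u + d) * v)) = exp (- (d * v)) * exp (- (v * u))"
        by (simp add: exp_add[symmetric] algebra_simps)
      then show "h u v = ennreal (v powr (- a - 1) * exp (- (d * v))) * ennreal (pos_powr u ((a + 1) - 1) * exp (- (v * u)))"
        using True unfolding h_def by (simp add: ennreal_mult'[symmetric] ennreal_mult''[symmetric] pos_powr_def[of v] mult_ac)
    qed
    also have "\<dots> = ennreal (v powr (- a - 1) * exp (- (d * v))) * ennreal (Gamma (a + 1) * v powr (- (a + 1)))"
      using nn_integral_exp_powr[of "a + 1" v] a True by (subst nn_integral_cmult) auto
    also have "\<dots> = ennreal (Gamma (a + 1)) * ennreal ((v powr (- a - 1) * v powr (- (a + 1))) * exp (- (d * v)))"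
      using a by (simp add: ennreal_mult'[symmetric] ennreal_mult''[symmetric] Gamma_real_pos less_imp_le mult_ac)
    also have "v powr (- a - 1) * v powr (- (a + 1)) = v powr ((- 2 * a - 1) - 1)"
    proof -
      have "(- a - 1) + (- (a + 1)) = (- 2 * a - 1) - 1" by simp
      then show ?thesis by (simp only: powr_add[symmetric])
    qed
    finally show ?thesis using True by (simp add: pos_powr_def)
  next
    case False then show ?thesis by (simp add: h_def pos_powr_def)
  qed
  have "ennreal (Gamma (- a)) * ?I = (\<integral>\<^sup>+u. \<integral>\<^sup>+v. h u v \<partial>lborel \<partial>lborel)"
    by (subst nn_integral_cmult[symmetric]) (auto simp: 1)
  also have "\<dots> = (\<integral>\<^sup>+v. \<integral>\<^sup>+u. h u v \<partial>lborel \<partial>lborel)"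
    by (rule lborel_pair.Fubini'[symmetric]) simp
  also have "\<dots> = ennreal (Gamma (a + 1)) * ennreal (Gamma (- 2 * a - 1) * d powr (- (- 2 * a - 1)))"
    unfolding 2 using nn_integral_exp_powr[of "- 2 * a - 1" d] a d by (subst nn_integral_cmult) auto
  finally have "ennreal (1 / Gamma (- a)) * (ennreal (Gamma (- a)) * ?I) = ennreal (1 / Gamma (- a)) * (ennreal (Gamma (a + 1)) * ennreal (Gamma (- 2 * a - 1) * d powr (- (- 2 * a - 1))))" by simp
  also have "ennreal (1 / Gamma (- a)) * (ennreal (Gamma (- a)) * ?I) = ?I"
  proof -
    have "Gamma (- a) > 0" using a by (intro Gamma_real_pos) auto
    then show ?thesis by (simp add: mult.assoc[symmetric] ennreal_mult'[symmetric])
  qed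
  also have "ennreal (1 / Gamma (- a)) * (ennreal (Gamma (a + 1)) * ennreal (Gamma (- 2 * a - 1) * d powr (- (- 2 * a - 1))))
     = ennreal (energy_const a * d powr (2 * a + 1))"
    using a Gamma_real_pos[of "- a"] Gamma_real_pos[of "a + 1"] Gamma_real_pos[of "- 2 * a - 1"]
    by (simp add: ennreal_mult'[symmetric] ennreal_mult''[symmetric] energy_const_def Beta_def add.commute)
  finally show ?thesis .
qed

lemma power_correlation:
  assumes a: "-1 < a" "a < -1/2" and sr: "s \<noteq> r"
  shows "(\<integral>\<^sup>+x. ennreal (pos_powr (s - x) a) * ennreal (pos_powr (r - x) a) \<partial>lborel) = ennreal (energy_const a * \<bar>s - r\<bar> powr (2 * a + 1))"
proof -
  have *: "(\<integral>\<^sup>+x. ennreal (pos_powr (s - x) a) * ennreal (pos_powr (r - x) a) \<partial>lborel) = ennreal (energy_const a * (r - s) powr (2 * a + 1))"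
    if "s < r" for s r
  proof -
    have "(\<integral>\<^sup>+x. ennreal (pos_powr (s - x) a) * ennreal (pos_powr (r - x) a) \<partial>lborel)
      = (\<integral>\<^sup>+u. ennreal (pos_powr (s - (s - u)) a) * ennreal (pos_powr (r - (s - u)) a) \<partial>lborel)"
      by (rule nn_integral_shift(2)) measurable
    also have "\<dots> = (\<integral>\<^sup>+u. ennreal (pos_powr u a) * ennreal (pos_powr (u + (r - s)) a) \<partial>lborel)"
      by (simp add: algebra_simps)
    finally show ?thesis using power_correlation_pos[OF a, of "r - s"] that by simp
  qed
  show ?thesis
  proof (cases "s < r")
    case True with *[OF True] show ?thesis by simp
  next
    case False with sr *[of r s] show ?thesis by (simp add: mult.commute)
  qed
qed

lemma nn_integral_powr_interval:
  assumes \<theta>: "\<theta> > -1" and pq: "p \<le> q"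
  shows "(\<integral>\<^sup>+r. ennreal ((r - p) powr \<theta>) * indicator {p..q} r \<partial>lborel) = ennreal ((q - p) powr (\<theta> + 1) / (\<theta> + 1))" (is ?A)
    "(\<integral>\<^sup>+r. ennreal ((q - r) powr \<theta>) * indicator {p..q} r \<partial>lborel) = ennreal ((q - p) powr (\<theta> + 1) / (\<theta> + 1))" (is ?B)
proof -
  have *: "(\<integral>\<^sup>+u. ennreal (u powr \<theta>) * indicator {0..q-p} u \<partial>lborel) = ennreal ((q - p) powr (\<theta> + 1) / (\<theta> + 1))"
    using nn_integral_has_integral_lebesgue'[OF _ has_integral_powr_from_0[OF \<theta>, of "q - p"]] pq by simp
  have "(\<integral>\<^sup>+r. ennreal ((r - p) powr \<theta>) * indicator {p..q} r \<partial>lborel) = (\<integral>\<^sup>+u. ennreal (((p + u) - p) powr \<theta>) * indicator {p..q} (p + u) \<partial>lborel)"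
    by (rule nn_integral_shift(1)) measurable
  also have "\<dots> = (\<integral>\<^sup>+u. ennreal (u powr \<theta>) * indicator {0..q-p} u \<partial>lborel)"
    by (intro nn_integral_cong) (auto simp: indicator_def)
  finally show ?A using * by simp
  have "(\<integral>\<^sup>+r. ennreal ((q - r) powr \<theta>) * indicator {p..q} r \<partial>lborel) = (\<integral>\<^sup>+u. ennreal ((q - (q - u)) powr \<theta>) * indicator {p..q} (q - u) \<partial>lborel)"
    by (rule nn_integral_shift(2)) measurable
  also have "\<dots> = (\<integral>\<^sup>+u. ennreal (u powr \<theta>) * indicator {0..q-p} u \<partial>lborel)"
    by (intro nn_integral_cong) (auto simp: indicator_def)
  finally show ?B using * by simp
qed

lemma nn_integral_distance_powr:
  assumes \<theta>: "\<theta> > -1" and pq: "p \<le> q"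
  shows "(\<integral>\<^sup>+s. (\<integral>\<^sup>+r. ennreal (\<bar>s - r\<bar> powr \<theta>) * indicator {p..q} r \<partial>lborel) * indicator {p..q} s \<partial>lborel)
     = ennreal (2 * (q - p) powr (\<theta> + 2) / ((\<theta> + 1) * (\<theta> + 2)))"
proof -
  have inner: "(\<integral>\<^sup>+r. ennreal (\<bar>s - r\<bar> powr \<theta>) * indicator {p..q} r \<partial>lborel)
     = ennreal ((s - p) powr (\<theta> + 1) / (\<theta> + 1)) + ennreal ((q - s) powr (\<theta> + 1) / (\<theta> + 1))" if "s \<in> {p..q}" for s
  proof -
    have "(\<integral>\<^sup>+r. ennreal (\<bar>s - r\<bar> powr \<theta>) * indicator {p..q} r \<partial>lborel)
      = (\<integral>\<^sup>+r. ennreal ((s - r) powr \<theta>) * indicator {p..s} r + ennreal ((r - s) powr \<theta>) * indicator {s..q} r \<partial>lborel)"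
      using that by (intro nn_integral_cong) (auto simp: indicator_def abs_if)
    also have "\<dots> = (\<integral>\<^sup>+r. ennreal ((s - r) powr \<theta>) * indicator {p..s} r \<partial>lborel) + (\<integral>\<^sup>+r. ennreal ((r - s) powr \<theta>) * indicator {s..q} r \<partial>lborel)"
      by (rule nn_integral_add) measurable
    finally show ?thesis using nn_integral_powr_interval(2)[OF \<theta>, of p s] nn_integral_powr_interval(1)[OF \<theta>, of s q] that by simp
  qed
  have "(\<integral>\<^sup>+s. (\<integral>\<^sup>+r. ennreal (\<bar>s - r\<bar> powr \<theta>) * indicator {p..q} r \<partial>lborel) * indicator {p..q} s \<partial>lborel)
    = (\<integral>\<^sup>+s. ennreal (1 / (\<theta> + 1)) * (ennreal ((s - p) powr (\<theta> + 1)) * indicator {p..q} s + ennreal ((q - s) powr (\<theta> + 1)) * indicator {p..q} s) \<partial>lborel)"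
  proof (rule nn_integral_cong)
    fix s
    show "(\<integral>\<^sup>+r. ennreal (\<bar>s - r\<bar> powr \<theta>) * indicator {p..q} r \<partial>lborel) * indicator {p..q} s =
      ennreal (1 / (\<theta> + 1)) * (ennreal ((s - p) powr (\<theta> + 1)) * indicator {p..q} s + ennreal ((q - s) powr (\<theta> + 1)) * indicator {p..q} s)"
      using inner[of s] \<theta> by (cases "s \<in> {p..q}") (auto simp: distrib_left ennreal_mult'[symmetric])
  qed
  also have "\<dots> = ennreal (1 / (\<theta> + 1)) * ((\<integral>\<^sup>+s. ennreal ((s - p) powr (\<theta> + 1)) * indicator {p..q} s \<partial>lborel) + (\<integral>\<^sup>+s. ennreal ((q - s) powr (\<theta> + 1)) * indicator {p..q} s \<partial>lborel))"
    by (subst nn_integral_cmult, measurable, subst nn_integral_add, measurable)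
  also have "\<dots> = ennreal (1 / (\<theta> + 1)) * (ennreal ((q - p) powr (\<theta> + 2) / (\<theta> + 2)) + ennreal ((q - p) powr (\<theta> + 2) / (\<theta> + 2)))"
    using nn_integral_powr_interval[of "\<theta> + 1", OF _ pq] \<theta> by (simp add: add.assoc)
  also have "\<dots> = ennreal (1 / (\<theta> + 1) * ((q - p) powr (\<theta> + 2) / (\<theta> + 2) + (q - p) powr (\<theta> + 2) / (\<theta> + 2)))"
    using \<theta> by (simp only: ennreal_plus[symmetric] ennreal_mult'[symmetric] divide_nonneg_pos powr_ge_zero)
  also have "1 / (\<theta> + 1) * ((q - p) powr (\<theta> + 2) / (\<theta> + 2) + (q - p) powr (\<theta> + 2) / (\<theta> + 2)) = 2 * (q - p) powr (\<theta> + 2) / ((\<theta> + 1) * (\<theta> + 2))"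
    by simp
  finally show ?thesis .
qed

text \<open>The square is a double integral over s and r, and Tonelli moves the integral over z
  inside. The correlation is given for s and r distinct; for each s the exceptional r form a null
  set.\<close>

lemma nn_integral_square_of_integral:
  fixes K :: "real \<Rightarrow> 'z \<Rightarrow> ennreal"
  assumes N: "sigma_finite_measure N" and K[measurable]: "case_prod K \<in> borel_measurable (lborel \<Otimes>\<^sub>M N)"
    and c: "c \<ge> 0" and \<theta>: "\<theta> > -1" and pq: "p \<le> q"
    and corr: "\<And>s r. s \<noteq> r \<Longrightarrow> (\<integral>\<^sup>+z. K s z * K r z \<partial>N) = ennreal (c * \<bar>s - r\<bar> powr \<theta>)"
  shows "(\<integral>\<^sup>+z. (\<integral>\<^sup>+s. K s z * indicator {p..q} s \<partial>lborel)\<^sup>2 \<partial>N) = ennreal (c * (2 * (q - p) powr (\<theta> + 2) / ((\<theta> + 1) * (\<theta> + 2))))"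
proof -
  interpret N: sigma_finite_measure N by fact
  interpret P: pair_sigma_finite lborel N ..
  have "(\<integral>\<^sup>+z. (\<integral>\<^sup>+s. K s z * indicator {p..q} s \<partial>lborel)\<^sup>2 \<partial>N)
     = (\<integral>\<^sup>+z. (\<integral>\<^sup>+s. (\<integral>\<^sup>+r. K s z * indicator {p..q} s * (K r z * indicator {p..q} r) \<partial>lborel) \<partial>lborel) \<partial>N)"
  proof (rule nn_integral_cong)
    fix z assume [measurable]: "z \<in> space N"
    have [measurable]: "(\<lambda>s. K s z) \<in> borel_measurable lborel" by measurable
    show "(\<integral>\<^sup>+s. K s z * indicator {p..q} s \<partial>lborel)\<^sup>2 = (\<integral>\<^sup>+s. (\<integral>\<^sup>+r. K s z * indicator {p..q} s * (K r z * indicator {p..q} r) \<partial>lborel) \<partial>lborel)"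
      unfolding power2_eq_square by (subst nn_integral_cmult, measurable, subst nn_integral_multc, measurable)
  qed
  also have "\<dots> = (\<integral>\<^sup>+s. (\<integral>\<^sup>+z. (\<integral>\<^sup>+r. K s z * indicator {p..q} s * (K r z * indicator {p..q} r) \<partial>lborel) \<partial>N) \<partial>lborel)"
    by (rule P.Fubini') measurable
  also have "\<dots> = (\<integral>\<^sup>+s. (\<integral>\<^sup>+r. (\<integral>\<^sup>+z. K s z * indicator {p..q} s * (K r z * indicator {p..q} r) \<partial>N) \<partial>lborel) \<partial>lborel)"
  proof (intro nn_integral_cong)
    fix s :: real
    show "(\<integral>\<^sup>+z. (\<integral>\<^sup>+r. K s z * indicator {p..q} s * (K r z * indicator {p..q} r) \<partial>lborel) \<partial>N) =
       (\<integral>\<^sup>+r. (\<integral>\<^sup>+z. K s z * indicator {p..q} s * (K r z * indicator {p..q} r) \<partial>N) \<partial>lborel)"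
      by (rule P.Fubini') measurable
  qed
  also have "\<dots> = (\<integral>\<^sup>+s. (\<integral>\<^sup>+r. ennreal c * (ennreal (\<bar>s - r\<bar> powr \<theta>) * indicator {p..q} r) \<partial>lborel) * indicator {p..q} s \<partial>lborel)"
  proof (rule nn_integral_cong)
    fix s :: real
    have "(\<integral>\<^sup>+r. (\<integral>\<^sup>+z. K s z * indicator {p..q} s * (K r z * indicator {p..q} r) \<partial>N) \<partial>lborel)
      = (\<integral>\<^sup>+r. ennreal c * (ennreal (\<bar>s - r\<bar> powr \<theta>) * indicator {p..q} r) * indicator {p..q} s \<partial>lborel)"
    proof (rule nn_integral_cong_AE, use AE_lborel_singleton[of s] in eventually_elim)
      fix r assume "r \<noteq> s"
      have "(\<integral>\<^sup>+z. K s z * indicator {p..q} s * (K r z * indicator {p..q} r) \<partial>N) = (\<integral>\<^sup>+z. (K s z * K r z) * (indicator {p..q} s * indicator {p..q} r) \<partial>N)"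
        by (simp add: mult_ac)
      also have "\<dots> = (\<integral>\<^sup>+z. K s z * K r z \<partial>N) * (indicator {p..q} s * indicator {p..q} r)"
        by (rule nn_integral_multc) measurable
      also have "\<dots> = ennreal c * (ennreal (\<bar>s - r\<bar> powr \<theta>) * indicator {p..q} r) * indicator {p..q} s"
        using corr[of s r] \<open>r \<noteq> s\<close> c by (simp add: ennreal_mult' mult_ac)
      finally show "(\<integral>\<^sup>+z. K s z * indicator {p..q} s * (K r z * indicator {p..q} r) \<partial>N) = \<dots>" .
    qed
    also have "\<dots> = (\<integral>\<^sup>+r. ennreal c * (ennreal (\<bar>s - r\<bar> powr \<theta>) * indicator {p..q} r) \<partial>lborel) * indicator {p..q} s"
      by (rule nn_integral_multc) measurable
    finally show "(\<integral>\<^sup>+r. (\<integral>\<^sup>+z. K s z * indicator {p..q} s * (K r z * indicator {p..q} r) \<partial>N) \<partial>lborel) = \<dots>" .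
  qed
  also have "\<dots> = ennreal c * (\<integral>\<^sup>+s. (\<integral>\<^sup>+r. ennreal (\<bar>s - r\<bar> powr \<theta>) * indicator {p..q} r \<partial>lborel) * indicator {p..q} s \<partial>lborel)"
    by (subst nn_integral_cmult, measurable, subst nn_integral_cmult[symmetric], measurable, simp add: mult.assoc)
  also have "\<dots> = ennreal (c * (2 * (q - p) powr (\<theta> + 2) / ((\<theta> + 1) * (\<theta> + 2))))"
    unfolding nn_integral_distance_powr[OF \<theta> pq] using c by (rule ennreal_mult'[symmetric])
  finally show ?thesis .
qed

lemma nn_integral_product:
  fixes f g :: "real \<Rightarrow> ennreal"
  assumes [measurable]: "f \<in> borel_measurable lborel" "g \<in> borel_measurable lborel"
  shows "(\<integral>\<^sup>+z. f (fst z) * g (snd z) \<partial>(lborel :: (real \<times> real) measure)) = (\<integral>\<^sup>+x. f x \<partial>lborel) * (\<integral>\<^sup>+y. g y \<partial>lborel)"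
proof -
  have "(\<integral>\<^sup>+z. f (fst z) * g (snd z) \<partial>(lborel :: (real \<times> real) measure)) = (\<integral>\<^sup>+x. \<integral>\<^sup>+y. f x * g y \<partial>lborel \<partial>lborel)"
    unfolding lborel_prod[symmetric]
    by (subst lborel.nn_integral_fst[symmetric]) auto
  also have "\<dots> = (\<integral>\<^sup>+x. f x \<partial>lborel) * (\<integral>\<^sup>+y. g y \<partial>lborel)"
    by (subst nn_integral_cmult, measurable, subst nn_integral_multc, measurable)
  finally show ?thesis .
qed

text \<open>For b > -1 this is ((q - y)_+^(b+1) - (p - y)_+^(b+1)) / (b + 1), the Mandelbrot-Van
  Ness kernel up to a constant. The integral form makes its norm a case of the general square
  computation.\<close>

definition time_kernel :: "real \<Rightarrow> real \<Rightarrow> real \<Rightarrow> real \<Rightarrow> ennreal" where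
  "time_kernel b p q y = (\<integral>\<^sup>+s. ennreal (pos_powr (s - y) b) * indicator {p..q} s \<partial>lborel)"

text \<open>One half of the symmetrised kernel, before normalisation. Values in
  \<open>ennreal\<close> make Tonelli available before finiteness is known.\<close>

definition pair_kernel :: "real \<Rightarrow> real \<Rightarrow> real \<Rightarrow> real \<Rightarrow> real \<times> real \<Rightarrow> ennreal" where
  "pair_kernel a b p q z = (\<integral>\<^sup>+s. (ennreal (pos_powr (s - fst z) a) * ennreal (pos_powr (s - snd z) b)) * indicator {p..q} s \<partial>lborel)"

lemma fst_snd_lborel_measurable[measurable]:
  "(fst :: real \<times> real \<Rightarrow> real) \<in> lborel \<rightarrow>\<^sub>M borel" "(snd :: real \<times> real \<Rightarrow> real) \<in> lborel \<rightarrow>\<^sub>M borel"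
  by (auto intro!: borel_measurable_continuous_onI continuous_intros)

lemma time_kernel_measurable[measurable]: "time_kernel b p q \<in> borel_measurable borel"
proof -
  have "(\<lambda>y. \<integral>\<^sup>+s. ennreal (pos_powr (s - y) b) * indicator {p..q} s \<partial>lborel) \<in> borel_measurable borel" by measurable
  then show ?thesis unfolding time_kernel_def[abs_def] .
qed

lemma pair_kernel_measurable: "pair_kernel a b p q \<in> borel_measurable lborel"
proof -
  have "(\<lambda>z. \<integral>\<^sup>+s. (ennreal (pos_powr (s - fst z) a) * ennreal (pos_powr (s - snd z) b)) * indicator {p..q} s \<partial>lborel) \<in> borel_measurable (lborel :: (real \<times> real) measure)" by measurable
  then show ?thesis unfolding pair_kernel_def[abs_def] .
qed

lemma time_kernel_norm:
  assumes b: "-1 < b" "b < -1/2" and pq: "p \<le> q"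
  shows "(\<integral>\<^sup>+y. (time_kernel b p q y)\<^sup>2 \<partial>lborel) = ennreal (energy_const b * (q - p) powr (2 * b + 3) / ((b + 1) * (2 * b + 3)))"
proof -
  have "(\<integral>\<^sup>+y. (time_kernel b p q y)\<^sup>2 \<partial>lborel) = ennreal (energy_const b * (2 * (q - p) powr ((2 * b + 1) + 2) / (((2 * b + 1) + 1) * ((2 * b + 1) + 2))))"
    unfolding time_kernel_def
    by (rule nn_integral_square_of_integral[OF sigma_finite_lborel _ _ _ pq power_correlation[OF b]])
      (use b energy_const_pos[OF b] in \<open>auto\<close>)
  also have "energy_const b * (2 * (q - p) powr ((2 * b + 1) + 2) / (((2 * b + 1) + 1) * ((2 * b + 1) + 2))) = energy_const b * (q - p) powr (2 * b + 3) / ((b + 1) * (2 * b + 3))"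
  proof -
    have "((2 * b + 1) + 1) * ((2 * b + 1) + 2) = 2 * ((b + 1) * (2 * b + 3))" by algebra
    moreover have "(2 * b + 1) + 2 = 2 * b + 3" by simp
    moreover have "2 * (x / (2 * y)) = x / y" for x y :: real by simp
    ultimately show ?thesis by (simp only: times_divide_eq_right[symmetric])
  qed
  finally show ?thesis .
qed

text \<open>The correlation factorises over the two variables, so the exponents add to 2a + 2b + 2.
  The condition a + b > -3/2 of the region is exactly the integrability of this power at 0.\<close>

lemma pair_kernel_norm:
  assumes ab: "(a, b) \<in> rosenblatt_region" and pq: "p \<le> q"
  shows "(\<integral>\<^sup>+z. (pair_kernel a b p q z)\<^sup>2 \<partial>lborel) =
     ennreal (energy_const a * energy_const b * (q - p) powr (2 * (a + b + 2)) / ((a + b + 2) * (2 * (a + b) + 3)))"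
proof -
  have a: "-1 < a" "a < -1/2" and b: "-1 < b" "b < -1/2" and sum: "a + b > -3/2" using ab by (auto simp: rosenblatt_region_def)
  have corr: "(\<integral>\<^sup>+z. (ennreal (pos_powr (s - fst z) a) * ennreal (pos_powr (s - snd z) b)) * (ennreal (pos_powr (r - fst z) a) * ennreal (pos_powr (r - snd z) b)) \<partial>lborel)
    = ennreal ((energy_const a * energy_const b) * \<bar>s - r\<bar> powr (2 * a + 2 * b + 2))" if "s \<noteq> r" for s r
  proof -
    have "(\<integral>\<^sup>+z. (ennreal (pos_powr (s - fst z) a) * ennreal (pos_powr (s - snd z) b)) * (ennreal (pos_powr (r - fst z) a) * ennreal (pos_powr (r - snd z) b)) \<partial>lborel)
      = (\<integral>\<^sup>+z. (ennreal (pos_powr (s - fst z) a) * ennreal (pos_powr (r - fst z) a)) * (ennreal (pos_powr (s - snd z) b) * ennreal (pos_powr (r - snd z) b)) \<partial>lborel)"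
      by (simp add: mult_ac)
    also have "\<dots> = ennreal (energy_const a * \<bar>s - r\<bar> powr (2 * a + 1)) * ennreal (energy_const b * \<bar>s - r\<bar> powr (2 * b + 1))"
      by (subst nn_integral_product, measurable) (simp add: power_correlation[OF a that] power_correlation[OF b that])
    also have "\<dots> = ennreal ((energy_const a * energy_const b) * (\<bar>s - r\<bar> powr (2 * a + 1) * \<bar>s - r\<bar> powr (2 * b + 1)))"
      using energy_const_pos[OF a] energy_const_pos[OF b] by (subst ennreal_mult'[symmetric]) (auto simp: mult_ac)
    also have "\<bar>s - r\<bar> powr (2 * a + 1) * \<bar>s - r\<bar> powr (2 * b + 1) = \<bar>s - r\<bar> powr (2 * a + 2 * b + 2)"
      by (subst powr_add[symmetric]) (simp add: algebra_simps)
    finally show ?thesis .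
  qed
  have "(\<integral>\<^sup>+z. (pair_kernel a b p q z)\<^sup>2 \<partial>lborel) = ennreal ((energy_const a * energy_const b) * (2 * (q - p) powr ((2 * a + 2 * b + 2) + 2) / (((2 * a + 2 * b + 2) + 1) * ((2 * a + 2 * b + 2) + 2))))"
    unfolding pair_kernel_def
    by (rule nn_integral_square_of_integral[OF sigma_finite_lborel _ _ _ pq corr])
      (use sum energy_const_pos[OF a] energy_const_pos[OF b] in auto)
  also have "(energy_const a * energy_const b) * (2 * (q - p) powr ((2 * a + 2 * b + 2) + 2) / (((2 * a + 2 * b + 2) + 1) * ((2 * a + 2 * b + 2) + 2)))
     = energy_const a * energy_const b * (q - p) powr (2 * (a + b + 2)) / ((a + b + 2) * (2 * (a + b) + 3))"
  proof -
    have "((2 * a + 2 * b + 2) + 1) * ((2 * a + 2 * b + 2) + 2) = 2 * ((a + b + 2) * (2 * (a + b) + 3))" by algebra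
    moreover have "(2 * a + 2 * b + 2) + 2 = 2 * (a + b + 2)" by simp
    moreover have "2 * (x / (2 * y)) = x / y" for x y :: real by simp
    ultimately show ?thesis by (simp only: times_divide_eq_right[symmetric])
  qed
  finally show ?thesis .
qed

lemma nn_integral_power_tail:
  assumes a: "a < -1/2" and L: "L > 0"
  shows "(\<integral>\<^sup>+x. ennreal (((- x) powr a)\<^sup>2) * indicator {..- L} x \<partial>lborel) = ennreal (L powr (2 * a + 1) / (- 2 * a - 1))"
proof -
  have "(\<integral>\<^sup>+x. ennreal (((- x) powr a)\<^sup>2) * indicator {..- L} x \<partial>lborel) = (\<integral>\<^sup>+x. ennreal (((- (0 - x)) powr a)\<^sup>2) * indicator {..- L} (0 - x) \<partial>lborel)"
    by (rule nn_integral_shift(2)) measurable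
  also have "\<dots> = (\<integral>\<^sup>+x. ennreal (x powr (2 * a)) * indicator {L..} x \<partial>lborel)"
  proof (rule nn_integral_cong)
    fix x
    have "(x powr a)\<^sup>2 = x powr (2 * a)" by (simp add: power2_eq_square powr_add[symmetric])
    then show "ennreal (((- (0 - x)) powr a)\<^sup>2) * indicator {..- L} (0 - x) = ennreal (x powr (2 * a)) * indicator {L..} x"
      by (auto simp: indicator_def)
  qed
  also have "\<dots> = ennreal (0 - L powr (2 * a + 1) / (2 * a + 1))"
  proof (rule nn_integral_FTC_atLeast)
    fix x assume "L \<le> x"
    then show "((\<lambda>x. x powr (2 * a + 1) / (2 * a + 1)) has_real_derivative x powr (2 * a)) (at x)"
      using DERIV_cdivide[OF has_real_derivative_powr[of x "2 * a + 1"], of "2 * a + 1"] L a by simp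
  next
    have "((\<lambda>x::real. x powr (2 * a + 1)) \<longlongrightarrow> 0) at_top" using a by (intro tendsto_neg_powr filterlim_ident) auto
    then have "((\<lambda>x::real. x powr (2 * a + 1) / (2 * a + 1)) \<longlongrightarrow> 0 / (2 * a + 1)) at_top" using a by (intro tendsto_divide) auto
    then show "((\<lambda>x::real. x powr (2 * a + 1) / (2 * a + 1)) \<longlongrightarrow> 0) at_top" by simp
  qed auto
  also have "0 - L powr (2 * a + 1) / (2 * a + 1) = L powr (2 * a + 1) / (- 2 * a - 1)"
    using minus_divide_right[of "L powr (2 * a + 1)" "2 * a + 1"] by simp
  finally show ?thesis .
qed

text \<open>Since b < 0, (s - y)^b is at most (-y)^b for s >= 0 and y <= -L, so the time integral is
  at most t (-y)^b there.\<close>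

lemma time_kernel_tail:
  assumes b: "b < -1/2" and L: "L > 0" and t: "t \<ge> 0"
  shows "(\<integral>\<^sup>+y. (time_kernel b 0 t y)\<^sup>2 * indicator {..- L} y \<partial>lborel) \<le> ennreal (t\<^sup>2 * L powr (2 * b + 1) / (- 2 * b - 1))"
proof -
  have "time_kernel b 0 t y \<le> ennreal (t * (- y) powr b)" if "y \<le> - L" for y
  proof -
    have "time_kernel b 0 t y \<le> (\<integral>\<^sup>+s. ennreal ((- y) powr b) * indicator {0..t} s \<partial>lborel)"
      unfolding time_kernel_def
    proof (rule nn_integral_mono)
      fix s
      show "ennreal (pos_powr (s - y) b) * indicator {0..t} s \<le> ennreal ((- y) powr b) * indicator {0..t} s"
        using that L b by (auto simp: indicator_def pos_powr_def intro!: ennreal_leI powr_mono2')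
    qed
    also have "\<dots> = ennreal ((- y) powr b) * ennreal t" using t by (subst nn_integral_cmult_indicator) auto
    finally show ?thesis using t by (simp add: ennreal_mult' mult.commute)
  qed
  then have "(time_kernel b 0 t y)\<^sup>2 * indicator {..- L} y \<le> ennreal (t\<^sup>2) * (ennreal (((- y) powr b)\<^sup>2) * indicator {..- L} y)" for y
  proof (cases "y \<le> - L")
    case True
    have "(time_kernel b 0 t y)\<^sup>2 \<le> (ennreal (t * (- y) powr b))\<^sup>2"
      using \<open>\<And>y. y \<le> - L \<Longrightarrow> _ y\<close>[OF True] by (intro power_mono) auto
    also have "\<dots> = ennreal (t\<^sup>2) * ennreal (((- y) powr b)\<^sup>2)"
      using t by (simp add: ennreal_power power_mult_distrib ennreal_mult')
    finally show ?thesis using True by simp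
  qed simp
  then have "(\<integral>\<^sup>+y. (time_kernel b 0 t y)\<^sup>2 * indicator {..- L} y \<partial>lborel) \<le> (\<integral>\<^sup>+y. ennreal (t\<^sup>2) * (ennreal (((- y) powr b)\<^sup>2) * indicator {..- L} y) \<partial>lborel)"
    by (intro nn_integral_mono) auto
  also have "\<dots> = ennreal (t\<^sup>2) * ennreal (L powr (2 * b + 1) / (- 2 * b - 1))"
    by (subst nn_integral_cmult, measurable) (simp add: nn_integral_power_tail[OF b L, simplified])
  also have "\<dots> = ennreal (t\<^sup>2 * L powr (2 * b + 1) / (- 2 * b - 1))"
    by (subst ennreal_mult'[symmetric]) auto
  finally show ?thesis .
qed

text \<open>For 0 <= s <= t one has s - x <= t - x <= ((L + t)/L) (-x). As a < 0 the inequality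
  reverses under the power, so the first factor is at least a constant multiple of (-x)^a uniformly
  in s and leaves the integral. That constant tends to 1 as L grows.\<close>

lemma pair_kernel_lower:
  assumes a: "a < 0" and L: "L > 0" and t: "t \<ge> 0" and x: "x \<le> - L"
  shows "ennreal (((L + t) / L) powr a * (- x) powr a) * time_kernel b 0 t y \<le> pair_kernel a b 0 t (x, y)"
proof -
  have tx: "t - x > 0" using assms by simp
  have "((L + t) / L) * (- x) \<ge> t - x"
  proof -
    have "t * L \<le> t * (- x)" using t x by (intro mult_left_mono) auto
    then show ?thesis using L by (simp add: field_simps)
  qed
  then have "(((L + t) / L) * (- x)) powr a \<le> (t - x) powr a"
    using tx a by (intro powr_mono2') auto
  then have *: "((L + t) / L) powr a * (- x) powr a \<le> (t - x) powr a"
    using L t x by (simp add: powr_mult[symmetric])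
  have "ennreal (((L + t) / L) powr a * (- x) powr a) * time_kernel b 0 t y =
    (\<integral>\<^sup>+s. ennreal (((L + t) / L) powr a * (- x) powr a) * (ennreal (pos_powr (s - y) b) * indicator {0..t} s) \<partial>lborel)"
    unfolding time_kernel_def by (subst nn_integral_cmult) auto
  also have "\<dots> \<le> pair_kernel a b 0 t (x, y)"
    unfolding pair_kernel_def
  proof (rule nn_integral_mono)
    fix s
    have "((L + t) / L) powr a * (- x) powr a \<le> pos_powr (s - x) a" if "s \<in> {0..t}"
    proof -
      have "(t - x) powr a \<le> (s - x) powr a" using that assms by (intro powr_mono2') auto
      then show ?thesis using * that x L by (simp add: pos_powr_def)
    qed
    then show "ennreal (((L + t) / L) powr a * (- x) powr a) * (ennreal (pos_powr (s - y) b) * indicator {0..t} s)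
       \<le> ennreal (pos_powr (s - fst (x, y)) a) * ennreal (pos_powr (s - snd (x, y)) b) * indicator {0..t} s"
      by (cases "s \<in> {0..t}") (auto intro!: mult_right_mono ennreal_leI)
  qed
  finally show ?thesis .
qed


section \<open>Moment bound and step functions\<close>


lemma pair_kernel_swap: "pair_kernel a b p q (snd z, fst z) = pair_kernel b a p q z"
  by (simp add: pair_kernel_def mult_ac)

lemma region_swap: "(a, b) \<in> rosenblatt_region \<Longrightarrow> (b, a) \<in> rosenblatt_region"
  by (auto simp: rosenblatt_region_def)

lemma pair_kernel_split:
  assumes "p \<le> q" "q \<le> r"
  shows "pair_kernel a b p r z = pair_kernel a b p q z + pair_kernel a b q r z"
proof -
  let ?f = "\<lambda>s. ennreal (pos_powr (s - fst z) a) * ennreal (pos_powr (s - snd z) b)"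
  have "pair_kernel a b p r z = (\<integral>\<^sup>+s. ?f s * indicator {p..q} s + ?f s * indicator {q..r} s \<partial>lborel)"
    unfolding pair_kernel_def
    by (rule nn_integral_cong_AE, use AE_lborel_singleton[of q] in eventually_elim)
      (use assms in \<open>auto simp: indicator_def\<close>)
  also have "\<dots> = pair_kernel a b p q z + pair_kernel a b q r z"
    unfolding pair_kernel_def by (rule nn_integral_add) measurable
  finally show ?thesis .
qed

lemma pair_kernel_finite_AE:
  assumes "(a, b) \<in> rosenblatt_region" "p \<le> q"
  shows "AE z in lborel. pair_kernel a b p q z \<noteq> \<infinity>"
proof -
  note [measurable] = pair_kernel_measurable
  have "AE z in lborel. (pair_kernel a b p q z)\<^sup>2 \<noteq> \<infinity>"
    by (rule nn_integral_PInf_AE) (simp_all add: pair_kernel_norm[OF assms])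
  then show ?thesis by eventually_elim (auto simp: power2_eq_square)
qed

text \<open>Finiteness is essential: a divergent Lebesgue integral has the default value 0, and
  \<open>enn2real\<close> is additive only on finite values.\<close>

lemma rosenblatt_kernel_eq:
  assumes fin: "pair_kernel a b 0 t z \<noteq> \<infinity>" "pair_kernel b a 0 t z \<noteq> \<infinity>"
  shows "rosenblatt_kernel a b t z = enn2real (pair_kernel a b 0 t z) + enn2real (pair_kernel b a 0 t z)"
proof -
  obtain x1 x2 where z: "z = (x1, x2)" by (cases z)
  let ?f = "\<lambda>s. pos_powr (s - x1) a * pos_powr (s - x2) b" and ?g = "\<lambda>s. pos_powr (s - x1) b * pos_powr (s - x2) a"
  have "rosenblatt_kernel a b t z = (\<integral>s. indicator {0..t} s * (?f s + ?g s) \<partial>lborel)"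
    by (simp add: rosenblatt_kernel_def z set_lebesgue_integral_def)
  also have "\<dots> = enn2real (\<integral>\<^sup>+s. ennreal (indicator {0..t} s * (?f s + ?g s)) \<partial>lborel)"
    by (rule integral_eq_nn_integral) auto
  also have "(\<integral>\<^sup>+s. ennreal (indicator {0..t} s * (?f s + ?g s)) \<partial>lborel)
     = (\<integral>\<^sup>+s. ennreal (pos_powr (s - x1) a) * ennreal (pos_powr (s - x2) b) * indicator {0..t} s
          + ennreal (pos_powr (s - x1) b) * ennreal (pos_powr (s - x2) a) * indicator {0..t} s \<partial>lborel)"
    by (intro nn_integral_cong) (auto simp: indicator_def ennreal_plus ennreal_mult')
  also have "\<dots> = pair_kernel a b 0 t z + pair_kernel b a 0 t z"
    unfolding pair_kernel_def z by (subst nn_integral_add) auto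
  also have "enn2real \<dots> = enn2real (pair_kernel a b 0 t z) + enn2real (pair_kernel b a 0 t z)"
    using fin by (intro enn2real_plus) (auto simp: top.not_eq_extremum)
  finally show ?thesis .
qed

lemma rosenblatt_kernel_increment_AE:
  assumes ab: "(a, b) \<in> rosenblatt_region" and st: "0 \<le> s" "s \<le> t"
  shows "AE z in lborel. rosenblatt_kernel a b t z - rosenblatt_kernel a b s z
     = enn2real (pair_kernel a b s t z) + enn2real (pair_kernel b a s t z)"
  using pair_kernel_finite_AE[OF ab order_trans[OF st]] pair_kernel_finite_AE[OF region_swap[OF ab] order_trans[OF st]]
proof eventually_elim
  case (elim z)
  have 1: "pair_kernel a b 0 t z \<noteq> \<infinity>" "pair_kernel b a 0 t z \<noteq> \<infinity>" using elim st by auto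
  then have 2: "pair_kernel a b 0 s z \<noteq> \<infinity>" "pair_kernel b a 0 s z \<noteq> \<infinity>" "pair_kernel a b s t z \<noteq> \<infinity>" "pair_kernel b a s t z \<noteq> \<infinity>"
    using st by (auto simp: pair_kernel_split[of 0 s t])
  show ?case
    unfolding rosenblatt_kernel_eq[OF 1] rosenblatt_kernel_eq[OF 2(1,2)] pair_kernel_split[OF st]
    using 2 by (simp add: enn2real_plus top.not_eq_extremum)
qed

text \<open>The second claim drops a positive product of Beta values from the denominator. This
  loses nothing asymptotically, because \<open>energy_const a\<close> blows up as a tends to -1/2
  while that product stays bounded.\<close>

lemma rosenblatt_const_sq:
  assumes ab: "(a, b) \<in> rosenblatt_region"
  shows "(rosenblatt_const a b)\<^sup>2 = (a + b + 2) * (2 * (a + b) + 3) /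
     (Beta (a + 1) (- a - b - 1) * Beta (b + 1) (- a - b - 1) + energy_const a * energy_const b)"
    and "(rosenblatt_const a b)\<^sup>2 * (energy_const a * energy_const b) \<le> (a + b + 2) * (2 * (a + b) + 3)"
    and "rosenblatt_const a b > 0"
proof -
  have a: "-1 < a" "a < -1/2" and b: "-1 < b" "b < -1/2" and sum: "a + b > -3/2" using ab by (auto simp: rosenblatt_region_def)
  define D where "D = Beta (a + 1) (- a - b - 1) * Beta (b + 1) (- a - b - 1)"
  define E where "E = energy_const a * energy_const b"
  define h where "h = (a + b + 2) * (2 * (a + b) + 3)"
  have D: "D > 0" unfolding D_def Beta_def using a b by (intro mult_pos_pos divide_pos_pos Gamma_real_pos) auto
  have E: "E > 0" unfolding E_def using energy_const_pos a b by simp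
  have h: "h > 0" unfolding h_def using sum by (intro mult_pos_pos) auto
  have A: "rosenblatt_const a b = h powr (1/2) * (D + E) powr (-1/2)"
    by (simp add: rosenblatt_const_def D_def E_def h_def energy_const_def)
  have "(h powr (1/2))\<^sup>2 = h" "((D + E) powr (-1/2))\<^sup>2 = 1 / (D + E)"
    using h D E by (simp_all add: power2_eq_square powr_add[symmetric] powr_minus_divide)
  then show 1: "(rosenblatt_const a b)\<^sup>2 = (a + b + 2) * (2 * (a + b) + 3) /
     (Beta (a + 1) (- a - b - 1) * Beta (b + 1) (- a - b - 1) + energy_const a * energy_const b)"
    unfolding A power_mult_distrib by (simp add: D_def E_def h_def)
  have "h / (D + E) * E \<le> h" using h D E by (simp add: divide_le_eq)
  then show "(rosenblatt_const a b)\<^sup>2 * (energy_const a * energy_const b) \<le> (a + b + 2) * (2 * (a + b) + 3)"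
    unfolding 1 by (simp add: D_def E_def h_def)
  show "rosenblatt_const a b > 0" unfolding A using h D E by simp
qed

lemma nn_integral_enn2real_square_le:
  "sq_integral M (\<lambda>z. enn2real (f z)) \<le> (\<integral>\<^sup>+z. (f z)\<^sup>2 \<partial>M)"
proof (rule nn_integral_mono)
  fix z show "ennreal ((enn2real (f z))\<^sup>2) \<le> (f z)\<^sup>2"
    by (cases "f z") (auto simp: ennreal_power)
qed

lemma nn_integral_enn2real_square:
  assumes "AE z in M. f z \<noteq> \<infinity>"
  shows "sq_integral M (\<lambda>z. enn2real (f z)) = (\<integral>\<^sup>+z. (f z)\<^sup>2 \<partial>M)"
proof (rule nn_integral_cong_AE, use assms in eventually_elim)
  fix z assume "f z \<noteq> \<infinity>" then show "ennreal ((enn2real (f z))\<^sup>2) = (f z)\<^sup>2"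
    by (cases "f z") (auto simp: ennreal_power)
qed

text \<open>The numerator of the squared constant cancels the denominator of the kernel norm,
  leaving a pure power of q - p.\<close>

lemma const_pair_kernel_norm:
  assumes ab: "(a, b) \<in> rosenblatt_region" and pq: "p \<le> q"
  shows "ennreal ((rosenblatt_const a b)\<^sup>2) * (\<integral>\<^sup>+z. (pair_kernel a b p q z)\<^sup>2 \<partial>lborel) \<le> ennreal ((q - p) powr (2 * (a + b + 2)))"
proof -
  define h where "h = (a + b + 2) * (2 * (a + b) + 3)"
  have h: "h > 0" using ab unfolding h_def by (intro mult_pos_pos) (auto simp: rosenblatt_region_def)
  have "ennreal ((rosenblatt_const a b)\<^sup>2) * (\<integral>\<^sup>+z. (pair_kernel a b p q z)\<^sup>2 \<partial>lborel)
      = ennreal ((rosenblatt_const a b)\<^sup>2 * (energy_const a * energy_const b) * ((q - p) powr (2 * (a + b + 2)) / h))"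
    unfolding pair_kernel_norm[OF assms] h_def by (subst ennreal_mult'[symmetric]) (auto simp: mult_ac)
  also have "\<dots> \<le> ennreal (h * ((q - p) powr (2 * (a + b + 2)) / h))"
    using rosenblatt_const_sq(2)[OF ab] h unfolding h_def[symmetric] by (intro ennreal_leI mult_right_mono) auto
  also have "h * ((q - p) powr (2 * (a + b + 2)) / h) = (q - p) powr (2 * (a + b + 2))" using h by simp
  finally show ?thesis .
qed

text \<open>The kernel of an increment is the kernel of the time interval [s, t]. The constant is
  (1/2)^2 * 8 * 4: the prefactor A/2, the bound for double integrals, and the splitting of the
  symmetrised kernel.\<close>

lemma (in white_noise) rosenblatt_moment_bound:
  assumes ab: "(a, b) \<in> rosenblatt_region" and Z: "generalized_rosenblatt_process M B a b Z" and st: "0 \<le> s" "s \<le> t"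
  shows "sq_integral M (\<lambda>\<omega>. Z t \<omega> - Z s \<omega>) \<le> ennreal (8 * (t - s) powr (2 * (a + b + 2)))"
proof -
  define A where "A = rosenblatt_const a b"
  note [measurable] = pair_kernel_measurable
  obtain Yt where Yt: "has_double_wiener_ito_integral M B (rosenblatt_kernel a b t) Yt" "AE \<omega> in M. Z t \<omega> = A / 2 * Yt \<omega>"
    using Z st unfolding generalized_rosenblatt_process_def A_def by (metis order_trans)
  obtain Ys where Ys: "has_double_wiener_ito_integral M B (rosenblatt_kernel a b s) Ys" "AE \<omega> in M. Z s \<omega> = A / 2 * Ys \<omega>"
    using Z st unfolding generalized_rosenblatt_process_def A_def by metis
  have d: "has_rect_integral M B (\<lambda>z. rosenblatt_kernel a b t z + (-1) * rosenblatt_kernel a b s z) (\<lambda>\<omega>. Yt \<omega> + (-1) * Ys \<omega>)"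
    by (intro has_rect_integral_add_scaled has_double_imp_has_rect_integral Yt Ys)
  have [measurable]: "Yt \<in> borel_measurable M" "Ys \<in> borel_measurable M"
    using Yt(1) Ys(1) unfolding has_double_wiener_ito_integral_def by auto
  let ?P = "\<integral>\<^sup>+z. (pair_kernel a b s t z)\<^sup>2 \<partial>lborel"
  let ?q = "\<lambda>z. enn2real (pair_kernel a b s t z)" and ?r = "\<lambda>z. enn2real (pair_kernel b a s t z)"
  have r: "sq_integral lborel ?r \<le> ?P"
  proof -
    have "sq_integral lborel ?r \<le> (\<integral>\<^sup>+z. (pair_kernel a b s t (snd z, fst z))\<^sup>2 \<partial>lborel)"
      unfolding pair_kernel_swap by (rule nn_integral_enn2real_square_le)
    also have "\<dots> = ?P" by (rule nn_integral_lborel_swap[of "\<lambda>z. (pair_kernel a b s t z)\<^sup>2"]) simp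
    finally show ?thesis .
  qed
  have "sq_integral lborel (\<lambda>z. rosenblatt_kernel a b t z + (-1) * rosenblatt_kernel a b s z)
     = sq_integral lborel (\<lambda>z. ?q z + ?r z)"
    by (rule nn_integral_cong_AE, use rosenblatt_kernel_increment_AE[OF ab st] in eventually_elim) simp
  also have "\<dots> \<le> 2 * sq_integral lborel ?q + 2 * sq_integral lborel ?r"
    by (rule nn_integral_square_add) auto
  also have "\<dots> \<le> 2 * ?P + 2 * ?P"
    using r by (intro add_mono mult_left_mono nn_integral_enn2real_square_le) auto
  also have "\<dots> = 4 * ?P" by (simp add: distrib_right[symmetric])
  finally have K: "sq_integral lborel (\<lambda>z. rosenblatt_kernel a b t z + (-1) * rosenblatt_kernel a b s z) \<le> 4 * ?P" .
  have "sq_integral M (\<lambda>\<omega>. Z t \<omega> - Z s \<omega>) = sq_integral M (\<lambda>\<omega>. A / 2 * (Yt \<omega> + (-1) * Ys \<omega>))"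
    by (rule nn_integral_cong_AE, use Yt(2) Ys(2) in eventually_elim) (simp only: distrib_left, simp)
  also have "\<dots> = ennreal ((A / 2)\<^sup>2) * sq_integral M (\<lambda>\<omega>. Yt \<omega> + (-1) * Ys \<omega>)"
    by (rule nn_integral_square_cmult) measurable
  also have "\<dots> \<le> ennreal ((A / 2)\<^sup>2) * (8 * (4 * ?P))"
    using order_trans[OF has_rect_integral_bound[OF d] mult_left_mono[OF K]] by (intro mult_left_mono) auto
  also have "\<dots> = 8 * (ennreal (A\<^sup>2) * ?P)"
  proof -
    have "ennreal ((A / 2)\<^sup>2) * 4 = ennreal (A\<^sup>2)"
      using ennreal_mult'[of "4" "(A/2)\<^sup>2"] by (simp add: power_divide mult.commute)
    moreover have "ennreal ((A / 2)\<^sup>2) * (8 * (4 * ?P)) = 8 * ((ennreal ((A / 2)\<^sup>2) * 4) * ?P)"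
      by (simp only: mult.assoc mult.commute mult.left_commute)
    ultimately show ?thesis by simp
  qed
  also have "\<dots> \<le> 8 * ennreal ((t - s) powr (2 * (a + b + 2)))"
    unfolding A_def using const_pair_kernel_norm[OF ab st(2)] by (intro mult_left_mono) auto
  finally show ?thesis by (simp add: ennreal_mult')
qed

section \<open>Step functions of one variable and their Gaussian integrals\<close>

type_synonym steps = "(real \<times> real set) list"

definition step_fun :: "steps \<Rightarrow> real \<Rightarrow> real" where
  "step_fun xs x = (\<Sum>(a, S)\<leftarrow>xs. a * indicator S x)"

definition step_integral :: "(real set \<Rightarrow> 'a \<Rightarrow> real) \<Rightarrow> steps \<Rightarrow> 'a \<Rightarrow> real" where
  "step_integral B xs \<omega> = (\<Sum>(a, S)\<leftarrow>xs. a * B S \<omega>)"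

text \<open>Sets within one list may overlap; only their common location \<open>D\<close> is
  recorded, since disjointness matters between two lists.\<close>

definition step_sets :: "real set \<Rightarrow> steps \<Rightarrow> bool" where
  "step_sets D xs \<longleftrightarrow> (\<forall>(a, S)\<in>set xs. S \<in> fmeasurable lborel \<and> S \<subseteq> D)"

lemma step_simps [simp]:
  "step_fun [] x = 0" "step_fun ((a, S) # xs) x = a * indicator S x + step_fun xs x"
  "step_integral B [] \<omega> = 0" "step_integral B ((a, S) # xs) \<omega> = a * B S \<omega> + step_integral B xs \<omega>"
  "step_fun (xs @ ys) x = step_fun xs x + step_fun ys x"
  "step_integral B (xs @ ys) \<omega> = step_integral B xs \<omega> + step_integral B ys \<omega>"
  "step_sets D []" "step_sets D ((a, S) # xs) \<longleftrightarrow> S \<in> fmeasurable lborel \<and> S \<subseteq> D \<and> step_sets D xs"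
  by (auto simp: step_fun_def step_integral_def step_sets_def)

lemma step_sets_append [simp]: "step_sets D (xs @ ys) \<longleftrightarrow> step_sets D xs \<and> step_sets D ys"
  by (induction xs) auto

lemma step_sets_mono: "step_sets D xs \<Longrightarrow> D \<subseteq> E \<Longrightarrow> step_sets E xs"
  by (induction xs) (auto, blast)

lemma step_scale:
  fixes c :: real
  defines "sc \<equiv> \<lambda>(a::real, S::real set). (c * a, S)"
  shows "step_fun (map sc xs) x = c * step_fun xs x"
    "step_integral B (map sc xs) \<omega> = c * step_integral B xs \<omega>"
    "step_sets D (map sc xs) \<longleftrightarrow> step_sets D xs"
  by (induction xs) (auto simp: sc_def algebra_simps)

lemma step_fun_outside: "step_sets D xs \<Longrightarrow> x \<notin> D \<Longrightarrow> step_fun xs x = 0"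
  by (induction xs) (auto simp: indicator_def)

lemma step_fun_measurable: "step_sets D xs \<Longrightarrow> step_fun xs \<in> borel_measurable borel"
proof (induction xs)
  case (Cons x xs)
  obtain a S where x: "x = (a, S)" by (cases x)
  then have "S \<in> sets borel" "step_fun xs \<in> borel_measurable borel" using Cons by (auto dest: fmeasurableD)
  moreover have "step_fun ((a, S) # xs) = (\<lambda>x. a * indicator S x + step_fun xs x)" by (simp add: fun_eq_iff)
  ultimately show ?case unfolding x by simp
qed (simp add: step_fun_def[abs_def])

text \<open>The list runs over the nonzero values: their level sets have finite measure by
  Chebyshev's inequality, while the zero level set may have infinite measure.\<close>

lemma simple_nonneg_step_fun:
  fixes u :: "real \<Rightarrow> real"
  assumes u: "simple_function lborel u" and u0: "\<And>x. 0 \<le> u x" and supp: "\<And>x. x \<notin> D \<Longrightarrow> u x = 0"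
    and fin: "sq_integral lborel u < \<infinity>"
  shows "\<exists>xs. step_sets D xs \<and> step_fun xs = u"
proof -
  have fr: "finite (range u)" and ms: "\<And>y. u -` {y} \<in> sets lborel"
    using simple_functionD[OF u] by auto
  have [measurable]: "u \<in> borel_measurable lborel" using u by (rule borel_measurable_simple_function)
  obtain ys where ys: "set ys = range u - {0}" "distinct ys" using finite_distinct_list[of "range u - {0}"] fr by auto
  define xs where "xs = map (\<lambda>y. (y, u -` {y})) ys"
  have "step_fun xs x = u x" for x
  proof -
    have "step_fun xs x = (\<Sum>y\<in>range u - {0}. y * indicator (u -` {y}) x)"
      unfolding step_fun_def xs_def map_map comp_def
      using ys by (simp add: sum_list_distinct_conv_sum_set)
    also have "\<dots> = (\<Sum>y\<in>range u - {0}. if y = u x then u x else 0)"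
      by (intro sum.cong) (auto simp: indicator_def)
    also have "\<dots> = u x" using fr by (subst sum.delta) auto
    finally show ?thesis .
  qed
  moreover have "step_sets D xs"
  proof -
    have "u -` {y} \<in> fmeasurable lborel" if y: "y \<in> range u" "y \<noteq> 0" for y
    proof (rule fmeasurableI)
      have "ennreal (y\<^sup>2) * emeasure lborel (u -` {y}) = (\<integral>\<^sup>+x. ennreal (y\<^sup>2) * indicator (u -` {y}) x \<partial>lborel)"
        using ms by (subst nn_integral_cmult_indicator) auto
      also have "\<dots> \<le> sq_integral lborel u"
        by (intro nn_integral_mono) (auto simp: indicator_def)
      finally have "ennreal (y\<^sup>2) * emeasure lborel (u -` {y}) < \<infinity>" using fin by (rule order.strict_trans1)
      then show "emeasure lborel (u -` {y}) < \<infinity>" using y(2) by (auto simp: ennreal_mult_less_top)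
    qed (rule ms)
    moreover have "u -` {y} \<subseteq> D" if "y \<noteq> 0" for y using supp that by auto
    ultimately show ?thesis unfolding step_sets_def xs_def using ys(1) by auto
  qed
  ultimately show ?thesis by (intro exI[of _ xs]) auto
qed

text \<open>Monotone approximation from below by simple functions, with dominated convergence under
  f^2. The sandwich between 0 and f keeps the support inside \<open>D\<close> and the norm below
  that of f.\<close>

lemma step_approx:
  fixes f :: "real \<Rightarrow> real"
  assumes f[measurable]: "f \<in> borel_measurable borel" and f0: "\<And>x. 0 \<le> f x" and supp: "\<And>x. x \<notin> D \<Longrightarrow> f x = 0"
    and fin: "sq_integral lborel f < \<infinity>" and d: "d > 0"
  obtains xs where "step_sets D xs" "\<And>x. 0 \<le> step_fun xs x" "\<And>x. step_fun xs x \<le> f x"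
    "sq_integral lborel (\<lambda>x. f x - step_fun xs x) \<le> ennreal d"
proof -
  have "(\<lambda>x. ennreal (f x)) \<in> borel_measurable lborel" by measurable
  then obtain u where u: "\<And>i. simple_function lborel (u i)" "incseq u" "\<And>i x. u i x < top" "\<And>x. (SUP i. u i x) = ennreal (f x)"
    by (rule borel_measurable_implies_simple_function_sequence') blast
  define v where "v i x = enn2real (u i x)" for i x
  have uv: "u i x = ennreal (v i x)" for i x using u(3)[of i x] by (simp add: v_def)
  have v0: "v i x \<ge> 0" for i x by (simp add: v_def)
  have vf: "v i x \<le> f x" for i x
  proof -
    have "u i x \<le> ennreal (f x)" unfolding u(4)[of x, symmetric] by (rule SUP_upper) simp
    then show ?thesis using f0[of x] by (simp add: uv)
  qed
  have lim: "(\<lambda>i. v i x) \<longlonglongrightarrow> f x" for x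
  proof -
    have "(\<lambda>i. u i x) \<longlonglongrightarrow> ennreal (f x)" unfolding u(4)[of x, symmetric]
      by (rule LIMSEQ_SUP) (use u(2) in \<open>auto simp: incseq_def le_fun_def\<close>)
    then show ?thesis unfolding uv using f0 v0 by (subst (asm) tendsto_ennreal_iff) auto
  qed
  have sv: "simple_function lborel (v i)" for i unfolding v_def
    using u(1) by (rule simple_function_compose1)
  have [measurable]: "v i \<in> borel_measurable lborel" for i using sv by (rule borel_measurable_simple_function)
  have "(\<lambda>i. \<integral>\<^sup>+x. ennreal ((f x - v i x)\<^sup>2) \<partial>lborel) \<longlonglongrightarrow> (\<integral>\<^sup>+x. 0 \<partial>(lborel :: real measure))"
  proof (rule nn_integral_dominated_convergence[where w="\<lambda>x. ennreal ((f x)\<^sup>2)"])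
    show "AE x in lborel. ennreal ((f x - v i x)\<^sup>2) \<le> ennreal ((f x)\<^sup>2)" for i
      using v0 vf by (intro AE_I2 ennreal_leI power_mono) auto
    show "AE x in lborel. (\<lambda>i. ennreal ((f x - v i x)\<^sup>2)) \<longlonglongrightarrow> 0"
    proof (intro AE_I2)
      fix x have "(\<lambda>i. ennreal ((f x - v i x)\<^sup>2)) \<longlonglongrightarrow> ennreal ((f x - f x)\<^sup>2)"
        by (intro tendsto_ennrealI tendsto_intros lim)
      then show "(\<lambda>i. ennreal ((f x - v i x)\<^sup>2)) \<longlonglongrightarrow> 0" by simp
    qed
  qed (use fin in auto)
  then have "\<forall>\<^sub>F i in sequentially. sq_integral lborel (\<lambda>x. f x - v i x) < ennreal d"
    using d by (intro order_tendstoD(2)) auto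
  then obtain i where i: "sq_integral lborel (\<lambda>x. f x - v i x) < ennreal d" by (auto simp: eventually_sequentially)
  have "sq_integral lborel (v i) \<le> sq_integral lborel f"
    using v0 vf by (intro nn_integral_mono ennreal_leI power_mono) auto
  then have "sq_integral lborel (v i) < \<infinity>" using fin by (rule order.strict_trans1)
  moreover have "v i x = 0" if "x \<notin> D" for x using vf[of i x] v0[of i x] supp[OF that] by simp
  ultimately obtain xs where xs: "step_sets D xs" "step_fun xs = v i"
    using simple_nonneg_step_fun[OF sv v0] by blast
  show thesis by (rule that[OF xs(1)]) (use xs(2) v0 vf i in auto)
qed

definition step_product :: "steps \<Rightarrow> steps \<Rightarrow> rects" where
  "step_product xs ys = concat (map (\<lambda>(a, S). map (\<lambda>(b, T). (a * b, S, T)) ys) xs)"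

text \<open>When \<open>D\<close> and \<open>E\<close> are disjoint the tensor product avoids the
  diagonal, so the product of the two Gaussian sums is itself an exact double integral, without a
  trace term.\<close>

lemma step_product_facts:
  shows "rect_kernel (step_product xs ys) z = step_fun xs (fst z) * step_fun ys (snd z)"
    "rect_integral B (step_product xs ys) \<omega> = step_integral B xs \<omega> * step_integral B ys \<omega>"
    "step_sets D xs \<Longrightarrow> step_sets E ys \<Longrightarrow> D \<inter> E = {} \<Longrightarrow> off_diagonal_rects (step_product xs ys)"
proof -
  have 1: "rect_kernel (map (\<lambda>(b, T). (a * b, S, T)) ys) z = a * indicator S (fst z) * step_fun ys (snd z)"
    "rect_integral B (map (\<lambda>(b, T). (a * b, S, T)) ys) \<omega> = a * B S \<omega> * step_integral B ys \<omega>"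
    "S \<in> fmeasurable lborel \<Longrightarrow> S \<subseteq> D \<Longrightarrow> step_sets E ys \<Longrightarrow> D \<inter> E = {} \<Longrightarrow> off_diagonal_rects (map (\<lambda>(b, T). (a * b, S, T)) ys)" for a S
    by (induction ys) (auto simp: algebra_simps, blast)
  show "rect_kernel (step_product xs ys) z = step_fun xs (fst z) * step_fun ys (snd z)"
    "rect_integral B (step_product xs ys) \<omega> = step_integral B xs \<omega> * step_integral B ys \<omega>"
    "step_sets D xs \<Longrightarrow> step_sets E ys \<Longrightarrow> D \<inter> E = {} \<Longrightarrow> off_diagonal_rects (step_product xs ys)"
    by (induction xs) (auto simp: step_product_def 1 algebra_simps)
qed

lemma (in white_noise) step_integral_gaussian:
  assumes xs: "step_sets D xs"
  shows "step_integral B xs \<in> borel_measurable M"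
    "integrable M (\<lambda>\<omega>. (step_integral B xs \<omega>)\<^sup>2)" "(\<integral>\<omega>. (step_integral B xs \<omega>)\<^sup>2 \<partial>M) = (\<integral>x. (step_fun xs x)\<^sup>2 \<partial>lborel)"
    "integrable lborel (\<lambda>x. (step_fun xs x)\<^sup>2)"
    "(CLINT \<omega>|M. iexp (step_integral B xs \<omega>)) = exp (- (\<integral>x. (step_fun xs x)\<^sup>2 \<partial>lborel) / 2)"
proof -
  define n where "n = length xs"
  define a where "a i = fst (xs ! i)" for i
  define S where "S i = snd (xs ! i)" for i
  have S: "S i \<in> fmeasurable lborel" if "i \<in> {..<n}" for i
    using xs that unfolding step_sets_def n_def S_def by (metis (mono_tags, lifting) case_prod_beta lessThan_iff nth_mem)
  have SI: "step_integral B xs = (\<lambda>\<omega>. \<Sum>i<n. a i * B (S i) \<omega>)"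
    by (simp add: fun_eq_iff step_integral_def n_def a_def S_def sum_list_sum_nth lessThan_atLeast0 case_prod_beta)
  have SF: "step_fun xs = (\<lambda>x. \<Sum>i<n. a i * indicator (S i) x)"
    by (simp add: fun_eq_iff step_fun_def n_def a_def S_def sum_list_sum_nth lessThan_atLeast0 case_prod_beta)
  have g: "gaussian_variable M (step_integral B xs)" "(\<integral>\<omega>. step_integral B xs \<omega> \<partial>M) = 0"
    "integrable M (\<lambda>\<omega>. (step_integral B xs \<omega>)\<^sup>2)"
    "(\<integral>\<omega>. (step_integral B xs \<omega>)\<^sup>2 \<partial>M) = (\<Sum>i<n. \<Sum>j<n. a i * a j * measure lborel (S i \<inter> S j))"
    unfolding SI by (rule combination[OF finite_lessThan S], assumption)+
  show "step_integral B xs \<in> borel_measurable M" using g(1) by (simp add: gaussian_variable_def)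
  show "integrable M (\<lambda>\<omega>. (step_integral B xs \<omega>)\<^sup>2)" by fact
  have "has_bochner_integral lborel (\<lambda>x. \<Sum>i<n. \<Sum>j<n. a i * a j * indicator (S i \<inter> S j) x) (\<Sum>i<n. \<Sum>j<n. a i * a j * measure lborel (S i \<inter> S j))"
  proof (intro has_bochner_integral_sum has_bochner_integral_mult_right)
    fix i j assume "i \<in> {..<n}" "j \<in> {..<n}"
    then have "S i \<inter> S j \<in> fmeasurable lborel" using S by (intro fmeasurable.Int) auto
    then show "has_bochner_integral lborel (indicator (S i \<inter> S j)) (measure lborel (S i \<inter> S j))"
      by (intro has_bochner_integral_real_indicator) (auto simp: fmeasurable_def)
  qed
  moreover have "(\<lambda>x. \<Sum>i<n. \<Sum>j<n. a i * a j * indicator (S i \<inter> S j) x) = (\<lambda>x. (step_fun xs x)\<^sup>2)"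
    unfolding SF power2_eq_square sum_product by (intro ext sum.cong refl) (auto simp: indicator_def)
  ultimately have hb: "has_bochner_integral lborel (\<lambda>x. (step_fun xs x)\<^sup>2) (\<Sum>i<n. \<Sum>j<n. a i * a j * measure lborel (S i \<inter> S j))" by simp
  then show "integrable lborel (\<lambda>x. (step_fun xs x)\<^sup>2)" by (simp add: has_bochner_integral_iff)
  show v: "(\<integral>\<omega>. (step_integral B xs \<omega>)\<^sup>2 \<partial>M) = (\<integral>x. (step_fun xs x)\<^sup>2 \<partial>lborel)"
    unfolding g(4) using hb by (simp add: has_bochner_integral_iff)
  show "(CLINT \<omega>|M. iexp (step_integral B xs \<omega>)) = exp (- (\<integral>x. (step_fun xs x)\<^sup>2 \<partial>lborel) / 2)"
    unfolding v[symmetric] by (rule gaussian_variable_moments(4)[OF prob_space_axioms g(1,2)])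
qed


section \<open>Rank-one approximation of the kernel\<close>


lemma time_kernel_split:
  assumes "p \<le> q" "q \<le> r"
  shows "time_kernel b p r y = time_kernel b p q y + time_kernel b q r y"
proof -
  have "time_kernel b p r y = (\<integral>\<^sup>+s. ennreal (pos_powr (s - y) b) * indicator {p..q} s + ennreal (pos_powr (s - y) b) * indicator {q..r} s \<partial>lborel)"
    unfolding time_kernel_def
    by (rule nn_integral_cong_AE, use AE_lborel_singleton[of q] in eventually_elim)
      (use assms in \<open>auto simp: indicator_def\<close>)
  also have "\<dots> = time_kernel b p q y + time_kernel b q r y"
    unfolding time_kernel_def by (rule nn_integral_add) measurable
  finally show ?thesis .
qed

lemma time_kernel_finite_AE:
  assumes "-1 < b" "b < -1/2" "p \<le> q"
  shows "AE y in lborel. time_kernel b p q y \<noteq> \<infinity>"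
proof -
  have "AE y in lborel. (time_kernel b p q y)\<^sup>2 \<noteq> \<infinity>"
    by (rule nn_integral_PInf_AE) (simp_all add: time_kernel_norm[OF assms])
  then show ?thesis by eventually_elim (auto simp: power2_eq_square)
qed

text \<open>As \<open>a\<close> tends to \<open>-1/2\<close> the kernel loses square integrability at \<open>x = -\<infinity>\<close>; its \<open>L\<^sup>2\<close> mass
  concentrates on the normalised tail below, which carries the limiting factor \<open>W\<close>.\<close>

definition tail_mass :: "real \<Rightarrow> real \<Rightarrow> real" where
  "tail_mass a L = L powr (2 * a + 1) / (- 2 * a - 1)"

definition tail_fun :: "real \<Rightarrow> real \<Rightarrow> real \<Rightarrow> real" where
  "tail_fun a L x = (- x) powr a / sqrt (tail_mass a L) * indicator {..- L} x"

text \<open>The constant A and the norm of the tail are moved onto the second factor: the first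
  factor then has norm 1, and in the product the norm of the tail cancels.\<close>

definition limit_scale :: "real \<Rightarrow> real \<Rightarrow> real \<Rightarrow> real" where
  "limit_scale a b L = rosenblatt_const a b * sqrt (tail_mass a L)"

definition limit_kernel :: "real \<Rightarrow> real \<Rightarrow> real \<Rightarrow> real \<Rightarrow> real \<Rightarrow> real" where
  "limit_kernel a b L t y = limit_scale a b L * enn2real (time_kernel b 0 t y)"

definition time_norm :: "real \<Rightarrow> real \<Rightarrow> real" where
  "time_norm b t = energy_const b * t powr (2 * b + 3) / ((b + 1) * (2 * b + 3))"

definition time_tail :: "real \<Rightarrow> real \<Rightarrow> real \<Rightarrow> real" where
  "time_tail b L t = t\<^sup>2 * L powr (2 * b + 1) / (- 2 * b - 1)"

text \<open>Bounds the squared error of replacing Z(t) by a product of step integrals. The squared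
  norm of the cut kernel enters through an upper bound where its sign is positive and through a
  lower bound, reduced by the tail, where its sign is negative; \<delta> is the accuracy of the step
  functions.\<close>

definition approx_bound :: "real \<Rightarrow> real \<Rightarrow> real \<Rightarrow> real \<Rightarrow> real \<Rightarrow> real" where
  "approx_bound a b L \<delta> t = (let \<kappa> = (limit_scale a b L)\<^sup>2; \<rho> = ((L + t) / L) powr a in
     8 * (2 * (t powr (2 * (a + b + 2)) + \<kappa> * time_norm b t - 2 * \<rho> * (\<kappa> * time_norm b t - \<kappa> * time_tail b L t))
       + 4 * \<delta> * (\<kappa> * time_norm b t) + 4 * \<delta>))"

locale rosenblatt_parameters =
  fixes a b L :: real
  assumes ab: "(a, b) \<in> rosenblatt_region" and L: "L > 0"
begin

lemma a: "-1 < a" "a < -1/2" and b: "-1 < b" "b < -1/2"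
  using ab by (auto simp: rosenblatt_region_def)

lemma tail_mass_pos: "tail_mass a L > 0"
  unfolding tail_mass_def using a L by (intro divide_pos_pos) auto

lemma limit_scale_pos: "limit_scale a b L > 0"
  unfolding limit_scale_def using rosenblatt_const_sq(3)[OF ab] tail_mass_pos by simp

lemma tail_fun_nonneg: "0 \<le> tail_fun a L x"
  unfolding tail_fun_def using tail_mass_pos by (auto intro!: mult_nonneg_nonneg divide_nonneg_pos)

lemma tail_fun_measurable[measurable]: "tail_fun a L \<in> borel_measurable borel"
proof -
  have "(\<lambda>x. (- x) powr a / sqrt (tail_mass a L) * indicator {..- L} x) \<in> borel_measurable borel" by measurable
  then show ?thesis unfolding tail_fun_def[abs_def] .
qed

lemma tail_fun_norm: "sq_integral lborel (tail_fun a L) = 1"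
proof -
  have "sq_integral lborel (tail_fun a L)
      = (\<integral>\<^sup>+x. ennreal (1 / tail_mass a L) * (ennreal (((- x) powr a)\<^sup>2) * indicator {..- L} x) \<partial>lborel)"
    using tail_mass_pos
    by (intro nn_integral_cong) (auto simp: tail_fun_def indicator_def power_divide ennreal_mult'[symmetric])
  also have "\<dots> = ennreal (1 / tail_mass a L) * ennreal (tail_mass a L)"
    unfolding tail_mass_def by (subst nn_integral_cmult, measurable) (simp add: nn_integral_power_tail[OF a(2) L, simplified])
  also have "\<dots> = 1" using tail_mass_pos by (simp add: ennreal_mult'[symmetric])
  finally show ?thesis .
qed

lemma limit_kernel_nonneg: "0 \<le> limit_kernel a b L t y"
  unfolding limit_kernel_def using limit_scale_pos by simp

lemma limit_kernel_measurable[measurable]: "limit_kernel a b L t \<in> borel_measurable borel"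
proof -
  have "(\<lambda>y. limit_scale a b L * enn2real (time_kernel b 0 t y)) \<in> borel_measurable borel" by measurable
  then show ?thesis unfolding limit_kernel_def[abs_def] .
qed

lemma time_norm_nonneg: "t \<ge> 0 \<Longrightarrow> 0 \<le> time_norm b t"
  unfolding time_norm_def using energy_const_pos[OF b] b by (intro divide_nonneg_pos mult_nonneg_nonneg mult_pos_pos) auto

lemma time_tail_nonneg: "0 \<le> time_tail b L t"
  unfolding time_tail_def using b by (intro divide_nonneg_pos) auto

lemma limit_kernel_increment_norm:
  assumes st: "0 \<le> s" "s \<le> t"
  shows "sq_integral lborel (\<lambda>y. limit_kernel a b L t y - limit_kernel a b L s y) = ennreal ((limit_scale a b L)\<^sup>2 * time_norm b (t - s))"
proof -
  have "sq_integral lborel (\<lambda>y. limit_kernel a b L t y - limit_kernel a b L s y)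
    = sq_integral lborel (\<lambda>y. limit_scale a b L * enn2real (time_kernel b s t y))"
  proof (rule nn_integral_cong_AE, use time_kernel_finite_AE[OF b order_trans[OF st]] in eventually_elim)
    fix y assume "time_kernel b 0 t y \<noteq> \<infinity>"
    then have "enn2real (time_kernel b 0 t y) = enn2real (time_kernel b 0 s y) + enn2real (time_kernel b s t y)"
      unfolding time_kernel_split[OF st] by (intro enn2real_plus) (auto simp: top.not_eq_extremum)
    then have "limit_kernel a b L t y - limit_kernel a b L s y = limit_scale a b L * enn2real (time_kernel b s t y)"
      unfolding limit_kernel_def by (simp add: algebra_simps)
    then show "ennreal ((limit_kernel a b L t y - limit_kernel a b L s y)\<^sup>2) = ennreal ((limit_scale a b L * enn2real (time_kernel b s t y))\<^sup>2)" by simp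
  qed
  also have "\<dots> = ennreal ((limit_scale a b L)\<^sup>2) * sq_integral lborel (\<lambda>y. enn2real (time_kernel b s t y))"
    by (rule nn_integral_square_cmult) measurable
  also have "sq_integral lborel (\<lambda>y. enn2real (time_kernel b s t y)) = (\<integral>\<^sup>+y. (time_kernel b s t y)\<^sup>2 \<partial>lborel)"
    by (rule nn_integral_enn2real_square[OF time_kernel_finite_AE[OF b st(2)]])
  also have "\<dots> = ennreal (time_norm b (t - s))"
    unfolding time_norm_def by (rule time_kernel_norm[OF b st(2)])
  also have "ennreal ((limit_scale a b L)\<^sup>2) * ennreal (time_norm b (t - s)) = ennreal ((limit_scale a b L)\<^sup>2 * time_norm b (t - s))"
    by (subst ennreal_mult') auto
  finally show ?thesis .
qed

lemma time_kernel_0: "time_kernel b 0 0 y = 0"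
proof -
  have "time_kernel b 0 0 y = (\<integral>\<^sup>+s. 0 \<partial>(lborel :: real measure))"
    unfolding time_kernel_def
    by (rule nn_integral_cong_AE, use AE_lborel_singleton[of 0] in eventually_elim) (auto simp: indicator_def)
  then show ?thesis by simp
qed

lemma limit_kernel_norm:
  assumes "0 \<le> t"
  shows "sq_integral lborel (limit_kernel a b L t) = ennreal ((limit_scale a b L)\<^sup>2 * time_norm b t)"
  using limit_kernel_increment_norm[of 0 t] assms by (simp add: limit_kernel_def[of _ _ _ 0] time_kernel_0)

lemma limit_kernel_tail:
  assumes "0 \<le> t"
  shows "sq_integral lborel (\<lambda>y. limit_kernel a b L t y * indicator {..- L} y) \<le> ennreal ((limit_scale a b L)\<^sup>2 * time_tail b L t)"
proof -
  have "sq_integral lborel (\<lambda>y. limit_kernel a b L t y * indicator {..- L} y)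
    \<le> (\<integral>\<^sup>+y. ennreal ((limit_scale a b L)\<^sup>2) * ((time_kernel b 0 t y)\<^sup>2 * indicator {..- L} y) \<partial>lborel)"
  proof (rule nn_integral_mono)
    fix y
    have "ennreal ((enn2real (time_kernel b 0 t y))\<^sup>2) \<le> (time_kernel b 0 t y)\<^sup>2"
      by (cases "time_kernel b 0 t y") (auto simp: ennreal_power)
    then show "ennreal ((limit_kernel a b L t y * indicator {..- L} y)\<^sup>2) \<le> ennreal ((limit_scale a b L)\<^sup>2) * ((time_kernel b 0 t y)\<^sup>2 * indicator {..- L} y)"
      by (auto simp: limit_kernel_def indicator_def power_mult_distrib ennreal_mult' intro!: mult_left_mono)
  qed
  also have "\<dots> = ennreal ((limit_scale a b L)\<^sup>2) * (\<integral>\<^sup>+y. (time_kernel b 0 t y)\<^sup>2 * indicator {..- L} y \<partial>lborel)"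
    by (rule nn_integral_cmult) measurable
  also have "\<dots> \<le> ennreal ((limit_scale a b L)\<^sup>2) * ennreal (time_tail b L t)"
    unfolding time_tail_def by (intro mult_left_mono time_kernel_tail[OF b(2) L assms]) simp
  also have "\<dots> = ennreal ((limit_scale a b L)\<^sup>2 * time_tail b L t)" by (subst ennreal_mult') auto
  finally show ?thesis .
qed

text \<open>Removing y <= -L separates the support from that of \<open>tail_fun\<close>; the lost
  mass is controlled by \<open>time_tail\<close>.\<close>

definition cut_kernel :: "real \<Rightarrow> real \<Rightarrow> real" where
  "cut_kernel t y = limit_kernel a b L t y * indicator {- L<..} y"

lemma cut_kernel_measurable[measurable]: "cut_kernel t \<in> borel_measurable borel"
proof -
  have "(\<lambda>y. limit_kernel a b L t y * indicator {- L<..} y) \<in> borel_measurable borel" by measurable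
  then show ?thesis unfolding cut_kernel_def[abs_def] .
qed

lemma cut_kernel_norm:
  assumes t: "0 \<le> t"
  obtains n where "sq_integral lborel (cut_kernel t) = ennreal n" "0 \<le> n"
    "n \<le> (limit_scale a b L)\<^sup>2 * time_norm b t"
    "(limit_scale a b L)\<^sup>2 * time_norm b t - (limit_scale a b L)\<^sup>2 * time_tail b L t \<le> n"
proof -
  let ?\<kappa> = "(limit_scale a b L)\<^sup>2"
  have "sq_integral lborel (limit_kernel a b L t) = (\<integral>\<^sup>+y. ennreal ((cut_kernel t y)\<^sup>2) + ennreal ((limit_kernel a b L t y * indicator {..- L} y)\<^sup>2) \<partial>lborel)"
    by (intro nn_integral_cong) (auto simp: cut_kernel_def indicator_def)
  also have "\<dots> = sq_integral lborel (cut_kernel t) + sq_integral lborel (\<lambda>y. limit_kernel a b L t y * indicator {..- L} y)"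
    by (rule nn_integral_add) measurable
  finally have sum: "ennreal (?\<kappa> * time_norm b t) = sq_integral lborel (cut_kernel t) + sq_integral lborel (\<lambda>y. limit_kernel a b L t y * indicator {..- L} y)"
    unfolding limit_kernel_norm[OF t] .
  have fin: "sq_integral lborel (cut_kernel t) < \<infinity>"
    using sum by (metis ennreal_add_eq_top ennreal_neq_top infinity_ennreal_def top.not_eq_extremum)
  define n where "n = enn2real (sq_integral lborel (cut_kernel t))"
  have n: "sq_integral lborel (cut_kernel t) = ennreal n" "0 \<le> n" unfolding n_def using fin by auto
  have "ennreal n \<le> ennreal (?\<kappa> * time_norm b t)" unfolding sum n(1) by simp
  then have le: "n \<le> ?\<kappa> * time_norm b t" using time_norm_nonneg[OF t] by (subst (asm) ennreal_le_iff) auto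
  have "ennreal (?\<kappa> * time_norm b t) \<le> ennreal n + ennreal (?\<kappa> * time_tail b L t)"
    unfolding sum n(1) by (intro add_left_mono limit_kernel_tail t)
  also have "\<dots> = ennreal (n + ?\<kappa> * time_tail b L t)" using n(2) time_tail_nonneg by (subst ennreal_plus) auto
  finally have "?\<kappa> * time_norm b t \<le> n + ?\<kappa> * time_tail b L t"
    using n(2) time_tail_nonneg by (subst (asm) ennreal_le_iff) auto
  then show thesis using that[OF n le] by simp
qed

lemma tail_cut_product:
  "tail_fun a L x * cut_kernel t y = rosenblatt_const a b * ((- x) powr a * enn2real (time_kernel b 0 t y)) * (indicator {..- L} x * indicator {- L<..} y)"
  unfolding tail_fun_def cut_kernel_def limit_kernel_def limit_scale_def using tail_mass_pos by simp

text \<open>Expanding the square: the cross term is controlled from below by \<open>pair_kernel_lower\<close>, and the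
  normalising constant bounds the norm of the full kernel, so no estimate of the kernel off
  the tail is needed.\<close>

lemma kernel_minus_product_norm:
  assumes t: "0 \<le> t" and n: "sq_integral lborel (cut_kernel t) = ennreal n" "0 \<le> n"
  defines "\<rho> \<equiv> ((L + t) / L) powr a"
  shows "sq_integral lborel (\<lambda>z. rosenblatt_const a b * enn2real (pair_kernel a b 0 t z) - tail_fun a L (fst z) * cut_kernel t (snd z))
     \<le> ennreal (t powr (2 * (a + b + 2)) + n - 2 * \<rho> * n)" (is ?le)
    and "0 \<le> t powr (2 * (a + b + 2)) + n - 2 * \<rho> * n" (is ?nn)
proof -
  define A where "A = rosenblatt_const a b"
  have A: "A > 0" unfolding A_def by (rule rosenblatt_const_sq(3)[OF ab])
  have \<rho>: "\<rho> \<ge> 0" by (simp add: \<rho>_def)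
  note [measurable] = pair_kernel_measurable
  let ?q = "\<lambda>z. A * enn2real (pair_kernel a b 0 t z)" and ?v = "\<lambda>z::real \<times> real. tail_fun a L (fst z) * cut_kernel t (snd z)"
  have vn: "sq_integral lborel ?v = ennreal n"
  proof -
    have "sq_integral lborel ?v = (\<integral>\<^sup>+z. ennreal ((tail_fun a L (fst z))\<^sup>2) * ennreal ((cut_kernel t (snd z))\<^sup>2) \<partial>lborel)"
      by (simp add: power_mult_distrib ennreal_mult')
    also have "\<dots> = 1 * ennreal n"
      by (subst nn_integral_product, measurable) (simp add: tail_fun_norm n)
    finally show ?thesis by simp
  qed
  have qn: "sq_integral lborel ?q \<le> ennreal (t powr (2 * (a + b + 2)))"
  proof -
    have "sq_integral lborel ?q = ennreal (A\<^sup>2) * sq_integral lborel (\<lambda>z. enn2real (pair_kernel a b 0 t z))"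
      by (rule nn_integral_square_cmult) measurable
    also have "\<dots> \<le> ennreal (A\<^sup>2) * (\<integral>\<^sup>+z. (pair_kernel a b 0 t z)\<^sup>2 \<partial>lborel)"
      by (intro mult_left_mono nn_integral_enn2real_square_le) simp
    also have "\<dots> \<le> ennreal (t powr (2 * (a + b + 2)))" unfolding A_def using const_pair_kernel_norm[OF ab t] by simp
    finally show ?thesis .
  qed
  \<comment> \<open>The expanded square is arranged with the cross term on the left, so that every
    term is nonnegative and can be integrated in \<open>ennreal\<close>.\<close>
  have pt: "AE z in lborel. ennreal ((?q z - ?v z)\<^sup>2) + ennreal (2 * \<rho>) * ennreal ((?v z)\<^sup>2) \<le> ennreal ((?q z)\<^sup>2) + ennreal ((?v z)\<^sup>2)"
    using pair_kernel_finite_AE[OF ab t]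
  proof eventually_elim
    case (elim z)
    obtain x y where z: "z = (x, y)" by (cases z)
    \<comment> \<open>Off the product of the two supports the rank-one kernel is 0 and the bound is
      trivial; on it the bound is the uniform lower estimate of the first power factor.\<close>
    have lower: "\<rho> * ?v z \<le> ?q z \<and> 0 \<le> ?v z"
    proof (cases "x \<le> - L \<and> - L < y")
      case True
      have "ennreal (\<rho> * (- x) powr a) * time_kernel b 0 t y \<le> pair_kernel a b 0 t z"
        unfolding \<rho>_def z using True a L t by (intro pair_kernel_lower) auto
      then have "enn2real (ennreal (\<rho> * (- x) powr a) * time_kernel b 0 t y) \<le> enn2real (pair_kernel a b 0 t z)"
        using elim by (intro enn2real_mono) (auto simp: top.not_eq_extremum)
      then have "\<rho> * ((- x) powr a * enn2real (time_kernel b 0 t y)) \<le> enn2real (pair_kernel a b 0 t z)"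
        using \<rho> by (simp add: enn2real_mult mult.assoc)
      then have "A * (\<rho> * ((- x) powr a * enn2real (time_kernel b 0 t y))) \<le> ?q z" using A by simp
      moreover have "?v z = A * ((- x) powr a * enn2real (time_kernel b 0 t y))"
        using True unfolding z A_def by (simp add: tail_cut_product)
      moreover have "\<rho> * (A * ((- x) powr a * enn2real (time_kernel b 0 t y))) = A * (\<rho> * ((- x) powr a * enn2real (time_kernel b 0 t y)))"
        by simp
      ultimately show ?thesis using A by simp
    next
      case False
      then have v0: "?v z = 0" unfolding z by (auto simp: tail_cut_product)
      show ?thesis unfolding v0 using A by simp
    qed
    then have "\<rho> * ?v z * ?v z \<le> ?q z * ?v z" by (intro mult_right_mono) auto
    moreover have "(p - v)\<^sup>2 + 2 * \<rho> * v\<^sup>2 \<le> p\<^sup>2 + v\<^sup>2" if "\<rho> * v * v \<le> p * v" for p v :: real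
      using that by (simp add: power2_eq_square algebra_simps)
    ultimately have "(?q z - ?v z)\<^sup>2 + 2 * \<rho> * (?v z)\<^sup>2 \<le> (?q z)\<^sup>2 + (?v z)\<^sup>2" by blast
    then have "ennreal ((?q z - ?v z)\<^sup>2 + 2 * \<rho> * (?v z)\<^sup>2) \<le> ennreal ((?q z)\<^sup>2 + (?v z)\<^sup>2)" by (rule ennreal_leI)
    then show ?case using \<rho> by (simp add: ennreal_plus ennreal_mult')
  qed
  have "sq_integral lborel (\<lambda>z. ?q z - ?v z) + ennreal (2 * \<rho>) * ennreal n
     = (\<integral>\<^sup>+z. ennreal ((?q z - ?v z)\<^sup>2) + ennreal (2 * \<rho>) * ennreal ((?v z)\<^sup>2) \<partial>lborel)"
    unfolding vn[symmetric] by (subst nn_integral_add, measurable, subst nn_integral_cmult, measurable)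
  also have "\<dots> \<le> (\<integral>\<^sup>+z. ennreal ((?q z)\<^sup>2) + ennreal ((?v z)\<^sup>2) \<partial>lborel)"
    by (rule nn_integral_mono_AE[OF pt])
  also have "\<dots> = sq_integral lborel ?q + ennreal n"
    unfolding vn[symmetric] by (rule nn_integral_add) measurable
  also have "\<dots> \<le> ennreal (t powr (2 * (a + b + 2))) + ennreal n" using qn by (rule add_right_mono)
  also have "\<dots> = ennreal (t powr (2 * (a + b + 2)) + n)" using n(2) by (subst ennreal_plus) auto
  finally have le: "sq_integral lborel (\<lambda>z. ?q z - ?v z) + ennreal (2 * \<rho>) * ennreal n \<le> ennreal (t powr (2 * (a + b + 2)) + n)" .
  have fin: "sq_integral lborel (\<lambda>z. ?q z - ?v z) \<noteq> \<infinity>"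
  proof
    assume "sq_integral lborel (\<lambda>z. ?q z - ?v z) = \<infinity>"
    then show False using le by (simp add: top_unique)
  qed
  define I where "I = enn2real (sq_integral lborel (\<lambda>z. ?q z - ?v z))"
  have I: "sq_integral lborel (\<lambda>z. ?q z - ?v z) = ennreal I" "I \<ge> 0"
    unfolding I_def using fin by (auto simp: top.not_eq_extremum)
  have "ennreal (I + 2 * \<rho> * n) \<le> ennreal (t powr (2 * (a + b + 2)) + n)"
    using le n(2) I(2) \<rho> unfolding I(1) by (simp add: ennreal_plus ennreal_mult')
  then have "I + 2 * \<rho> * n \<le> t powr (2 * (a + b + 2)) + n"
    using n(2) by (subst (asm) ennreal_le_iff) (auto intro!: add_nonneg_nonneg)
  then show ?le ?nn using I(2) unfolding I(1)[unfolded A_def] by (auto intro: ennreal_leI)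
qed

end

locale rosenblatt_setting = white_noise M B + rosenblatt_parameters a b L
  for M :: "'a measure" and B and a b L :: real +
  fixes Z :: "real \<Rightarrow> 'a \<Rightarrow> real"
  assumes Z: "generalized_rosenblatt_process M B a b Z"
begin

text \<open>Z(t) minus the product X of the step integrals is the double integral of the
  symmetrisation of u = A K - P, where K is the unsymmetrised kernel and P the step kernel.
  Symmetrising does not increase the norm, so the estimate for K suffices.\<close>

lemma product_approximation:
  assumes t: "0 \<le> t" and n: "sq_integral lborel (cut_kernel t) = ennreal n" "0 \<le> n"
    and \<delta>: "0 < \<delta>"
    and ws: "step_sets {..- L} ws" "\<And>x. 0 \<le> step_fun ws x" "\<And>x. step_fun ws x \<le> tail_fun a L x"
      "sq_integral lborel (\<lambda>x. tail_fun a L x - step_fun ws x) \<le> ennreal \<delta>"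
    and ys: "step_sets {- L<..} ys" "sq_integral lborel (\<lambda>y. cut_kernel t y - step_fun ys y) \<le> ennreal \<delta>"
  defines "\<rho> \<equiv> ((L + t) / L) powr a"
  shows "sq_integral M (\<lambda>\<omega>. Z t \<omega> - step_integral B ws \<omega> * step_integral B ys \<omega>)
     \<le> ennreal (8 * (2 * (t powr (2 * (a + b + 2)) + n - 2 * \<rho> * n) + 4 * \<delta> * n + 4 * \<delta>))"
proof -
  define A where "A = rosenblatt_const a b"
  have A: "A > 0" unfolding A_def by (rule rosenblatt_const_sq(3)[OF ab])
  note [measurable] = pair_kernel_measurable step_fun_measurable[OF ws(1)] step_fun_measurable[OF ys(1)]
  obtain Y where Y: "has_double_wiener_ito_integral M B (rosenblatt_kernel a b t) Y" "AE \<omega> in M. Z t \<omega> = A / 2 * Y \<omega>"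
    using Z t unfolding generalized_rosenblatt_process_def A_def by metis
  have [measurable]: "Y \<in> borel_measurable M" "rosenblatt_kernel a b t \<in> borel_measurable lborel"
    using Y(1) unfolding has_double_wiener_ito_integral_def by auto
  define P where "P z = step_fun ws (fst z) * step_fun ys (snd z)" for z
  define X where "X \<omega> = step_integral B ws \<omega> * step_integral B ys \<omega>" for \<omega>
  have "off_diagonal_rects (step_product ws ys)"
    using ws(1) ys(1) by (rule step_product_facts(3)) auto
  from has_rect_integral_rects[OF this] have PX: "has_rect_integral M B P X"
    unfolding P_def X_def step_product_facts(1)[abs_def] step_product_facts(2)[abs_def]
    by (simp add: step_product_facts(1,2)[abs_def] fun_eq_iff[symmetric] step_product_facts(1,2))
  \<comment> \<open>P and its transpose have the same integral X; the factor -1/A below makes A/2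
    times their sum subtract X exactly once.\<close>
  have PX2: "has_rect_integral M B (\<lambda>z. P (snd z, fst z) + 1 * P z) (\<lambda>\<omega>. X \<omega> + 1 * X \<omega>)"
    by (intro has_rect_integral_add_scaled has_rect_integral_swap PX)
  have d: "has_rect_integral M B (\<lambda>z. rosenblatt_kernel a b t z + (- 1 / A) * (P (snd z, fst z) + 1 * P z)) (\<lambda>\<omega>. Y \<omega> + (- 1 / A) * (X \<omega> + 1 * X \<omega>))"
    by (intro has_rect_integral_add_scaled PX2 has_double_imp_has_rect_integral Y)
  have [measurable]: "X \<in> borel_measurable M" "P \<in> borel_measurable lborel" using PX by (auto simp: has_rect_integral_def)
  define u where "u z = A * enn2real (pair_kernel a b 0 t z) - P z" for z
  have u[measurable]: "u \<in> borel_measurable lborel" unfolding u_def[abs_def] by measurable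
  have u'[measurable]: "(\<lambda>z. u (snd z, fst z)) \<in> borel_measurable lborel"
    by (rule measurable_compose[OF measurable_swap u])
  have K: "sq_integral lborel (\<lambda>z. A / 2 * (rosenblatt_kernel a b t z + (- 1 / A) * (P (snd z, fst z) + 1 * P z))) \<le> sq_integral lborel u"
  proof -
    have "sq_integral lborel (\<lambda>z. A / 2 * (rosenblatt_kernel a b t z + (- 1 / A) * (P (snd z, fst z) + 1 * P z)))
       = sq_integral lborel (\<lambda>z. 1/2 * u z + 1/2 * u (snd z, fst z))"
    proof (rule nn_integral_cong_AE, use pair_kernel_finite_AE[OF ab t] pair_kernel_finite_AE[OF region_swap[OF ab] t] in eventually_elim)
      case (elim z)
      have "A / 2 * (rosenblatt_kernel a b t z + (- 1 / A) * (P (snd z, fst z) + 1 * P z)) = 1/2 * u z + 1/2 * u (snd z, fst z)"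
        unfolding rosenblatt_kernel_eq[OF elim] u_def pair_kernel_swap using A by (simp add: field_simps)
      then show ?case by (simp only:)
    qed
    also have "\<dots> \<le> 2 * sq_integral lborel (\<lambda>z. 1/2 * u z) + 2 * sq_integral lborel (\<lambda>z. 1/2 * u (snd z, fst z))"
      by (rule nn_integral_square_add) measurable
    also have "\<dots> = 2 * (ennreal ((1/2)\<^sup>2) * sq_integral lborel u) + 2 * (ennreal ((1/2)\<^sup>2) * sq_integral lborel (\<lambda>z. u (snd z, fst z)))"
      by (subst nn_integral_square_cmult, measurable, subst nn_integral_square_cmult, measurable)
    also have "sq_integral lborel (\<lambda>z. u (snd z, fst z)) = sq_integral lborel u"
      by (rule nn_integral_lborel_swap[of "\<lambda>z. ennreal ((u z)\<^sup>2)"]) measurable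
    also have "2 * (ennreal ((1/2)\<^sup>2) * c) + 2 * (ennreal ((1/2)\<^sup>2) * c) = c" for c
    proof -
      have "2 * (ennreal ((1/2)\<^sup>2) * c) + 2 * (ennreal ((1/2)\<^sup>2) * c) = (ennreal 4 * ennreal ((1/2)\<^sup>2)) * c"
        by (simp add: mult.assoc distrib_right[symmetric])
      also have "ennreal 4 * ennreal ((1/2)\<^sup>2) = 1" by (subst ennreal_mult'[symmetric]) (auto simp: power2_eq_square)
      finally show ?thesis by simp
    qed
    finally show ?thesis .
  qed
  have wn: "sq_integral lborel (step_fun ws) \<le> 1"
    unfolding tail_fun_norm[symmetric] using ws(2,3) by (intro nn_integral_mono ennreal_leI power_mono)
  have v1: "sq_integral (lborel :: (real \<times> real) measure) (\<lambda>z. (tail_fun a L (fst z) - step_fun ws (fst z)) * cut_kernel t (snd z)) \<le> ennreal \<delta> * ennreal n"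
  proof -
    have "sq_integral (lborel :: (real \<times> real) measure) (\<lambda>z. (tail_fun a L (fst z) - step_fun ws (fst z)) * cut_kernel t (snd z))
       = (\<integral>\<^sup>+z. ennreal ((tail_fun a L (fst z) - step_fun ws (fst z))\<^sup>2) * ennreal ((cut_kernel t (snd z))\<^sup>2) \<partial>lborel)"
      by (simp add: power_mult_distrib ennreal_mult')
    also have "\<dots> = sq_integral lborel (\<lambda>x. tail_fun a L x - step_fun ws x) * ennreal n"
      unfolding n(1)[symmetric] by (rule nn_integral_product) measurable
    also have "\<dots> \<le> ennreal \<delta> * ennreal n" using ws(4) by (rule mult_right_mono) simp
    finally show ?thesis .
  qed
  have v2: "sq_integral (lborel :: (real \<times> real) measure) (\<lambda>z. step_fun ws (fst z) * (cut_kernel t (snd z) - step_fun ys (snd z))) \<le> ennreal \<delta>"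
  proof -
    have "sq_integral (lborel :: (real \<times> real) measure) (\<lambda>z. step_fun ws (fst z) * (cut_kernel t (snd z) - step_fun ys (snd z)))
       = (\<integral>\<^sup>+z. ennreal ((step_fun ws (fst z))\<^sup>2) * ennreal ((cut_kernel t (snd z) - step_fun ys (snd z))\<^sup>2) \<partial>lborel)"
      by (simp add: power_mult_distrib ennreal_mult')
    also have "\<dots> = sq_integral lborel (step_fun ws) * sq_integral lborel (\<lambda>y. cut_kernel t y - step_fun ys y)"
      by (rule nn_integral_product) measurable
    also have "\<dots> \<le> 1 * ennreal \<delta>" using wn ys(2) by (intro mult_mono) auto
    finally show ?thesis by simp
  qed
  let ?E = "t powr (2 * (a + b + 2)) + n - 2 * \<rho> * n"
  \<comment> \<open>Three errors: the kernel against tail times cut kernel, the tail against its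
    step function, and the cut kernel against its step function.\<close>
  have un: "sq_integral lborel u \<le> 2 * ennreal ?E + 2 * (2 * (ennreal \<delta> * ennreal n) + 2 * ennreal \<delta>)"
  proof -
    have "sq_integral lborel u = sq_integral lborel (\<lambda>z. (A * enn2real (pair_kernel a b 0 t z) - tail_fun a L (fst z) * cut_kernel t (snd z))
        + ((tail_fun a L (fst z) - step_fun ws (fst z)) * cut_kernel t (snd z) + step_fun ws (fst z) * (cut_kernel t (snd z) - step_fun ys (snd z))))"
      unfolding u_def P_def by (intro nn_integral_cong arg_cong[where f=ennreal] arg_cong[where f="\<lambda>x. x\<^sup>2"]) (simp add: algebra_simps)
    also have "\<dots> \<le> 2 * sq_integral lborel (\<lambda>z. A * enn2real (pair_kernel a b 0 t z) - tail_fun a L (fst z) * cut_kernel t (snd z))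
       + 2 * sq_integral lborel (\<lambda>z. (tail_fun a L (fst z) - step_fun ws (fst z)) * cut_kernel t (snd z) + step_fun ws (fst z) * (cut_kernel t (snd z) - step_fun ys (snd z)))"
      by (rule nn_integral_square_add) measurable
    also have "\<dots> \<le> 2 * ennreal ?E + 2 * (2 * (ennreal \<delta> * ennreal n) + 2 * ennreal \<delta>)"
    proof (intro add_mono mult_left_mono)
      show "sq_integral lborel (\<lambda>z. A * enn2real (pair_kernel a b 0 t z) - tail_fun a L (fst z) * cut_kernel t (snd z)) \<le> ennreal ?E"
        unfolding A_def \<rho>_def by (rule kernel_minus_product_norm(1)[OF t n])
      have "sq_integral (lborel :: (real \<times> real) measure) (\<lambda>z. (tail_fun a L (fst z) - step_fun ws (fst z)) * cut_kernel t (snd z) + step_fun ws (fst z) * (cut_kernel t (snd z) - step_fun ys (snd z)))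
        \<le> 2 * sq_integral (lborel :: (real \<times> real) measure) (\<lambda>z. (tail_fun a L (fst z) - step_fun ws (fst z)) * cut_kernel t (snd z))
          + 2 * sq_integral (lborel :: (real \<times> real) measure) (\<lambda>z. step_fun ws (fst z) * (cut_kernel t (snd z) - step_fun ys (snd z)))"
        by (rule nn_integral_square_add) measurable
      also have "\<dots> \<le> 2 * (ennreal \<delta> * ennreal n) + 2 * ennreal \<delta>"
        using v1 v2 by (intro add_mono mult_left_mono) auto
      finally show "sq_integral (lborel :: (real \<times> real) measure) (\<lambda>z. (tail_fun a L (fst z) - step_fun ws (fst z)) * cut_kernel t (snd z) + step_fun ws (fst z) * (cut_kernel t (snd z) - step_fun ys (snd z))) \<le> \<dots>" .
    qed auto
    finally show ?thesis .
  qed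
  have "sq_integral M (\<lambda>\<omega>. Z t \<omega> - X \<omega>) = sq_integral M (\<lambda>\<omega>. A / 2 * (Y \<omega> + (- 1 / A) * (X \<omega> + 1 * X \<omega>)))"
  proof (rule nn_integral_cong_AE, use Y(2) in eventually_elim)
    case (elim \<omega>)
    have "Z t \<omega> - X \<omega> = A / 2 * (Y \<omega> + (- 1 / A) * (X \<omega> + 1 * X \<omega>))" unfolding elim using A by (simp add: field_simps)
    then show ?case by (simp only:)
  qed
  also have "\<dots> = ennreal ((A / 2)\<^sup>2) * sq_integral M (\<lambda>\<omega>. Y \<omega> + (- 1 / A) * (X \<omega> + 1 * X \<omega>))"
    by (rule nn_integral_square_cmult) measurable
  also have "\<dots> \<le> ennreal ((A / 2)\<^sup>2) * (8 * sq_integral lborel (\<lambda>z. rosenblatt_kernel a b t z + (- 1 / A) * (P (snd z, fst z) + 1 * P z)))"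
    by (intro mult_left_mono has_rect_integral_bound[OF d]) simp
  also have "\<dots> = 8 * sq_integral lborel (\<lambda>z. A / 2 * (rosenblatt_kernel a b t z + (- 1 / A) * (P (snd z, fst z) + 1 * P z)))"
  proof -
    have [measurable]: "(\<lambda>z. rosenblatt_kernel a b t z + (- 1 / A) * (P (snd z, fst z) + 1 * P z)) \<in> borel_measurable lborel"
      using d by (simp add: has_rect_integral_def)
    show ?thesis by (subst nn_integral_square_cmult, measurable) (simp only: mult.left_commute)
  qed
  also have "\<dots> \<le> 8 * (2 * ennreal ?E + 2 * (2 * (ennreal \<delta> * ennreal n) + 2 * ennreal \<delta>))"
    using order_trans[OF K un] by (intro mult_left_mono) auto
  finally have fin: "sq_integral M (\<lambda>\<omega>. Z t \<omega> - X \<omega>) \<le> 8 * (2 * ennreal ?E + 2 * (2 * (ennreal \<delta> * ennreal n) + 2 * ennreal \<delta>))" .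
  have "0 \<le> ?E" unfolding \<rho>_def by (rule kernel_minus_product_norm(2)[OF t n])
  moreover have "8 * (2 * ennreal e + 2 * (2 * (ennreal \<delta> * ennreal n) + 2 * ennreal \<delta>)) = ennreal (8 * (2 * e + 4 * \<delta> * n + 4 * \<delta>))"
    if "0 \<le> e" for e
    using that n(2) \<delta> by (simp add: ennreal_plus ennreal_mult' distrib_left mult.assoc[symmetric] add.assoc)
  ultimately have "8 * (2 * ennreal ?E + 2 * (2 * (ennreal \<delta> * ennreal n) + 2 * ennreal \<delta>)) = ennreal (8 * (2 * ?E + 4 * \<delta> * n + 4 * \<delta>))"
    by blast
  with fin show ?thesis unfolding X_def by (simp only:)
qed

text \<open>One list \<open>ws\<close> serves all times, because the tail function is independent of
  t. This is why a single W appears in the limit.\<close>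

lemma rosenblatt_approximation:
  assumes ts: "\<And>i. 0 \<le> ts i" and \<delta>: "0 < \<delta>"
  obtains ws ys where "step_sets {..- L} ws" "\<And>i::nat. step_sets {- L<..} (ys i)"
    "sq_integral lborel (\<lambda>x. tail_fun a L x - step_fun ws x) \<le> ennreal \<delta>"
    "\<And>i. sq_integral lborel (\<lambda>y. limit_kernel a b L (ts i) y - step_fun (ys i) y)
        \<le> ennreal (2 * ((limit_scale a b L)\<^sup>2 * time_tail b L (ts i)) + 2 * \<delta>)"
    "\<And>i. sq_integral M (\<lambda>\<omega>. Z (ts i) \<omega> - step_integral B ws \<omega> * step_integral B (ys i) \<omega>)
        \<le> ennreal (approx_bound a b L \<delta> (ts i))"
proof -
  let ?\<kappa> = "(limit_scale a b L)\<^sup>2"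
  obtain ws where ws: "step_sets {..- L} ws" "\<And>x. 0 \<le> step_fun ws x" "\<And>x. step_fun ws x \<le> tail_fun a L x"
      "sq_integral lborel (\<lambda>x. tail_fun a L x - step_fun ws x) \<le> ennreal \<delta>"
    by (rule step_approx[of "tail_fun a L" "{..- L}" \<delta>])
      (use tail_fun_nonneg \<delta> in \<open>auto simp: tail_fun_norm\<close>, auto simp: tail_fun_def)
  have "\<exists>ys. step_sets {- L<..} ys \<and>
      sq_integral lborel (\<lambda>y. limit_kernel a b L t y - step_fun ys y) \<le> ennreal (2 * (?\<kappa> * time_tail b L t) + 2 * \<delta>) \<and>
      sq_integral M (\<lambda>\<omega>. Z t \<omega> - step_integral B ws \<omega> * step_integral B ys \<omega>) \<le> ennreal (approx_bound a b L \<delta> t)"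
    if t: "0 \<le> t" for t
  proof -
    obtain n where n: "sq_integral lborel (cut_kernel t) = ennreal n" "0 \<le> n"
      "n \<le> ?\<kappa> * time_norm b t" "?\<kappa> * time_norm b t - ?\<kappa> * time_tail b L t \<le> n"
      using cut_kernel_norm[OF t] by blast
    have c0: "0 \<le> cut_kernel t y" "y \<notin> {- L<..} \<Longrightarrow> cut_kernel t y = 0" for y
      using limit_kernel_nonneg by (auto simp: cut_kernel_def)
    obtain ys where ys: "step_sets {- L<..} ys" "sq_integral lborel (\<lambda>y. cut_kernel t y - step_fun ys y) \<le> ennreal \<delta>"
      by (rule step_approx[of "cut_kernel t" "{- L<..}" \<delta>]) (use c0 n \<delta> in auto)
    note [measurable] = step_fun_measurable[OF ys(1)]
    have "sq_integral lborel (\<lambda>y. limit_kernel a b L t y - step_fun ys y)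
        = sq_integral lborel (\<lambda>y. limit_kernel a b L t y * indicator {..- L} y + (cut_kernel t y - step_fun ys y))"
      by (intro nn_integral_cong) (auto simp: cut_kernel_def indicator_def)
    also have "\<dots> \<le> 2 * sq_integral lborel (\<lambda>y. limit_kernel a b L t y * indicator {..- L} y) + 2 * sq_integral lborel (\<lambda>y. cut_kernel t y - step_fun ys y)"
      by (rule nn_integral_square_add) measurable
    also have "\<dots> \<le> 2 * ennreal (?\<kappa> * time_tail b L t) + 2 * ennreal \<delta>"
      by (intro add_mono mult_left_mono limit_kernel_tail t ys) auto
    also have "\<dots> = ennreal (2 * (?\<kappa> * time_tail b L t) + 2 * \<delta>)"
      using time_tail_nonneg \<delta> by (simp add: ennreal_plus ennreal_mult')
    finally have 1: "sq_integral lborel (\<lambda>y. limit_kernel a b L t y - step_fun ys y) \<le> \<dots>" .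
    define \<rho> where "\<rho> = ((L + t) / L) powr a"
    have "sq_integral M (\<lambda>\<omega>. Z t \<omega> - step_integral B ws \<omega> * step_integral B ys \<omega>)
       \<le> ennreal (8 * (2 * (t powr (2 * (a + b + 2)) + n - 2 * \<rho> * n) + 4 * \<delta> * n + 4 * \<delta>))"
      unfolding \<rho>_def by (rule product_approximation[OF t n(1,2) \<delta> ws ys])
    also have "\<dots> \<le> ennreal (approx_bound a b L \<delta> t)"
    proof (rule ennreal_leI)
      have "\<rho> * (?\<kappa> * time_norm b t - ?\<kappa> * time_tail b L t) \<le> \<rho> * n"
        using n(4) by (intro mult_left_mono) (auto simp: \<rho>_def)
      moreover have "\<delta> * n \<le> \<delta> * (?\<kappa> * time_norm b t)" using n(3) \<delta> by (intro mult_left_mono) auto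
      ultimately show "8 * (2 * (t powr (2 * (a + b + 2)) + n - 2 * \<rho> * n) + 4 * \<delta> * n + 4 * \<delta>) \<le> approx_bound a b L \<delta> t"
        unfolding approx_bound_def Let_def \<rho>_def[symmetric] using n(3) by (simp add: mult.assoc)
    qed
    finally show ?thesis using ys(1) 1 by blast
  qed
  then have "\<forall>i. \<exists>ys. step_sets {- L<..} ys \<and>
      sq_integral lborel (\<lambda>y. limit_kernel a b L (ts i) y - step_fun ys y) \<le> ennreal (2 * (?\<kappa> * time_tail b L (ts i)) + 2 * \<delta>) \<and>
      sq_integral M (\<lambda>\<omega>. Z (ts i) \<omega> - step_integral B ws \<omega> * step_integral B ys \<omega>) \<le> ennreal (approx_bound a b L \<delta> (ts i))"
    using ts by blast
  then obtain ys where "\<forall>i. step_sets {- L<..} (ys i) \<and>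
      sq_integral lborel (\<lambda>y. limit_kernel a b L (ts i) y - step_fun (ys i) y) \<le> ennreal (2 * (?\<kappa> * time_tail b L (ts i)) + 2 * \<delta>) \<and>
      sq_integral M (\<lambda>\<omega>. Z (ts i) \<omega> - step_integral B ws \<omega> * step_integral B (ys i) \<omega>) \<le> ennreal (approx_bound a b L \<delta> (ts i))"
    using choice[of "\<lambda>i ys. step_sets {- L<..} ys \<and>
      sq_integral lborel (\<lambda>y. limit_kernel a b L (ts i) y - step_fun ys y) \<le> ennreal (2 * (?\<kappa> * time_tail b L (ts i)) + 2 * \<delta>) \<and>
      sq_integral M (\<lambda>\<omega>. Z (ts i) \<omega> - step_integral B ws \<omega> * step_integral B ys \<omega>) \<le> ennreal (approx_bound a b L \<delta> (ts i))"] by blast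
  then show thesis using that[OF ws(1) _ ws(4), of ys] by blast
qed

end


section \<open>Characteristic functions of the approximating and limiting vectors\<close>


text \<open>The triangle inequality in L^2, from Cauchy-Schwarz, in a form that delivers finiteness
  of the sum together with the bound.\<close>

lemma minkowski_square_integral:
  fixes f g :: "'z \<Rightarrow> real"
  assumes [measurable]: "f \<in> borel_measurable M" "g \<in> borel_measurable M"
    and f: "sq_integral M f = ennreal F" "0 \<le> F"
    and g: "sq_integral M g \<le> ennreal G" "0 \<le> G"
  obtains H where "sq_integral M (\<lambda>x. f x + g x) = ennreal H" "0 \<le> H" "sqrt H \<le> sqrt F + sqrt G"
proof -
  let ?C = "\<integral>\<^sup>+x. ennreal \<bar>f x\<bar> * ennreal \<bar>g x\<bar> \<partial>M"
  have "?C\<^sup>2 \<le> (\<integral>\<^sup>+x. (ennreal \<bar>f x\<bar>)\<^sup>2 \<partial>M) * (\<integral>\<^sup>+x. (ennreal \<bar>g x\<bar>)\<^sup>2 \<partial>M)"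
    by (rule Cauchy_Schwarz_nn_integral) measurable
  also have "\<dots> \<le> ennreal F * ennreal G"
    using f g by (intro mult_mono) (auto simp: ennreal_power)
  also have "\<dots> = (ennreal (sqrt F * sqrt G))\<^sup>2"
    using f(2) g(2) by (simp add: ennreal_power power_mult_distrib ennreal_mult)
  finally have C2: "?C\<^sup>2 \<le> (ennreal (sqrt F * sqrt G))\<^sup>2" .
  have C: "?C \<le> ennreal (sqrt F * sqrt G)"
  proof (cases ?C)
    case (real c)
    have "ennreal (c\<^sup>2) \<le> ennreal ((sqrt F * sqrt G)\<^sup>2)"
      using C2 real f(2) g(2) by (simp add: ennreal_power)
    then have c2: "c\<^sup>2 \<le> (sqrt F * sqrt G)\<^sup>2" by (subst (asm) ennreal_le_iff) auto
    have "0 \<le> sqrt F * sqrt G" using f(2) g(2) by simp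
    with c2 have "c \<le> sqrt F * sqrt G" by (rule power2_le_imp_le)
    then show ?thesis unfolding real by (rule ennreal_leI)
  next
    case top
    then show ?thesis using C2 f(2) g(2) by (simp add: ennreal_power top_unique)
  qed
  have "sq_integral M (\<lambda>x. f x + g x) \<le> (\<integral>\<^sup>+x. ennreal ((f x)\<^sup>2) + (2 * (ennreal \<bar>f x\<bar> * ennreal \<bar>g x\<bar>) + ennreal ((g x)\<^sup>2)) \<partial>M)"
  proof (rule nn_integral_mono)
    fix x
    have "(f x + g x)\<^sup>2 \<le> (f x)\<^sup>2 + (2 * (\<bar>f x\<bar> * \<bar>g x\<bar>) + (g x)\<^sup>2)"
      using abs_ge_self[of "f x * g x"] by (simp add: power2_sum abs_mult)
    then have "ennreal ((f x + g x)\<^sup>2) \<le> ennreal ((f x)\<^sup>2 + (2 * (\<bar>f x\<bar> * \<bar>g x\<bar>) + (g x)\<^sup>2))" by (rule ennreal_leI)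
    also have "\<dots> = ennreal ((f x)\<^sup>2) + (2 * (ennreal \<bar>f x\<bar> * ennreal \<bar>g x\<bar>) + ennreal ((g x)\<^sup>2))"
      by (simp add: ennreal_plus ennreal_mult')
    finally show "ennreal ((f x + g x)\<^sup>2) \<le> \<dots>" .
  qed
  also have "\<dots> = ennreal F + (2 * ?C + sq_integral M g)"
    unfolding f(1)[symmetric] by (subst nn_integral_add, measurable, subst nn_integral_add, measurable, subst nn_integral_cmult, measurable)
  also have "\<dots> \<le> ennreal F + (2 * ennreal (sqrt F * sqrt G) + ennreal G)"
    using C g by (intro add_mono mult_left_mono) auto
  also have "\<dots> = ennreal (F + (2 * (sqrt F * sqrt G) + G))"
    using f(2) g(2) by (simp add: ennreal_plus ennreal_mult')
  also have "F + (2 * (sqrt F * sqrt G) + G) = (sqrt F + sqrt G)\<^sup>2"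
    using f(2) g(2) by (simp add: power2_sum)
  finally have le: "sq_integral M (\<lambda>x. f x + g x) \<le> ennreal ((sqrt F + sqrt G)\<^sup>2)" .
  define H where "H = enn2real (sq_integral M (\<lambda>x. f x + g x))"
  have H: "sq_integral M (\<lambda>x. f x + g x) = ennreal H" "0 \<le> H"
    unfolding H_def using le by (auto simp: ennreal_enn2real_if top_unique)
  have "H \<le> (sqrt F + sqrt G)\<^sup>2" using le unfolding H(1) by (subst (asm) ennreal_le_iff) auto
  then have "sqrt H \<le> sqrt F + sqrt G" using f(2) g(2) by (intro real_le_lsqrt) auto
  with H that show thesis by blast
qed

text \<open>The triangle inequality used in both directions bounds the difference of the norms by
  the square root of d; squaring recovers the second moments.\<close>

lemma step_norm_tendsto:
  fixes f :: "'p \<Rightarrow> real \<Rightarrow> real"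
  assumes ev: "\<forall>\<^sub>F p in F. f p \<in> borel_measurable borel \<and> step_sets UNIV (xs p)
      \<and> sq_integral lborel (f p) = ennreal (v p) \<and> 0 \<le> v p
      \<and> integrable lborel (\<lambda>x. (step_fun (xs p) x)\<^sup>2)
      \<and> sq_integral lborel (\<lambda>x. f p x - step_fun (xs p) x) \<le> ennreal (d p) \<and> 0 \<le> d p"
    and v: "(v \<longlongrightarrow> V) F" and d: "(d \<longlongrightarrow> 0) F"
  shows "((\<lambda>p. \<integral>x. (step_fun (xs p) x)\<^sup>2 \<partial>lborel) \<longlongrightarrow> V) F"
proof -
  let ?s = "\<lambda>p. \<integral>x. (step_fun (xs p) x)\<^sup>2 \<partial>lborel"
  have "((\<lambda>p. sqrt (?s p) - sqrt (v p)) \<longlongrightarrow> 0) F"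
  proof (rule Lim_null_comparison)
    show "\<forall>\<^sub>F p in F. norm (sqrt (?s p) - sqrt (v p)) \<le> sqrt (d p)"
      using ev
    proof eventually_elim
      case (elim p)
      then have [measurable]: "f p \<in> borel_measurable borel" "step_fun (xs p) \<in> borel_measurable borel"
        by (auto intro: step_fun_measurable)
      have s: "sq_integral lborel (step_fun (xs p)) = ennreal (?s p)" "0 \<le> ?s p"
        using elim by (auto intro: nn_integral_eq_integral)
      have d1: "sq_integral lborel (\<lambda>x. step_fun (xs p) x - f p x) \<le> ennreal (d p)"
        using elim by (simp add: power2_commute)
      obtain H where H: "sq_integral lborel (\<lambda>x. f p x + (step_fun (xs p) x - f p x)) = ennreal H" "0 \<le> H" "sqrt H \<le> sqrt (v p) + sqrt (d p)"
        by (rule minkowski_square_integral[of "f p" lborel "\<lambda>x. step_fun (xs p) x - f p x" "v p" "d p"]) (use elim d1 in auto)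
      obtain H' where H': "sq_integral lborel (\<lambda>x. step_fun (xs p) x + (f p x - step_fun (xs p) x)) = ennreal H'" "0 \<le> H'" "sqrt H' \<le> sqrt (?s p) + sqrt (d p)"
        by (rule minkowski_square_integral[of "step_fun (xs p)" lborel "\<lambda>x. f p x - step_fun (xs p) x" "?s p" "d p"]) (use elim s in auto)
      have "H = ?s p" using H(1,2) s by simp
      moreover have "H' = v p" using H'(1,2) elim by simp
      ultimately show ?case using H(3) H'(3) by simp
    qed
    show "((\<lambda>p. sqrt (d p)) \<longlongrightarrow> 0) F" using tendsto_real_sqrt[OF d] by simp
  qed
  from tendsto_add[OF this tendsto_real_sqrt[OF v]] have "((\<lambda>p. sqrt (?s p)) \<longlongrightarrow> sqrt V) F" by simp
  then have "((\<lambda>p. (sqrt (?s p))\<^sup>2) \<longlongrightarrow> (sqrt V)\<^sup>2) F" by (rule tendsto_power)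
  moreover have "(sqrt (?s p))\<^sup>2 = ?s p" for p by simp
  \<comment> \<open>Squaring the root of V gives back V only if V >= 0, which the bounds on v yield
    unless the filter is trivial.\<close>
  moreover have "F \<noteq> bot \<Longrightarrow> 0 \<le> V"
    using ev by (intro tendsto_lowerbound[OF v]) (auto elim: eventually_mono)
  ultimately show ?thesis by (cases "F = bot") auto
qed

lemma combination_step:
  fixes c :: "nat \<Rightarrow> real"
  shows "\<exists>zs. (\<forall>x. step_fun zs x = (\<Sum>i<k. c i * step_fun (xs i) x)) \<and>
     (\<forall>B (\<omega>::'a). step_integral B zs \<omega> = (\<Sum>i<k. c i * step_integral B (xs i) \<omega>)) \<and>
     ((\<forall>i<k. step_sets UNIV (xs i)) \<longrightarrow> step_sets UNIV zs)"
proof (induction k)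
  case 0
  show ?case by (intro exI[of _ "[]"]) simp
next
  case (Suc k)
  then obtain zs where zs: "\<forall>x. step_fun zs x = (\<Sum>i<k. c i * step_fun (xs i) x)"
     "\<forall>B (\<omega>::'a). step_integral B zs \<omega> = (\<Sum>i<k. c i * step_integral B (xs i) \<omega>)"
     "(\<forall>i<k. step_sets UNIV (xs i)) \<longrightarrow> step_sets UNIV zs" by blast
  show ?case
    by (intro exI[of _ "zs @ map (\<lambda>(a, S). (c k * a, S)) (xs k)"]) (use zs in \<open>auto simp: step_scale\<close>)
qed

text \<open>Covariances are expressed through norms of single functions and of differences: these
  are the quantities with known limits, and the fractional Brownian covariance has the same
  shape.\<close>

lemma quadratic_form_polarization:
  fixes f :: "nat \<Rightarrow> 'z \<Rightarrow> real"
  assumes f: "\<And>i. i < k \<Longrightarrow> integrable M (\<lambda>x. (f i x)\<^sup>2)"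
    and d: "\<And>i j. i < k \<Longrightarrow> j < k \<Longrightarrow> integrable M (\<lambda>x. (f i x - f j x)\<^sup>2)"
  shows "(\<integral>x. (\<Sum>i<k. c i * f i x)\<^sup>2 \<partial>M) =
    (\<Sum>i<k. \<Sum>j<k. c i * c j * (((\<integral>x. (f i x)\<^sup>2 \<partial>M) + (\<integral>x. (f j x)\<^sup>2 \<partial>M) - (\<integral>x. (f i x - f j x)\<^sup>2 \<partial>M)) / 2))"
proof -
  define h where "h i j x = c i * c j * (((f i x)\<^sup>2 + (f j x)\<^sup>2 - (f i x - f j x)\<^sup>2) / 2)" for i j x
  have "(\<Sum>i<k. c i * f i x)\<^sup>2 = (\<Sum>i<k. \<Sum>j<k. h i j x)" for x
    unfolding power2_eq_square sum_product h_def by (intro sum.cong refl) (simp add: algebra_simps)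
  moreover have h: "integrable M (h i j)"
    "(\<integral>x. h i j x \<partial>M) = c i * c j * (((\<integral>x. (f i x)\<^sup>2 \<partial>M) + (\<integral>x. (f j x)\<^sup>2 \<partial>M) - (\<integral>x. (f i x - f j x)\<^sup>2 \<partial>M)) / 2)"
    if "i < k" "j < k" for i j
    unfolding h_def[abs_def] using f d that
    by (auto intro!: integrable_mult_right integrable_divide Bochner_Integration.integrable_add Bochner_Integration.integrable_diff)
  ultimately have "(\<integral>x. (\<Sum>i<k. c i * f i x)\<^sup>2 \<partial>M) = (\<integral>x. (\<Sum>i<k. \<Sum>j<k. h i j x) \<partial>M)" by simp
  also have "\<dots> = (\<Sum>i<k. \<Sum>j<k. \<integral>x. h i j x \<partial>M)"
  proof -
    have "(\<integral>x. (\<Sum>i<k. \<Sum>j<k. h i j x) \<partial>M) = (\<Sum>i<k. \<integral>x. (\<Sum>j<k. h i j x) \<partial>M)"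
      by (rule Bochner_Integration.integral_sum, rule Bochner_Integration.integrable_sum) (auto intro: h(1))
    also have "\<dots> = (\<Sum>i<k. \<Sum>j<k. \<integral>x. h i j x \<partial>M)"
      by (intro sum.cong refl, rule Bochner_Integration.integral_sum) (auto intro: h(1))
    finally show ?thesis .
  qed
  also have "\<dots> = (\<Sum>i<k. \<Sum>j<k. c i * c j * (((\<integral>x. (f i x)\<^sup>2 \<partial>M) + (\<integral>x. (f j x)\<^sup>2 \<partial>M) - (\<integral>x. (f i x - f j x)\<^sup>2 \<partial>M)) / 2))"
    using h(2) by (intro sum.cong refl) auto
  finally show ?thesis .
qed

lemma iexp_components:
  assumes "prob_space M" "X \<in> borel_measurable M"
  shows "(\<integral>\<omega>. cos (X \<omega>) \<partial>M) = Re (CLINT \<omega>|M. iexp (X \<omega>))" "(\<integral>\<omega>. sin (X \<omega>) \<partial>M) = Im (CLINT \<omega>|M. iexp (X \<omega>))"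
proof -
  have i: "integrable M (\<lambda>\<omega>. iexp (X \<omega>))"
    using assms prob_space.integrable_iexp[of M X] by simp
  show "(\<integral>\<omega>. cos (X \<omega>) \<partial>M) = Re (CLINT \<omega>|M. iexp (X \<omega>))" "(\<integral>\<omega>. sin (X \<omega>) \<partial>M) = Im (CLINT \<omega>|M. iexp (X \<omega>))"
    using integral_Re[OF i] integral_Im[OF i] by (simp_all add: Re_exp Im_exp)
qed

section \<open>The limiting Gaussian vector\<close>

definition fbm_covariance :: "real \<Rightarrow> real \<Rightarrow> real \<Rightarrow> real" where
  "fbm_covariance H s t = (\<bar>s\<bar> powr (2 * H) + \<bar>t\<bar> powr (2 * H) - \<bar>s - t\<bar> powr (2 * H)) / 2"

locale limit_process = prob_space N for N :: "'b measure" +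
  fixes H :: real and W :: "'b \<Rightarrow> real" and BH :: "real \<Rightarrow> 'b \<Rightarrow> real"
  assumes W: "distributed N lborel W (\<lambda>x. ennreal (std_normal_density x))"
    and BH: "fractional_brownian_motion N H BH"
    and indep: "independent_of_process N W BH"
begin

sublocale BH: gaussian_family N "{0..}" BH "fbm_covariance H"
proof
  show "centered_gaussian_family N {0..} BH (fbm_covariance H)"
    using BH unfolding fractional_brownian_motion_def fbm_covariance_def[abs_def] .
qed

lemma W_measurable[measurable]: "W \<in> borel_measurable N"
  using W by (simp add: distributed_def)

lemma W_char: "(CLINT \<omega>|N. iexp (c * W \<omega>)) = exp (- (c\<^sup>2) / 2)"
proof -
  have "distr N lborel W = std_normal_distribution" using W by (rule distributed_distr_eq_density)
  then have "(CLINT \<omega>|N. iexp (c * W \<omega>)) = (CLINT x|std_normal_distribution. iexp (c * x))"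
    by (subst integral_distr[of W N lborel, symmetric]) auto
  also have "\<dots> = exp (- (c\<^sup>2) / 2)"
    using fun_cong[OF char_std_normal_distribution, of c] by (simp add: char_def)
  finally show ?thesis .
qed

lemma W_moment: "integrable N (\<lambda>\<omega>. (W \<omega>)\<^sup>2)" "(\<integral>\<omega>. (W \<omega>)\<^sup>2 \<partial>N) = 1"
proof -
  have h: "has_bochner_integral lborel (\<lambda>x. std_normal_density x * x\<^sup>2) 1"
    using std_normal_moment_even[of 1] by (simp add: fact_numeral)
  show "integrable N (\<lambda>\<omega>. (W \<omega>)\<^sup>2)"
    using h distributed_integrable[OF W, of "\<lambda>x. x\<^sup>2"] by (simp add: has_bochner_integral_iff)
  show "(\<integral>\<omega>. (W \<omega>)\<^sup>2 \<partial>N) = 1"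
    using h distributed_integral[OF W, of "\<lambda>x. x\<^sup>2"] by (simp add: has_bochner_integral_iff)
qed

text \<open>A finite combination factors through the path map, hence is measurable for the
  \<sigma>-algebra generated by the process and inherits its independence from W.\<close>

lemma W_indep_combination:
  fixes k :: nat
  assumes ts: "\<And>i. i < k \<Longrightarrow> 0 \<le> ts i"
  shows "indep_var borel W borel (\<lambda>\<omega>. \<Sum>i<k. c i * BH (ts i) \<omega>)"
proof -
  let ?G = "\<lambda>\<omega>. \<Sum>i<k. c i * BH (ts i) \<omega>"
  let ?P = "\<lambda>\<omega>. \<lambda>t\<in>{0..}. BH t \<omega>"
  let ?V = "vimage_algebra (space N) ?P (Pi\<^sub>M {0..} (\<lambda>_. borel))"
  have GN: "?G \<in> borel_measurable N" using ts BH.member by auto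
  have "?P \<in> space N \<rightarrow> space (Pi\<^sub>M {0..} (\<lambda>_. borel))" by (auto simp: space_PiM)
  then have PV: "?P \<in> ?V \<rightarrow>\<^sub>M Pi\<^sub>M {0..} (\<lambda>_. borel)" by (rule measurable_vimage_algebra1)
  have "(\<lambda>f. \<Sum>i<k. c i * f (ts i)) \<in> borel_measurable (Pi\<^sub>M {0..} (\<lambda>_. borel :: real measure))"
    using ts by (intro borel_measurable_sum borel_measurable_times measurable_component_singleton borel_measurable_const) auto
  from measurable_compose[OF PV this] have "(\<lambda>\<omega>. \<Sum>i<k. c i * ?P \<omega> (ts i)) \<in> borel_measurable ?V" .
  moreover have "(\<lambda>\<omega>. \<Sum>i<k. c i * ?P \<omega> (ts i)) = ?G"
    by (intro ext sum.cong refl) (use ts in auto)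
  ultimately have GV: "?G \<in> borel_measurable ?V" by (simp only:)
  have sG: "sigma_sets (space N) {?G -` A \<inter> space N | A. A \<in> sets borel} \<subseteq> sets ?V"
  proof -
    have "sigma_sets (space ?V) {?G -` A \<inter> space N | A. A \<in> sets borel} \<subseteq> sets ?V"
      using measurable_sets[OF GV] by (intro sets.sigma_sets_subset) auto
    then show ?thesis by simp
  qed
  have sW: "sigma_sets (space N) {W -` A \<inter> space N | A. A \<in> sets borel} \<subseteq> sets (vimage_algebra (space N) W borel)"
    unfolding sets_vimage_algebra by simp
  have "indep_set (sigma_sets (space N) {W -` A \<inter> space N | A. A \<in> sets borel}) (sigma_sets (space N) {?G -` A \<inter> space N | A. A \<in> sets borel})"
    unfolding indep_set_def
    by (rule indep_sets_mono_sets[OF indep[unfolded independent_of_process_def indep_set_def]])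
      (use sG sW in \<open>auto split: bool.split\<close>)
  then show ?thesis unfolding indep_var_eq using GN by simp
qed

lemma joint_char:
  fixes k :: nat
  assumes ts: "\<And>i. i < k \<Longrightarrow> 0 \<le> ts i"
  shows "(CLINT \<omega>|N. iexp ((\<Sum>i<k. c i * BH (ts i) \<omega>) + w * W \<omega>)) =
    complex_of_real (exp (- (w\<^sup>2 + (\<Sum>i<k. \<Sum>j<k. c i * c j * fbm_covariance H (ts i) (ts j))) / 2))"
proof -
  let ?G = "\<lambda>\<omega>. \<Sum>i<k. c i * BH (ts i) \<omega>" and ?v = "(\<Sum>i<k. \<Sum>j<k. c i * c j * fbm_covariance H (ts i) (ts j))"
  have ts': "ts i \<in> {0..}" if "i \<in> {..<k}" for i using ts that by auto
  have g: "gaussian_variable N ?G" by (rule BH.combination(1)[where s=ts and J="{..<k}" and a=c]) (use ts' in auto)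
  have g2: "(\<integral>\<omega>. ?G \<omega> \<partial>N) = 0" by (rule BH.combination(2)[where s=ts and J="{..<k}" and a=c]) (use ts' in auto)
  have g3: "(\<integral>\<omega>. (?G \<omega>)\<^sup>2 \<partial>N) = (\<Sum>i<k. \<Sum>j<k. c i * c j * fbm_covariance H (ts i) (ts j))"
    by (rule BH.combination(4)[where s=ts and J="{..<k}" and a=c]) (use ts' in auto)
  have GN[measurable]: "?G \<in> borel_measurable N" using g by (simp add: gaussian_variable_def)
  have "indep_var borel ((\<lambda>x. w * x) \<circ> W) borel ((\<lambda>x. x) \<circ> ?G)"
    by (rule indep_var_compose[OF W_indep_combination[OF ts]]) auto
  then have ind: "indep_var borel (\<lambda>\<omega>. w * W \<omega>) borel ?G" by (simp add: comp_def)
  have "char (distr N borel (\<lambda>\<omega>. w * W \<omega> + ?G \<omega>)) 1 = char (distr N borel (\<lambda>\<omega>. w * W \<omega>)) 1 * char (distr N borel ?G) 1"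
    by (rule char_distr_add[OF ind])
  moreover have "char (distr N borel X) 1 = (CLINT \<omega>|N. iexp (X \<omega>))" if "X \<in> borel_measurable N" for X
    unfolding char_def using that by (subst integral_distr) auto
  ultimately have "(CLINT \<omega>|N. iexp (w * W \<omega> + ?G \<omega>)) = (CLINT \<omega>|N. iexp (w * W \<omega>)) * (CLINT \<omega>|N. iexp (?G \<omega>))"
    by simp
  also have "\<dots> = complex_of_real (exp (- (w\<^sup>2) / 2)) * complex_of_real (exp (- ?v / 2))"
    unfolding W_char gaussian_variable_moments(4)[OF prob_space_axioms g g2] g3 ..
  also have "\<dots> = complex_of_real (exp (- (w\<^sup>2 + ?v) / 2))"
  proof -
    have "- (w\<^sup>2) / 2 + - u / 2 = - (w\<^sup>2 + u) / 2" for u :: real by simp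
    then show ?thesis by (simp only: of_real_mult[symmetric] exp_add[symmetric])
  qed
  finally show ?thesis by (simp add: add.commute)
qed

end


section \<open>Limits of the constants\<close>


lemma powr_reciprocal: "(x::real) > 0 \<Longrightarrow> (1 / x) powr y = x powr (- y)"
  by (simp only: powr_minus_divide) (simp add: powr_divide)

lemma filterlim_region:
  fixes \<gamma> :: real
  defines "F \<equiv> at (-1/2, \<gamma>) within rosenblatt_region"
  shows "\<forall>\<^sub>F p in F. p \<in> rosenblatt_region" "(fst \<longlongrightarrow> -1/2) F" "(snd \<longlongrightarrow> \<gamma>) F"
proof -
  show "\<forall>\<^sub>F p in F. p \<in> rosenblatt_region" unfolding F_def by (simp add: eventually_at_filter)
  have "((\<lambda>p. p) \<longlongrightarrow> (-1/2, \<gamma>)) F" unfolding F_def by (rule tendsto_ident_at)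
  from tendsto_fst[OF this] tendsto_snd[OF this]
  show "(fst \<longlongrightarrow> -1/2) F" "(snd \<longlongrightarrow> \<gamma>) F" by simp_all
qed

text \<open>The cut-off \<open>L = 1/\<epsilon>\<close> with \<open>\<epsilon> = -2a - 1\<close> tends to infinity while \<open>L\<^sup>\<epsilon> \<rightarrow> 1\<close>, so that the
  tail keeps its full mass in the limit.\<close>

definition gap :: "real \<times> real \<Rightarrow> real" where
  "gap p = - 2 * fst p - 1"

definition scale_sq :: "real \<times> real \<Rightarrow> real" where
  "scale_sq p = (limit_scale (fst p) (snd p) (1 / gap p))\<^sup>2"

context
  fixes \<gamma> :: real and F :: "(real \<times> real) filter"
  assumes \<gamma>: "-1 < \<gamma>" "\<gamma> < -1/2"
  defines "F \<equiv> at (-1/2, \<gamma>) within rosenblatt_region"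
begin

lemma gap_tendsto: "(gap \<longlongrightarrow> 0) F" "\<forall>\<^sub>F p in F. gap p > 0" "filterlim gap (at_right 0) F"
proof -
  have "((\<lambda>p. - 2 * fst p - 1) \<longlongrightarrow> - 2 * (-1/2) - 1) F"
    unfolding F_def by (intro tendsto_intros filterlim_region)
  then show 1: "(gap \<longlongrightarrow> 0) F" unfolding gap_def[abs_def] by simp
  show 2: "\<forall>\<^sub>F p in F. gap p > 0"
    using filterlim_region(1)[of \<gamma>] unfolding F_def by eventually_elim (auto simp: gap_def rosenblatt_region_def)
  show "filterlim gap (at_right 0) F"
    using 1 2 by (auto simp: filterlim_at elim: eventually_mono)
qed

lemma energy_const_tendsto: "((\<lambda>p. energy_const (snd p)) \<longlongrightarrow> energy_const \<gamma>) F"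
proof -
  have g: "\<gamma> + 1 \<notin> \<int>\<^sub>\<le>\<^sub>0" "- 2 * \<gamma> - 1 \<notin> \<int>\<^sub>\<le>\<^sub>0" "- \<gamma> \<notin> \<int>\<^sub>\<le>\<^sub>0" using \<gamma> by (auto dest: nonpos_Ints_nonpos)
  have e: "energy_const b = Gamma (b + 1) * Gamma (- 2 * b - 1) / Gamma (- b)" for b
    by (simp add: energy_const_def Beta_def)
  have "Gamma (- \<gamma>) > 0" using \<gamma> by (intro Gamma_real_pos) auto
  then have "Gamma (- \<gamma>) \<noteq> 0" by simp
  then show ?thesis
    unfolding e F_def using g by (intro tendsto_intros filterlim_region) auto
qed

text \<open>The simple pole of Gamma at 0: x Gamma(x) = Gamma(x + 1) tends to 1, while the two
  remaining Gamma values tend to Gamma(1/2) and cancel.\<close>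

lemma gap_energy_const_tendsto: "((\<lambda>p. gap p * energy_const (fst p)) \<longlongrightarrow> 1) F"
proof -
  have "((\<lambda>p. Gamma (fst p + 1) * Gamma (gap p + 1) / Gamma (- fst p)) \<longlongrightarrow> Gamma (-1/2 + 1) * Gamma (0 + 1) / Gamma (- (-1/2))) F"
    using gap_tendsto(1) unfolding F_def
    by (intro tendsto_intros filterlim_region) (auto dest: nonpos_Ints_nonpos simp: Gamma_one_half_real)
  moreover have "Gamma (-1/2 + 1) * Gamma (0 + 1) / Gamma (- (-1/2)) = (1::real)"
    by (simp add: Gamma_one_half_real)
  moreover have "\<forall>\<^sub>F p in F. Gamma (fst p + 1) * Gamma (gap p + 1) / Gamma (- fst p) = gap p * energy_const (fst p)"
    using gap_tendsto(2)
  proof eventually_elim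
    case (elim p)
    then have "Gamma (gap p + 1) = gap p * Gamma (gap p)" by (intro Gamma_plus1) (auto dest: nonpos_Ints_nonpos)
    then show ?case by (simp add: energy_const_def Beta_def gap_def)
  qed
  ultimately show ?thesis using Lim_transform_eventually by fastforce
qed

text \<open>Numerator and denominator are multiplied by the gap. The regular Beta product then
  vanishes, the singular one tends to \<open>energy_const \<gamma>\<close>, and the tail mass
  contributes gap^gap -> 1. The limit is the factor that normalises the time kernel to unit variance
  at t = 1.\<close>

lemma scale_sq_tendsto: "(scale_sq \<longlongrightarrow> (\<gamma> + 3/2) * (2 * \<gamma> + 2) / energy_const \<gamma>) F"
proof -
  define D where "D p = Beta (fst p + 1) (- fst p - snd p - 1) * Beta (snd p + 1) (- fst p - snd p - 1)" for p :: "real \<times> real"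
  have D: "(D \<longlongrightarrow> Beta (-1/2 + 1) (- (-1/2) - \<gamma> - 1) * Beta (\<gamma> + 1) (- (-1/2) - \<gamma> - 1)) F" (is "(_ \<longlongrightarrow> ?d) _")
    unfolding D_def[abs_def] Beta_def F_def
    by (intro tendsto_intros filterlim_region)
      (use \<gamma> Gamma_real_pos[of "- \<gamma>"] Gamma_real_pos[of "1/2"] in \<open>auto dest!: nonpos_Ints_nonpos simp: Gamma_eq_zero_iff\<close>)
  have ee: "((\<lambda>p. gap p powr gap p) \<longlongrightarrow> 1) F"
  proof -
    have "((\<lambda>x::real. x powr x) \<longlongrightarrow> 1) (at_right 0)" by real_asymp
    from filterlim_compose[OF this gap_tendsto(3)] show ?thesis .
  qed
  have "((\<lambda>p. (fst p + snd p + 2) * (2 * (fst p + snd p) + 3) * gap p powr gap p / (gap p * D p + (gap p * energy_const (fst p)) * energy_const (snd p)))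
     \<longlongrightarrow> (-1/2 + \<gamma> + 2) * (2 * (-1/2 + \<gamma>) + 3) * 1 / (0 * ?d + 1 * energy_const \<gamma>)) F"
    using energy_const_pos[OF \<gamma>]
    by (intro tendsto_intros D ee energy_const_tendsto gap_energy_const_tendsto gap_tendsto(1) filterlim_region[folded F_def]) 
       (use filterlim_region[of \<gamma>] in \<open>simp_all add: F_def\<close>)
  moreover have "(-1/2 + \<gamma> + 2) * (2 * (-1/2 + \<gamma>) + 3) * 1 / (0 * ?d + 1 * energy_const \<gamma>) = (\<gamma> + 3/2) * (2 * \<gamma> + 2) / energy_const \<gamma>"
    by (simp add: algebra_simps)
  moreover have "\<forall>\<^sub>F p in F. (fst p + snd p + 2) * (2 * (fst p + snd p) + 3) * gap p powr gap p / (gap p * D p + (gap p * energy_const (fst p)) * energy_const (snd p)) = scale_sq p"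
    using gap_tendsto(2) filterlim_region(1)[of \<gamma>, folded F_def]
  proof eventually_elim
    case (elim p)
    obtain a b where p: "p = (a, b)" by (cases p)
    have ab: "(a, b) \<in> rosenblatt_region" using elim p by simp
    have g: "gap (a, b) = - 2 * a - 1" by (simp add: gap_def)
    have "tail_mass a (1 / gap (a, b)) = gap (a, b) powr gap (a, b) / gap (a, b)"
    proof -
      have "(1 / gap (a, b)) powr (2 * a + 1) = gap (a, b) powr (- (2 * a + 1))"
        using elim(1) unfolding p by (rule powr_reciprocal)
      also have "- (2 * a + 1) = gap (a, b)" by (simp add: g)
      finally show ?thesis unfolding tail_mass_def by (simp add: g)
    qed
    then have "scale_sq (a, b) = (rosenblatt_const a b)\<^sup>2 * (gap (a, b) powr gap (a, b) / gap (a, b))"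
      using elim(1) unfolding scale_sq_def limit_scale_def p by (simp add: power_mult_distrib)
    also have "\<dots> = (a + b + 2) * (2 * (a + b) + 3) / (D (a, b) + energy_const a * energy_const b) * (gap (a, b) powr gap (a, b) / gap (a, b))"
      unfolding rosenblatt_const_sq(1)[OF ab] by (simp add: D_def)
    also have "\<dots> = (a + b + 2) * (2 * (a + b) + 3) * gap (a, b) powr gap (a, b) / (gap (a, b) * (D (a, b) + energy_const a * energy_const b))"
      by (simp add: mult.commute)
    finally show ?case unfolding p by (simp add: distrib_left mult.assoc)
  qed
  ultimately show ?thesis using Lim_transform_eventually by fastforce
qed

lemma powr_tendsto_nonneg_base:
  fixes t :: real
  assumes "t \<ge> 0" "(f \<longlongrightarrow> x) G"
  shows "((\<lambda>p. t powr f p) \<longlongrightarrow> t powr x) G"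
  using assms by (cases "t = 0") (auto intro!: tendsto_intros)

lemma time_norm_tendsto:
  assumes t: "t \<ge> 0"
  shows "((\<lambda>p. scale_sq p * time_norm (snd p) t) \<longlongrightarrow> t powr (2 * \<gamma> + 3)) F"
proof -
  have "((\<lambda>p. scale_sq p * time_norm (snd p) t) \<longlongrightarrow>
     ((\<gamma> + 3/2) * (2 * \<gamma> + 2) / energy_const \<gamma>) * (energy_const \<gamma> * t powr (2 * \<gamma> + 3) / ((\<gamma> + 1) * (2 * \<gamma> + 3)))) F"
    unfolding time_norm_def
    by (intro tendsto_intros scale_sq_tendsto energy_const_tendsto powr_tendsto_nonneg_base t filterlim_region(3)[of \<gamma>, folded F_def])
       (use \<gamma> in auto)
  moreover have "((\<gamma> + 3/2) * (2 * \<gamma> + 2) / energy_const \<gamma>) * (energy_const \<gamma> * t powr (2 * \<gamma> + 3) / ((\<gamma> + 1) * (2 * \<gamma> + 3))) = t powr (2 * \<gamma> + 3)"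
  proof -
    have e: "(\<gamma> + 3/2) * (2 * \<gamma> + 2) = (\<gamma> + 1) * (2 * \<gamma> + 3)" by algebra
    have cancel: "x / c * (c * y / x) = y" if "x \<noteq> 0" "c \<noteq> 0" for x c y :: real using that by simp
    have "(\<gamma> + 1) * (2 * \<gamma> + 3) \<noteq> 0" "energy_const \<gamma> \<noteq> 0" using \<gamma> energy_const_pos[OF \<gamma>] by auto
    then show ?thesis unfolding e by (rule cancel)
  qed
  ultimately show ?thesis by simp
qed

text \<open>With L = 1/gap the tail is of order gap^(-2b - 1), whose exponent tends to -2 \<gamma> -
  1 > 0. For the first parameter the corresponding exponent is the gap itself, and the power tends
  to 1 instead.\<close>

lemma time_tail_tendsto: "((\<lambda>p. scale_sq p * time_tail (snd p) (1 / gap p) t) \<longlongrightarrow> 0) F"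
proof -
  have z: "((\<lambda>p. gap p powr (- 2 * snd p - 1)) \<longlongrightarrow> 0 powr (- 2 * \<gamma> - 1)) F"
  proof (rule tendsto_powr')
    show "(gap \<longlongrightarrow> 0) F" by (rule gap_tendsto(1))
    show "((\<lambda>p. - 2 * snd p - 1) \<longlongrightarrow> - 2 * \<gamma> - 1) F" by (intro tendsto_intros filterlim_region(3)[of \<gamma>, folded F_def])
    show "(0::real) \<noteq> 0 \<or> 0 < - 2 * \<gamma> - 1 \<and> (\<forall>\<^sub>F p in F. 0 \<le> gap p)"
      using \<gamma> gap_tendsto(2) by (auto elim: eventually_mono)
  qed
  have "((\<lambda>p. scale_sq p * (t\<^sup>2 * gap p powr (- 2 * snd p - 1) / (- 2 * snd p - 1))) \<longlongrightarrow>
      ((\<gamma> + 3/2) * (2 * \<gamma> + 2) / energy_const \<gamma>) * (t\<^sup>2 * 0 powr (- 2 * \<gamma> - 1) / (- 2 * \<gamma> - 1))) F"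
    by (intro tendsto_intros scale_sq_tendsto z filterlim_region(3)[of \<gamma>, folded F_def]) (use \<gamma> in auto)
  moreover have "\<forall>\<^sub>F p in F. scale_sq p * (t\<^sup>2 * gap p powr (- 2 * snd p - 1) / (- 2 * snd p - 1)) = scale_sq p * time_tail (snd p) (1 / gap p) t"
    using gap_tendsto(2)
  proof eventually_elim
    case (elim p)
    have "(1 / gap p) powr (2 * snd p + 1) = gap p powr (- (2 * snd p + 1))"
      using elim by (rule powr_reciprocal)
    also have "- (2 * snd p + 1) = - 2 * snd p - 1" by simp
    finally show ?case by (simp add: time_tail_def)
  qed
  ultimately show ?thesis using Lim_transform_eventually by fastforce
qed

text \<open>With \<delta> = gap the step errors vanish and \<rho> = (1 + t gap)^a tends to 1; what
  remains is x + x - 2x = 0 with x = t^(2 \<gamma> + 3).\<close>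

lemma approx_bound_tendsto:
  assumes t: "t \<ge> 0"
  shows "((\<lambda>p. approx_bound (fst p) (snd p) (1 / gap p) (gap p) t) \<longlongrightarrow> 0) F"
proof -
  note r = filterlim_region(2,3)[of \<gamma>, folded F_def]
  have \<rho>: "((\<lambda>p. (1 + t * gap p) powr fst p) \<longlongrightarrow> (1 + t * 0) powr (-1/2)) F"
    by (intro tendsto_powr tendsto_intros gap_tendsto(1) r) auto
  have "((\<lambda>p. 8 * (2 * (t powr (2 * (fst p + snd p + 2)) + scale_sq p * time_norm (snd p) t
        - 2 * (1 + t * gap p) powr fst p * (scale_sq p * time_norm (snd p) t - scale_sq p * time_tail (snd p) (1 / gap p) t))
       + 4 * gap p * (scale_sq p * time_norm (snd p) t) + 4 * gap p)) \<longlongrightarrow>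
     8 * (2 * (t powr (2 * (-1/2 + \<gamma> + 2)) + t powr (2 * \<gamma> + 3) - 2 * (1 + t * 0) powr (-1/2) * (t powr (2 * \<gamma> + 3) - 0))
       + 4 * 0 * t powr (2 * \<gamma> + 3) + 4 * 0)) F"
    by (intro tendsto_intros \<rho> powr_tendsto_nonneg_base t time_norm_tendsto time_tail_tendsto gap_tendsto(1) r)
  moreover have "8 * (2 * (t powr (2 * (-1/2 + \<gamma> + 2)) + t powr (2 * \<gamma> + 3) - 2 * (1 + t * 0) powr (-1/2) * (t powr (2 * \<gamma> + 3) - 0))
       + 4 * 0 * t powr (2 * \<gamma> + 3) + 4 * 0) = 0"
  proof -
    have e: "2 * (-1/2 + \<gamma> + 2) = 2 * \<gamma> + 3" by simp
    show ?thesis unfolding e by simp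
  qed
  moreover have "\<forall>\<^sub>F p in F. 8 * (2 * (t powr (2 * (fst p + snd p + 2)) + scale_sq p * time_norm (snd p) t
        - 2 * (1 + t * gap p) powr fst p * (scale_sq p * time_norm (snd p) t - scale_sq p * time_tail (snd p) (1 / gap p) t))
       + 4 * gap p * (scale_sq p * time_norm (snd p) t) + 4 * gap p) = approx_bound (fst p) (snd p) (1 / gap p) (gap p) t"
    using gap_tendsto(2)
  proof eventually_elim
    case (elim p)
    then have "(1 / gap p + t) / (1 / gap p) = 1 + t * gap p" by (simp add: field_simps)
    then show ?case unfolding approx_bound_def Let_def scale_sq_def[symmetric] by simp
  qed
  ultimately show ?thesis using Lim_transform_eventually by fastforce
qed

end


section \<open>Covariances of the approximating Gaussian vectors\<close>


lemma (in prob_space) expectation_abs_bound: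
  assumes [measurable]: "X \<in> borel_measurable M" and X: "sq_integral M X \<le> ennreal c" and c: "0 \<le> c"
  shows "(\<integral>\<^sup>+\<omega>. ennreal \<bar>X \<omega>\<bar> \<partial>M) \<le> ennreal (sqrt c)"
proof -
  let ?E = "\<integral>\<^sup>+\<omega>. ennreal \<bar>X \<omega>\<bar> \<partial>M"
  have "(\<integral>\<^sup>+\<omega>. ennreal \<bar>X \<omega>\<bar> * 1 \<partial>M)\<^sup>2 \<le> (\<integral>\<^sup>+\<omega>. (ennreal \<bar>X \<omega>\<bar>)\<^sup>2 \<partial>M) * (\<integral>\<^sup>+\<omega>. 1\<^sup>2 \<partial>M)"
    by (rule Cauchy_Schwarz_nn_integral) measurable
  also have "\<dots> \<le> ennreal c" using X by (simp add: ennreal_power emeasure_space_1)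
  finally have E2: "?E\<^sup>2 \<le> ennreal c" by simp
  show ?thesis
  proof (cases ?E)
    case (real e)
    have "ennreal (e\<^sup>2) \<le> ennreal c" using E2 real by (simp add: ennreal_power)
    then have "e\<^sup>2 \<le> c" using c by (subst (asm) ennreal_le_iff) auto
    then have "e \<le> sqrt c" by (rule real_le_rsqrt)
    then show ?thesis unfolding real by (rule ennreal_leI)
  next
    case top
    then show ?thesis using E2 by (simp add: power2_eq_square top_unique)
  qed
qed

text \<open>All approximating data are fixed beforehand for every parameter p and every time, with
  cut-off 1/gap and accuracy gap, so that the limits below concern explicit functions of p.\<close>

locale rosenblatt_limit = white_noise M B for M :: "'a measure" and B +
  fixes \<gamma> :: real and Z :: "real \<times> real \<Rightarrow> real \<Rightarrow> 'a \<Rightarrow> real" and ts :: "nat \<Rightarrow> real"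
    and ws :: "real \<times> real \<Rightarrow> steps" and ys :: "real \<times> real \<Rightarrow> nat \<Rightarrow> steps"
  assumes \<gamma>: "-1 < \<gamma>" "\<gamma> < -1/2" and ts: "\<And>i. 0 \<le> ts i"
    and ws_sets: "\<And>p. p \<in> rosenblatt_region \<Longrightarrow> step_sets {..- (1 / gap p)} (ws p)"
    and ys_sets: "\<And>p i. p \<in> rosenblatt_region \<Longrightarrow> step_sets {- (1 / gap p)<..} (ys p i)"
    and ws_close: "\<And>p. p \<in> rosenblatt_region \<Longrightarrow>
      sq_integral lborel (\<lambda>x. tail_fun (fst p) (1 / gap p) x - step_fun (ws p) x) \<le> ennreal (gap p)"
    and ys_close: "\<And>p i. p \<in> rosenblatt_region \<Longrightarrow>
      sq_integral lborel (\<lambda>y. limit_kernel (fst p) (snd p) (1 / gap p) (ts i) y - step_fun (ys p i) y)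
        \<le> ennreal (2 * (scale_sq p * time_tail (snd p) (1 / gap p) (ts i)) + 2 * gap p)"
    and Z_close: "\<And>p i. p \<in> rosenblatt_region \<Longrightarrow>
      sq_integral M (\<lambda>\<omega>. Z p (ts i) \<omega> - step_integral B (ws p) \<omega> * step_integral B (ys p i) \<omega>)
        \<le> ennreal (approx_bound (fst p) (snd p) (1 / gap p) (gap p) (ts i))"
begin

definition "F = at (-1/2, \<gamma>) within rosenblatt_region"

lemma region_F: "\<forall>\<^sub>F p in F. p \<in> rosenblatt_region"
  unfolding F_def by (rule filterlim_region(1))

lemma gap_pos: "p \<in> rosenblatt_region \<Longrightarrow> gap p > 0"
  by (auto simp: gap_def rosenblatt_region_def)

lemma parameters: "p \<in> rosenblatt_region \<Longrightarrow> rosenblatt_parameters (fst p) (snd p) (1 / gap p)"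
  using gap_pos by unfold_locales auto

lemma step_sets_UNIV:
  assumes "p \<in> rosenblatt_region"
  shows "step_sets UNIV (ws p)" "step_sets UNIV (ys p i)"
  using step_sets_mono[OF ws_sets[OF assms]] step_sets_mono[OF ys_sets[OF assms]] by auto

definition tail_err :: "nat \<Rightarrow> real \<times> real \<Rightarrow> real" where
  "tail_err i p = 2 * (scale_sq p * time_tail (snd p) (1 / gap p) (ts i)) + 2 * gap p"

lemma tail_err_tendsto: "(tail_err i \<longlongrightarrow> 0) F"
proof -
  have "((\<lambda>p. 2 * (scale_sq p * time_tail (snd p) (1 / gap p) (ts i)) + 2 * gap p) \<longlongrightarrow> 2 * 0 + 2 * 0) F"
    unfolding F_def by (intro tendsto_intros time_tail_tendsto gap_tendsto(1) \<gamma>)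
  then show ?thesis unfolding tail_err_def[abs_def] by simp
qed

lemma tail_err_nonneg: "p \<in> rosenblatt_region \<Longrightarrow> 0 \<le> tail_err i p"
  unfolding tail_err_def scale_sq_def
  using rosenblatt_parameters.time_tail_nonneg[OF parameters, of p "ts i"] gap_pos[of p]
  by (intro add_nonneg_nonneg mult_nonneg_nonneg) auto

lemma ws_norm_tendsto: "((\<lambda>p. \<integral>x. (step_fun (ws p) x)\<^sup>2 \<partial>lborel) \<longlongrightarrow> 1) F"
proof (rule step_norm_tendsto[where f="\<lambda>p. tail_fun (fst p) (1 / gap p)" and v="\<lambda>_. 1" and d=gap])
  show "(gap \<longlongrightarrow> 0) F" unfolding F_def by (rule gap_tendsto(1)[OF \<gamma>])
  show "\<forall>\<^sub>F p in F. tail_fun (fst p) (1 / gap p) \<in> borel_measurable borel \<and> step_sets UNIV (ws p)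
      \<and> sq_integral lborel (tail_fun (fst p) (1 / gap p)) = ennreal 1 \<and> 0 \<le> (1::real)
      \<and> integrable lborel (\<lambda>x. (step_fun (ws p) x)\<^sup>2)
      \<and> sq_integral lborel (\<lambda>x. tail_fun (fst p) (1 / gap p) x - step_fun (ws p) x) \<le> ennreal (gap p) \<and> 0 \<le> gap p"
    using region_F
  proof eventually_elim
    case (elim p)
    interpret rosenblatt_parameters "fst p" "snd p" "1 / gap p" by (rule parameters[OF elim])
    show ?case using tail_fun_norm gap_pos[OF elim] ws_close[OF elim] step_sets_UNIV[OF elim] step_integral_gaussian(4)[OF ws_sets[OF elim]]
      by simp
  qed
qed simp

lemma ys_norm_tendsto: "((\<lambda>p. \<integral>x. (step_fun (ys p i) x)\<^sup>2 \<partial>lborel) \<longlongrightarrow> ts i powr (2 * \<gamma> + 3)) F"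
proof (rule step_norm_tendsto[where f="\<lambda>p. limit_kernel (fst p) (snd p) (1 / gap p) (ts i)" and v="\<lambda>p. scale_sq p * time_norm (snd p) (ts i)" and d="tail_err i"])
  show "(tail_err i \<longlongrightarrow> 0) F" by (rule tail_err_tendsto)
  show "((\<lambda>p. scale_sq p * time_norm (snd p) (ts i)) \<longlongrightarrow> ts i powr (2 * \<gamma> + 3)) F"
    unfolding F_def by (rule time_norm_tendsto[OF \<gamma> ts])
  show "\<forall>\<^sub>F p in F. limit_kernel (fst p) (snd p) (1 / gap p) (ts i) \<in> borel_measurable borel \<and> step_sets UNIV (ys p i)
      \<and> sq_integral lborel (limit_kernel (fst p) (snd p) (1 / gap p) (ts i)) = ennreal (scale_sq p * time_norm (snd p) (ts i))
      \<and> 0 \<le> scale_sq p * time_norm (snd p) (ts i)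
      \<and> integrable lborel (\<lambda>x. (step_fun (ys p i) x)\<^sup>2)
      \<and> sq_integral lborel (\<lambda>x. limit_kernel (fst p) (snd p) (1 / gap p) (ts i) x - step_fun (ys p i) x) \<le> ennreal (tail_err i p) \<and> 0 \<le> tail_err i p"
    using region_F
  proof eventually_elim
    case (elim p)
    interpret rosenblatt_parameters "fst p" "snd p" "1 / gap p" by (rule parameters[OF elim])
    show ?case
      using limit_kernel_norm[OF ts[of i]] time_norm_nonneg[OF ts[of i]] ys_close[OF elim, of i] step_sets_UNIV[OF elim]
        step_integral_gaussian(4)[OF ys_sets[OF elim]] tail_err_nonneg[OF elim]
      unfolding scale_sq_def tail_err_def by simp
  qed
qed

text \<open>Increments of the limit kernel have a norm that depends on the time difference alone,
  the counterpart of stationary increments; the step functions inherit this in the limit.\<close>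

lemma ys_diff_tendsto:
  "((\<lambda>p. \<integral>x. (step_fun (ys p i) x - step_fun (ys p j) x)\<^sup>2 \<partial>lborel) \<longlongrightarrow> \<bar>ts i - ts j\<bar> powr (2 * \<gamma> + 3)) F"
proof -
  have main: "((\<lambda>p. \<integral>x. (step_fun (ys p i) x - step_fun (ys p j) x)\<^sup>2 \<partial>lborel) \<longlongrightarrow> (ts i - ts j) powr (2 * \<gamma> + 3)) F"
    if le: "ts j \<le> ts i" for i j
  proof -
    let ?sc = "\<lambda>(a::real, S::real set). (- 1 * a, S)"
    let ?xs = "\<lambda>p. ys p i @ map ?sc (ys p j)"
    let ?f = "\<lambda>p x. limit_kernel (fst p) (snd p) (1 / gap p) (ts i) x - limit_kernel (fst p) (snd p) (1 / gap p) (ts j) x"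
    have xs: "step_fun (?xs p) x = step_fun (ys p i) x - step_fun (ys p j) x" for p x
      unfolding step_simps step_scale by simp
    have "((\<lambda>p. \<integral>x. (step_fun (?xs p) x)\<^sup>2 \<partial>lborel) \<longlongrightarrow> (ts i - ts j) powr (2 * \<gamma> + 3)) F"
    proof (rule step_norm_tendsto[where f="?f" and v="\<lambda>p. scale_sq p * time_norm (snd p) (ts i - ts j)" and d="\<lambda>p. 2 * tail_err i p + 2 * tail_err j p"])
      show "((\<lambda>p. 2 * tail_err i p + 2 * tail_err j p) \<longlongrightarrow> 0) F"
        using tendsto_add[OF tendsto_mult_left[OF tail_err_tendsto[of i], of 2] tendsto_mult_left[OF tail_err_tendsto[of j], of 2]] by simp
      show "((\<lambda>p. scale_sq p * time_norm (snd p) (ts i - ts j)) \<longlongrightarrow> (ts i - ts j) powr (2 * \<gamma> + 3)) F"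
        unfolding F_def by (rule time_norm_tendsto[OF \<gamma>]) (use le in simp)
      show "\<forall>\<^sub>F p in F. ?f p \<in> borel_measurable borel \<and> step_sets UNIV (?xs p)
        \<and> sq_integral lborel (?f p) = ennreal (scale_sq p * time_norm (snd p) (ts i - ts j))
        \<and> 0 \<le> scale_sq p * time_norm (snd p) (ts i - ts j)
        \<and> integrable lborel (\<lambda>x. (step_fun (?xs p) x)\<^sup>2)
        \<and> sq_integral lborel (\<lambda>x. ?f p x - step_fun (?xs p) x) \<le> ennreal (2 * tail_err i p + 2 * tail_err j p) \<and> 0 \<le> 2 * tail_err i p + 2 * tail_err j p"
        using region_F
      proof eventually_elim
        case (elim p)
        interpret rosenblatt_parameters "fst p" "snd p" "1 / gap p" by (rule parameters[OF elim])
        have s: "step_sets UNIV (?xs p)" using step_sets_UNIV[OF elim] by (simp only: step_sets_append step_scale simp_thms)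
        note [measurable] = step_fun_measurable[OF step_sets_UNIV(2)[OF elim]]
        have "sq_integral lborel (\<lambda>x. ?f p x - step_fun (?xs p) x)
          = sq_integral lborel (\<lambda>x. (limit_kernel (fst p) (snd p) (1 / gap p) (ts i) x - step_fun (ys p i) x) + (- 1) * (limit_kernel (fst p) (snd p) (1 / gap p) (ts j) x - step_fun (ys p j) x))"
          unfolding xs by (simp add: algebra_simps)
        also have "\<dots> \<le> 2 * sq_integral lborel (\<lambda>x. limit_kernel (fst p) (snd p) (1 / gap p) (ts i) x - step_fun (ys p i) x)
           + 2 * sq_integral lborel (\<lambda>x. (- 1) * (limit_kernel (fst p) (snd p) (1 / gap p) (ts j) x - step_fun (ys p j) x))"
          by (rule nn_integral_square_add) measurable
        also have "\<dots> \<le> 2 * ennreal (tail_err i p) + 2 * ennreal (tail_err j p)"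
          using ys_close[OF elim, of i] ys_close[OF elim, of j] unfolding tail_err_def
          by (intro add_mono mult_left_mono) (auto simp: power2_commute)
        also have "\<dots> = ennreal (2 * tail_err i p + 2 * tail_err j p)"
          using tail_err_nonneg[OF elim] by (simp add: ennreal_plus ennreal_mult')
        finally have d: "sq_integral lborel (\<lambda>x. ?f p x - step_fun (?xs p) x) \<le> \<dots>" .
        have v: "sq_integral lborel (?f p) = ennreal (scale_sq p * time_norm (snd p) (ts i - ts j))"
          unfolding scale_sq_def by (rule limit_kernel_increment_norm[OF ts le])
        have v0: "0 \<le> scale_sq p * time_norm (snd p) (ts i - ts j)"
          unfolding scale_sq_def using time_norm_nonneg le by simp
        show ?case
          using s v v0 d tail_err_nonneg[OF elim] step_integral_gaussian(4)[OF s]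
          by (intro conjI) (auto intro!: borel_measurable_diff)
      qed
    qed
    then show ?thesis unfolding xs .
  qed
  show ?thesis
  proof (cases "ts j \<le> ts i")
    case True then show ?thesis using main[OF True] by simp
  next
    case False
    then have "((\<lambda>p. \<integral>x. (step_fun (ys p j) x - step_fun (ys p i) x)\<^sup>2 \<partial>lborel) \<longlongrightarrow> (ts j - ts i) powr (2 * \<gamma> + 3)) F"
      by (intro main) simp
    then show ?thesis using False by (simp add: power2_commute)
  qed
qed

text \<open>Indices from k on stand for the tail function, so that the k times and the factor W form
  one Gaussian vector of length k + 1.\<close>

definition sel :: "nat \<Rightarrow> real \<times> real \<Rightarrow> nat \<Rightarrow> steps" where
  "sel k p i = (if i < k then ys p i else ws p)"

definition sel_cov :: "nat \<Rightarrow> nat \<Rightarrow> nat \<Rightarrow> real" where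
  "sel_cov k i j = (if i < k \<and> j < k then fbm_covariance (\<gamma> + 3/2) (ts i) (ts j) else if i < k \<or> j < k then 0 else 1)"

lemma sel_sets: "p \<in> rosenblatt_region \<Longrightarrow> step_sets UNIV (sel k p i)"
  using step_sets_UNIV by (simp add: sel_def)

lemma sel_integrable:
  assumes p: "p \<in> rosenblatt_region"
  shows "integrable lborel (\<lambda>x. (step_fun (sel k p i) x)\<^sup>2)"
    "integrable lborel (\<lambda>x. (step_fun (sel k p i) x - step_fun (sel k p j) x)\<^sup>2)"
proof -
  show "integrable lborel (\<lambda>x. (step_fun (sel k p i) x)\<^sup>2)" by (rule step_integral_gaussian(4)[OF sel_sets[OF p]])
  let ?xs = "sel k p i @ map (\<lambda>(a, S). (- 1 * a, S)) (sel k p j)"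
  have "step_fun ?xs x = step_fun (sel k p i) x - step_fun (sel k p j) x" for x
    unfolding step_simps step_scale by simp
  moreover have "step_sets UNIV ?xs" using sel_sets[OF p] by (simp only: step_sets_append step_scale simp_thms)
  ultimately show "integrable lborel (\<lambda>x. (step_fun (sel k p i) x - step_fun (sel k p j) x)\<^sup>2)"
    using step_integral_gaussian(4)[of UNIV ?xs] by simp
qed

text \<open>Mixed indices give exactly 0 for every p in the region, because the two supports are
  disjoint and the polarised integrand vanishes pointwise; this is where the independence of W comes
  from.\<close>

lemma sel_cov_tendsto:
  "((\<lambda>p. ((\<integral>x. (step_fun (sel k p i) x)\<^sup>2 \<partial>lborel) + (\<integral>x. (step_fun (sel k p j) x)\<^sup>2 \<partial>lborel)
      - (\<integral>x. (step_fun (sel k p i) x - step_fun (sel k p j) x)\<^sup>2 \<partial>lborel)) / 2) \<longlongrightarrow> sel_cov k i j) F"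
proof -
  consider "i < k" "j < k" | "(i < k) \<noteq> (j < k)" | "\<not> i < k" "\<not> j < k" by blast
  then show ?thesis
  proof cases
    case 1
    have H: "2 * (\<gamma> + 3/2) = 2 * \<gamma> + 3" by simp
    have "((\<lambda>p. ((\<integral>x. (step_fun (ys p i) x)\<^sup>2 \<partial>lborel) + (\<integral>x. (step_fun (ys p j) x)\<^sup>2 \<partial>lborel)
        - (\<integral>x. (step_fun (ys p i) x - step_fun (ys p j) x)\<^sup>2 \<partial>lborel)) / 2) \<longlongrightarrow>
        (ts i powr (2 * \<gamma> + 3) + ts j powr (2 * \<gamma> + 3) - \<bar>ts i - ts j\<bar> powr (2 * \<gamma> + 3)) / 2) F"
      by (intro tendsto_intros ys_norm_tendsto ys_diff_tendsto) simp
    then show ?thesis using 1 ts by (simp add: sel_def sel_cov_def fbm_covariance_def H del: distrib_left_numeral)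
  next
    case 3
    have "((\<lambda>p. ((\<integral>x. (step_fun (ws p) x)\<^sup>2 \<partial>lborel) + (\<integral>x. (step_fun (ws p) x)\<^sup>2 \<partial>lborel) - 0) / 2) \<longlongrightarrow> (1 + 1 - 0) / 2) F"
      by (intro tendsto_intros ws_norm_tendsto) simp
    then show ?thesis using 3 by (simp add: sel_def sel_cov_def)
  next
    case 2
    have "\<forall>\<^sub>F p in F. 0 = ((\<integral>x. (step_fun (sel k p i) x)\<^sup>2 \<partial>lborel) + (\<integral>x. (step_fun (sel k p j) x)\<^sup>2 \<partial>lborel)
      - (\<integral>x. (step_fun (sel k p i) x - step_fun (sel k p j) x)\<^sup>2 \<partial>lborel)) / 2"
      using region_F
    proof eventually_elim
      case (elim p)
      have "step_fun (sel k p i) x = 0 \<or> step_fun (sel k p j) x = 0" for x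
        using 2 step_fun_outside[OF ws_sets[OF elim], of x] step_fun_outside[OF ys_sets[OF elim], of x i] step_fun_outside[OF ys_sets[OF elim], of x j]
        by (cases "x \<le> - (1 / gap p)") (auto simp: sel_def)
      then have "(step_fun (sel k p i) x - step_fun (sel k p j) x)\<^sup>2 = (step_fun (sel k p i) x)\<^sup>2 + (step_fun (sel k p j) x)\<^sup>2" for x
        by (metis add.left_neutral add.right_neutral diff_0 diff_zero power2_minus power_zero_numeral)
      then show ?case using sel_integrable(1)[OF elim] by simp
    qed
    moreover have z: "sel_cov k i j = 0" using 2 by (auto simp: sel_cov_def)
    ultimately show ?thesis unfolding z by (intro Lim_transform_eventually[OF tendsto_const])
  qed
qed

lemma sel_char_tendsto:
  "((\<lambda>p. CLINT \<omega>|M. iexp (\<Sum>i<n. c i * step_integral B (sel k p i) \<omega>)) \<longlongrightarrow>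
     complex_of_real (exp (- (\<Sum>i<n. \<Sum>j<n. c i * c j * sel_cov k i j) / 2))) F"
proof -
  define q where "q p i j = ((\<integral>x. (step_fun (sel k p i) x)\<^sup>2 \<partial>lborel) + (\<integral>x. (step_fun (sel k p j) x)\<^sup>2 \<partial>lborel)
      - (\<integral>x. (step_fun (sel k p i) x - step_fun (sel k p j) x)\<^sup>2 \<partial>lborel)) / 2" for p i j
  have "((\<lambda>p. complex_of_real (exp (- (\<Sum>i<n. \<Sum>j<n. c i * c j * q p i j) / 2))) \<longlongrightarrow>
     complex_of_real (exp (- (\<Sum>i<n. \<Sum>j<n. c i * c j * sel_cov k i j) / 2))) F"
    unfolding q_def by (intro tendsto_intros sel_cov_tendsto) simp
  moreover have "\<forall>\<^sub>F p in F. complex_of_real (exp (- (\<Sum>i<n. \<Sum>j<n. c i * c j * q p i j) / 2)) = (CLINT \<omega>|M. iexp (\<Sum>i<n. c i * step_integral B (sel k p i) \<omega>))"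
    using region_F
  proof eventually_elim
    case (elim p)
    obtain zs where zs: "\<forall>x. step_fun zs x = (\<Sum>i<n. c i * step_fun (sel k p i) x)"
      "\<forall>B (\<omega>::'a). step_integral B zs \<omega> = (\<Sum>i<n. c i * step_integral B (sel k p i) \<omega>)" "step_sets UNIV zs"
      using combination_step[where k=n and c=c and xs="sel k p"] sel_sets[OF elim] by blast
    have "(\<integral>x. (step_fun zs x)\<^sup>2 \<partial>lborel) = (\<Sum>i<n. \<Sum>j<n. c i * c j * q p i j)"
      unfolding zs(1)[rule_format] q_def by (rule quadratic_form_polarization) (rule sel_integrable[OF elim])+
    then show ?case using step_integral_gaussian(5)[OF zs(3)] zs(2) by simp
  qed
  ultimately show ?thesis by (rule Lim_transform_eventually)
qed

end


section \<open>Convergence of the generalized Rosenblatt process\<close>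


lemma rosenblatt_kernel_swap: "rosenblatt_kernel a b t = rosenblatt_kernel b a t"
  unfolding rosenblatt_kernel_def by (simp add: add.commute)

lemma rosenblatt_const_swap: "rosenblatt_const a b = rosenblatt_const b a"
proof -
  have "- a - b - 1 = - b - a - 1" by simp
  then show ?thesis unfolding rosenblatt_const_def by (simp only: add.commute[of a b] mult.commute)
qed

lemma generalized_rosenblatt_process_swap:
  "generalized_rosenblatt_process M B a b Z \<longleftrightarrow> generalized_rosenblatt_process M B b a Z"
  unfolding generalized_rosenblatt_process_def rosenblatt_kernel_swap[of a b] rosenblatt_const_swap[of a b] ..

lemma rosenblatt_continuous_process:
  assumes "generalized_rosenblatt_process M B a b Z"
  shows "continuous_process M Z"
proof
  fix t :: real assume "t \<in> {0..1}"
  then show "Z t \<in> borel_measurable M" using assms unfolding generalized_rosenblatt_process_def by auto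
next
  fix \<omega> assume "\<omega> \<in> space M"
  then have "continuous_on {0..} (\<lambda>t. Z t \<omega>)" using assms unfolding generalized_rosenblatt_process_def by auto
  then show "continuous_on {0..1} (\<lambda>t. Z t \<omega>)" by (rule continuous_on_subset) auto
qed

lemma rosenblatt_approximation_choice:
  assumes noise: "white_noise M B" and ts: "\<And>i. 0 \<le> ts i" and \<gamma>: "-1 < \<gamma>" "\<gamma> < -1/2"
    and Z: "\<And>p. p \<in> rosenblatt_region \<Longrightarrow> generalized_rosenblatt_process M B (fst p) (snd p) (Z p)"
  obtains ws ys where "rosenblatt_limit M B \<gamma> Z ts ws ys"
proof -
  define good where "good p = (\<lambda>(ws, ys). step_sets {..- (1 / gap p)} ws \<and> (\<forall>i. step_sets {- (1 / gap p)<..} (ys i)) \<and>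
      sq_integral lborel (\<lambda>x. tail_fun (fst p) (1 / gap p) x - step_fun ws x) \<le> ennreal (gap p) \<and>
      (\<forall>i. sq_integral lborel (\<lambda>y. limit_kernel (fst p) (snd p) (1 / gap p) (ts i) y - step_fun (ys i) y)
        \<le> ennreal (2 * (scale_sq p * time_tail (snd p) (1 / gap p) (ts i)) + 2 * gap p)) \<and>
      (\<forall>i. sq_integral M (\<lambda>\<omega>. Z p (ts i) \<omega> - step_integral B ws \<omega> * step_integral B (ys i) \<omega>)
        \<le> ennreal (approx_bound (fst p) (snd p) (1 / gap p) (gap p) (ts i))))" for p
  have "\<exists>wy. p \<in> rosenblatt_region \<longrightarrow> good p wy" for p
  proof (cases "p \<in> rosenblatt_region")
    case True
    then have g: "gap p > 0" by (auto simp: gap_def rosenblatt_region_def)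
    have "rosenblatt_setting M B (fst p) (snd p) (1 / gap p) (Z p)"
      using noise True g Z[OF True]
      by (auto simp: rosenblatt_setting_def rosenblatt_parameters_def rosenblatt_setting_axioms_def)
    then interpret rosenblatt_setting M B "fst p" "snd p" "1 / gap p" "Z p" .
    obtain ws ys where "good p (ws, ys)"
      unfolding good_def scale_sq_def by (rule rosenblatt_approximation[of ts "gap p"]) (use ts g in auto)
    then show ?thesis by blast
  qed simp
  then obtain wy where wy: "\<And>p. p \<in> rosenblatt_region \<Longrightarrow> good p (wy p)" by metis
  have "rosenblatt_limit M B \<gamma> Z ts (\<lambda>p. fst (wy p)) (\<lambda>p. snd (wy p))"
    unfolding rosenblatt_limit_def rosenblatt_limit_axioms_def
    using noise ts \<gamma> wy unfolding good_def by (auto simp: case_prod_beta)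
  then show thesis by (rule that)
qed

text \<open>The map h multiplies the last coordinate into the others, so the Gaussian limit passes
  to the products by continuous mapping. Exchanging the products for Z costs an L^1 distance, which
  the Lipschitz bound on g and Cauchy-Schwarz reduce to the vanishing approximation error.\<close>

lemma rosenblatt_fdd:
  fixes \<gamma> :: real and g :: "(nat \<Rightarrow> real) \<Rightarrow> real"
  assumes lim: "rosenblatt_limit M B \<gamma> Z ts ws ys" and N: "limit_process N (\<gamma> + 3/2) W BH"
    and Z: "\<And>p. p \<in> rosenblatt_region \<Longrightarrow> generalized_rosenblatt_process M B (fst p) (snd p) (Z p)"
    and ts1: "\<And>i. i < k \<Longrightarrow> ts i \<le> 1"
    and gL: "\<And>x y. \<bar>g x - g y\<bar> \<le> L * (\<Sum>i<k. \<bar>x i - y i\<bar>)" and gK: "\<And>x. \<bar>g x\<bar> \<le> K"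
  shows "((\<lambda>p. \<integral>\<omega>. g (\<lambda>i. Z p (ts i) \<omega>) \<partial>M) \<longlongrightarrow> (\<integral>\<omega>. g (\<lambda>i. W \<omega> * BH (ts i) \<omega>) \<partial>N)) (at (-1/2, \<gamma>) within rosenblatt_region)"
proof -
  interpret rosenblatt_limit M B \<gamma> Z ts ws ys by fact
  interpret N: limit_process N "\<gamma> + 3/2" W BH by fact
  have gc: "continuous_on UNIV g" by (rule continuous_on_coordinate_lipschitz[OF gL])
  \<comment> \<open>The Lipschitz bound sees k coordinates only, so g depends on these
    alone.\<close>
  have gcut: "g x = g (\<lambda>i. if i < k then x i else 0)" for x
    using gL[of x "\<lambda>i. if i < k then x i else 0"] by simp
  define h where "h v = g (\<lambda>i. if i < k then v k * v i else 0)" for v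
  define Y where "Y i = (if i < k then BH (ts i) else W)" for i
  have hc: "continuous_on UNIV h"
  proof -
    have c: "continuous_on UNIV (\<lambda>x::nat \<Rightarrow> real. x i)" for i
      by (rule continuous_on_product_then_coordinatewise[OF continuous_on_id])
    have "continuous_on UNIV (\<lambda>v::nat \<Rightarrow> real. \<lambda>i. if i < k then v k * v i else 0)"
    proof (rule continuous_on_coordinatewise_then_product)
      fix i show "continuous_on UNIV (\<lambda>v::nat \<Rightarrow> real. if i < k then v k * v i else 0)"
        using c by (cases "i < k") (auto intro!: continuous_intros)
    qed
    then show ?thesis unfolding h_def by (rule continuous_on_compose2[OF gc]) auto
  qed
  have tsT: "ts i \<in> {0..}" for i using ts by simp
  have Ym: "Y i \<in> borel_measurable N" for i unfolding Y_def using N.BH.member(2)[OF tsT] by simp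
  have Yi: "integrable N (\<lambda>\<omega>. (Y i \<omega>)\<^sup>2)" for i
    unfolding Y_def using N.BH.member(4)[OF tsT] N.W_moment(1) by simp
  have cov: "fbm_covariance (\<gamma> + 3/2) (ts i) (ts i) = ts i powr (2 * \<gamma> + 3)" for i
  proof -
    have H: "2 * (\<gamma> + 3/2) = 2 * \<gamma> + 3" by simp
    show ?thesis unfolding fbm_covariance_def H using ts[of i] by simp
  qed
  have pw: "ts i powr (2 * \<gamma> + 3) \<le> 1" if "i < k" for i
    using ts[of i] ts1[OF that] \<gamma> by (intro powr_le1) auto
  have Yn: "(\<integral>\<omega>. (Y i \<omega>)\<^sup>2 \<partial>N) \<le> 2" for i
  proof (cases "i < k")
    case True
    have "(\<integral>\<omega>. (BH (ts i) \<omega>)\<^sup>2 \<partial>N) = ts i powr (2 * \<gamma> + 3)"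
      using N.BH.covariance[OF tsT tsT, of i i] by (simp add: power2_eq_square cov)
    then show ?thesis using True pw[OF True] by (simp add: Y_def)
  qed (simp add: Y_def N.W_moment(2))
  \<comment> \<open>The limits of these variances are at most 1, so the bound 2 leaves room for a
    strict inequality.\<close>
  have norm2: "\<forall>\<^sub>F p in F. (\<integral>x. (step_fun (sel k p i) x)\<^sup>2 \<partial>lborel) < 2" for i
  proof (cases "i < k")
    case True
    then show ?thesis using order_tendstoD(2)[OF ys_norm_tendsto[of i], of 2] pw[OF True] by (simp add: sel_def)
  next
    case False
    then show ?thesis using order_tendstoD(2)[OF ws_norm_tendsto, of 2] by (simp add: sel_def)
  qed
  have X: "\<forall>\<^sub>F p in F. \<forall>i<Suc k. step_integral B (sel k p i) \<in> borel_measurable M \<and>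
      integrable M (\<lambda>\<omega>. (step_integral B (sel k p i) \<omega>)\<^sup>2) \<and> (\<integral>\<omega>. (step_integral B (sel k p i) \<omega>)\<^sup>2 \<partial>M) \<le> 2"
  proof -
    have "\<forall>\<^sub>F p in F. \<forall>i\<in>{..<Suc k}. (\<integral>x. (step_fun (sel k p i) x)\<^sup>2 \<partial>lborel) < 2"
      using norm2 by (intro eventually_ball_finite) auto
    with region_F show ?thesis
    proof eventually_elim
      case (elim p)
      show ?case using elim(2) step_integral_gaussian(1-3)[OF sel_sets[OF elim(1)]] by (auto intro: less_imp_le)
    qed
  qed
  have Xm: "step_integral B (sel k p i) \<in> borel_measurable M" if "p \<in> rosenblatt_region" for p i
    by (rule step_integral_gaussian(1)[OF sel_sets[OF that]])
  have charY: "(CLINT \<omega>|N. iexp (\<Sum>i<Suc k. c i * Y i \<omega>)) = complex_of_real (exp (- (\<Sum>i<Suc k. \<Sum>j<Suc k. c i * c j * sel_cov k i j) / 2))" for c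
  proof -
    have "(\<Sum>i<Suc k. c i * Y i \<omega>) = (\<Sum>i<k. c i * BH (ts i) \<omega>) + c k * W \<omega>" for \<omega> by (simp add: Y_def)
    then have "(CLINT \<omega>|N. iexp (\<Sum>i<Suc k. c i * Y i \<omega>)) = complex_of_real (exp (- ((c k)\<^sup>2 + (\<Sum>i<k. \<Sum>j<k. c i * c j * fbm_covariance (\<gamma> + 3/2) (ts i) (ts j))) / 2))"
      using N.joint_char[of k ts c "c k"] ts by (simp only:)
    moreover have "(\<Sum>i<Suc k. \<Sum>j<Suc k. c i * c j * sel_cov k i j) = (c k)\<^sup>2 + (\<Sum>i<k. \<Sum>j<k. c i * c j * fbm_covariance (\<gamma> + 3/2) (ts i) (ts j))"
      by (simp add: sel_cov_def power2_eq_square)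
    ultimately show ?thesis by (simp only:)
  qed
  have cs: "((\<lambda>p. \<integral>\<omega>. cos (\<Sum>i<Suc k. c i * step_integral B (sel k p i) \<omega>) \<partial>M) \<longlongrightarrow> (\<integral>\<omega>. cos (\<Sum>i<Suc k. c i * Y i \<omega>) \<partial>N)) F \<and>
     ((\<lambda>p. \<integral>\<omega>. sin (\<Sum>i<Suc k. c i * step_integral B (sel k p i) \<omega>) \<partial>M) \<longlongrightarrow> (\<integral>\<omega>. sin (\<Sum>i<Suc k. c i * Y i \<omega>) \<partial>N)) F" for c
  proof -
    have Ys: "(\<lambda>\<omega>. \<Sum>i<Suc k. c i * Y i \<omega>) \<in> borel_measurable N" using Ym by (intro borel_measurable_sum borel_measurable_times borel_measurable_const)
    note l = sel_char_tendsto[where n="Suc k" and c=c and k=k, folded charY]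
    have Xs: "(\<lambda>\<omega>. \<Sum>i<Suc k. c i * step_integral B (sel k p i) \<omega>) \<in> borel_measurable M" if "p \<in> rosenblatt_region" for p
      using that by (intro borel_measurable_sum borel_measurable_times borel_measurable_const Xm)
    have e1: "\<forall>\<^sub>F p in F. Re (CLINT \<omega>|M. iexp (\<Sum>i<Suc k. c i * step_integral B (sel k p i) \<omega>)) = (\<integral>\<omega>. cos (\<Sum>i<Suc k. c i * step_integral B (sel k p i) \<omega>) \<partial>M)"
      using region_F by eventually_elim (rule iexp_components(1)[OF prob_space_axioms Xs, symmetric])
    have e2: "\<forall>\<^sub>F p in F. Im (CLINT \<omega>|M. iexp (\<Sum>i<Suc k. c i * step_integral B (sel k p i) \<omega>)) = (\<integral>\<omega>. sin (\<Sum>i<Suc k. c i * step_integral B (sel k p i) \<omega>) \<partial>M)"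
      using region_F by eventually_elim (rule iexp_components(2)[OF prob_space_axioms Xs, symmetric])
    show ?thesis
      unfolding iexp_components[OF N.prob_space_axioms Ys]
      using Lim_transform_eventually[OF tendsto_Re[OF l] e1] Lim_transform_eventually[OF tendsto_Im[OF l] e2] by blast
  qed
  have "((\<lambda>p. \<integral>\<omega>. h (\<lambda>i. if i < Suc k then step_integral B (sel k p i) \<omega> else 0) \<partial>M) \<longlongrightarrow> (\<integral>\<omega>. h (\<lambda>i. if i < Suc k then Y i \<omega> else 0) \<partial>N)) F"
    by (rule cramer_wold[OF prob_space_axioms N.prob_space_axioms X Ym Yi Yn conjunct1[OF cs] conjunct2[OF cs] hc, of K])
      (simp add: h_def gK)
  moreover have "h (\<lambda>i. if i < Suc k then Y i \<omega> else 0) = g (\<lambda>i. W \<omega> * BH (ts i) \<omega>)" for \<omega>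
    unfolding h_def gcut[of "\<lambda>i. W \<omega> * BH (ts i) \<omega>"] by (intro arg_cong[of _ _ g]) (auto simp: Y_def)
  moreover have "h (\<lambda>i. if i < Suc k then step_integral B (sel k p i) \<omega> else 0) = g (\<lambda>i. step_integral B (ws p) \<omega> * step_integral B (ys p i) \<omega>)" for p \<omega>
    unfolding h_def gcut[of "\<lambda>i. step_integral B (ws p) \<omega> * step_integral B (ys p i) \<omega>"] by (intro arg_cong[of _ _ g]) (auto simp: sel_def)
  ultimately have l1: "((\<lambda>p. \<integral>\<omega>. g (\<lambda>i. step_integral B (ws p) \<omega> * step_integral B (ys p i) \<omega>) \<partial>M) \<longlongrightarrow> (\<integral>\<omega>. g (\<lambda>i. W \<omega> * BH (ts i) \<omega>) \<partial>N)) F"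
    by simp
  \<comment> \<open>The maximum with 0 secures the nonnegativity that the square root bound asks
    for.\<close>
  define e where "e p i = max 0 (approx_bound (fst p) (snd p) (1 / gap p) (gap p) (ts i))" for p i
  have e0: "((\<lambda>p. \<bar>L\<bar> * (\<Sum>i<k. sqrt (e p i))) \<longlongrightarrow> 0) F"
  proof -
    have "((\<lambda>p. e p i) \<longlongrightarrow> max 0 0) F" for i
      unfolding e_def F_def by (intro tendsto_max tendsto_const approx_bound_tendsto \<gamma> ts)
    then have "((\<lambda>p. \<bar>L\<bar> * (\<Sum>i<k. sqrt (e p i))) \<longlongrightarrow> \<bar>L\<bar> * (\<Sum>i<k. sqrt (max 0 0))) F"
      by (intro tendsto_intros)
    then show ?thesis by simp
  qed
  have "((\<lambda>p. (\<integral>\<omega>. g (\<lambda>i. Z p (ts i) \<omega>) \<partial>M) - (\<integral>\<omega>. g (\<lambda>i. step_integral B (ws p) \<omega> * step_integral B (ys p i) \<omega>) \<partial>M)) \<longlongrightarrow> 0) F"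
  proof (rule Lim_null_comparison[OF _ e0], use region_F in eventually_elim)
    case (elim p)
    let ?S = "\<lambda>i \<omega>. step_integral B (ws p) \<omega> * step_integral B (ys p i) \<omega>"
    have [measurable]: "Z p (ts i) \<in> borel_measurable M" for i
      using Z[OF elim] ts unfolding generalized_rosenblatt_process_def by auto
    have [measurable]: "step_integral B (ws p) \<in> borel_measurable M" "step_integral B (ys p i) \<in> borel_measurable M" for i
      using step_integral_gaussian(1)[OF ws_sets[OF elim]] step_integral_gaussian(1)[OF ys_sets[OF elim]] by auto
    have i1: "integrable M (\<lambda>\<omega>. g (\<lambda>i. Z p (ts i) \<omega>))"
    proof (rule integrable_const_bound[where B=K])
      show "(\<lambda>\<omega>. g (\<lambda>i. Z p (ts i) \<omega>)) \<in> borel_measurable M"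
        unfolding gcut[of "\<lambda>i. Z p (ts i) _"] by (rule measurable_continuous_coordinates[OF gc]) measurable
    qed (simp add: gK)
    have i2: "integrable M (\<lambda>\<omega>. g (\<lambda>i. ?S i \<omega>))"
    proof (rule integrable_const_bound[where B=K])
      show "(\<lambda>\<omega>. g (\<lambda>i. ?S i \<omega>)) \<in> borel_measurable M"
        unfolding gcut[of "\<lambda>i. ?S i _"] by (rule measurable_continuous_coordinates[OF gc]) measurable
    qed (simp add: gK)
    have "(\<integral>\<^sup>+\<omega>. ennreal \<bar>g (\<lambda>i. Z p (ts i) \<omega>) - g (\<lambda>i. ?S i \<omega>)\<bar> \<partial>M) \<le> (\<integral>\<^sup>+\<omega>. ennreal \<bar>L\<bar> * (\<Sum>i<k. ennreal \<bar>Z p (ts i) \<omega> - ?S i \<omega>\<bar>) \<partial>M)"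
    proof (rule nn_integral_mono)
      fix \<omega>
      have "\<bar>g (\<lambda>i. Z p (ts i) \<omega>) - g (\<lambda>i. ?S i \<omega>)\<bar> \<le> L * (\<Sum>i<k. \<bar>Z p (ts i) \<omega> - ?S i \<omega>\<bar>)" by (rule gL)
      also have "\<dots> \<le> \<bar>L\<bar> * (\<Sum>i<k. \<bar>Z p (ts i) \<omega> - ?S i \<omega>\<bar>)" by (intro mult_right_mono sum_nonneg) auto
      finally have "ennreal \<bar>g (\<lambda>i. Z p (ts i) \<omega>) - g (\<lambda>i. ?S i \<omega>)\<bar> \<le> ennreal (\<bar>L\<bar> * (\<Sum>i<k. \<bar>Z p (ts i) \<omega> - ?S i \<omega>\<bar>))" by (rule ennreal_leI)
      then show "ennreal \<bar>g (\<lambda>i. Z p (ts i) \<omega>) - g (\<lambda>i. ?S i \<omega>)\<bar> \<le> ennreal \<bar>L\<bar> * (\<Sum>i<k. ennreal \<bar>Z p (ts i) \<omega> - ?S i \<omega>\<bar>)"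
        by (simp add: ennreal_mult' sum_ennreal)
    qed
    also have "\<dots> = ennreal \<bar>L\<bar> * (\<Sum>i<k. \<integral>\<^sup>+\<omega>. ennreal \<bar>Z p (ts i) \<omega> - ?S i \<omega>\<bar> \<partial>M)"
      by (subst nn_integral_cmult, measurable, subst nn_integral_sum, measurable)
    also have "\<dots> \<le> ennreal \<bar>L\<bar> * (\<Sum>i<k. ennreal (sqrt (e p i)))"
    proof (intro mult_left_mono sum_mono)
      fix i
      have "ennreal (approx_bound (fst p) (snd p) (1 / gap p) (gap p) (ts i)) \<le> ennreal (e p i)"
        by (intro ennreal_leI) (simp add: e_def)
      with Z_close[OF elim, of i] have le: "sq_integral M (\<lambda>\<omega>. Z p (ts i) \<omega> - ?S i \<omega>) \<le> ennreal (e p i)" by (rule order_trans)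
      show "(\<integral>\<^sup>+\<omega>. ennreal \<bar>Z p (ts i) \<omega> - ?S i \<omega>\<bar> \<partial>M) \<le> ennreal (sqrt (e p i))"
        by (rule expectation_abs_bound[OF _ le]) (auto simp: e_def)
    qed simp
    also have "\<dots> = ennreal (\<bar>L\<bar> * (\<Sum>i<k. sqrt (e p i)))"
      by (simp add: ennreal_mult' sum_ennreal e_def)
    finally have "ennreal (\<integral>\<omega>. \<bar>g (\<lambda>i. Z p (ts i) \<omega>) - g (\<lambda>i. ?S i \<omega>)\<bar> \<partial>M) \<le> ennreal (\<bar>L\<bar> * (\<Sum>i<k. sqrt (e p i)))"
      using i1 i2 by (subst (asm) nn_integral_eq_integral) auto
    moreover have "0 \<le> \<bar>L\<bar> * (\<Sum>i<k. sqrt (e p i))" by (intro mult_nonneg_nonneg sum_nonneg) (auto simp: e_def)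
    ultimately have "(\<integral>\<omega>. \<bar>g (\<lambda>i. Z p (ts i) \<omega>) - g (\<lambda>i. ?S i \<omega>)\<bar> \<partial>M) \<le> \<bar>L\<bar> * (\<Sum>i<k. sqrt (e p i))"
      by (subst (asm) ennreal_le_iff) auto
    moreover have "\<bar>(\<integral>\<omega>. g (\<lambda>i. Z p (ts i) \<omega>) \<partial>M) - (\<integral>\<omega>. g (\<lambda>i. ?S i \<omega>) \<partial>M)\<bar> \<le> (\<integral>\<omega>. \<bar>g (\<lambda>i. Z p (ts i) \<omega>) - g (\<lambda>i. ?S i \<omega>)\<bar> \<partial>M)"
      unfolding Bochner_Integration.integral_diff[OF i1 i2, symmetric] by (rule integral_abs_bound)
    ultimately show ?case by simp
  qed
  from tendsto_add[OF this l1] show ?thesis unfolding F_def by simp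
qed

lemma rosenblatt_weak_limit:
  fixes \<gamma> :: real
  assumes \<gamma>: "-1 < \<gamma>" "\<gamma> < -1/2" and M: "prob_space M" and B: "brownian_random_measure M B"
    and Z: "\<And>p. p \<in> rosenblatt_region \<Longrightarrow> generalized_rosenblatt_process M B (fst p) (snd p) (Z p)"
    and N: "prob_space N" and W: "distributed N lborel W (\<lambda>x. ennreal (std_normal_density x))"
    and BH: "fractional_brownian_motion N (\<gamma> + 3/2) BH"
    and cont: "\<And>\<omega>. \<omega> \<in> space N \<Longrightarrow> continuous_on {0..} (\<lambda>t. BH t \<omega>)"
    and indep: "independent_of_process N W BH"
  shows "converges_weakly (mtopology_of C01) M (\<lambda>p. path01 (Z p)) N (path01 (\<lambda>t \<omega>. W \<omega> * BH t \<omega>))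
           (at (-1/2, \<gamma>) within rosenblatt_region)"
proof -
  interpret M: white_noise M B using M B by (simp add: white_noise_def white_noise_axioms_def)
  have NL: "limit_process N (\<gamma> + 3/2) W BH"
    using N W BH indep by (simp add: limit_process_def limit_process_axioms_def)
  then interpret N: limit_process N "\<gamma> + 3/2" W BH .
  let ?F = "at (-1/2, \<gamma>) within rosenblatt_region"
  note r = filterlim_region[of \<gamma>]
  show ?thesis
  \<comment> \<open>The exponent \<gamma> + 2 lies strictly between 1 and 2 \<gamma> + 3, the limit
    of 2(a + b + 2); both distances equal \<gamma> + 1 > 0. As times lie in [0, 1], a larger
    exponent gives a smaller bound.\<close>
  proof (rule weak_convergence_C01[where C=8 and q="\<gamma> + 2"])
    show "prob_space M" "prob_space N" by fact+
    show "\<forall>\<^sub>F p in ?F. continuous_process M (Z p)"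
      using r(1) by eventually_elim (rule rosenblatt_continuous_process[OF Z])
    show "continuous_process N (\<lambda>t \<omega>. W \<omega> * BH t \<omega>)"
    proof
      fix t :: real assume "t \<in> {0..1}"
      then show "(\<lambda>\<omega>. W \<omega> * BH t \<omega>) \<in> borel_measurable N" using N.BH.member(2)[of t] by simp
    next
      fix \<omega> assume "\<omega> \<in> space N"
      then have "continuous_on {0..1} (\<lambda>t. BH t \<omega>)" by (rule continuous_on_subset[OF cont]) auto
      then show "continuous_on {0..1} (\<lambda>t. W \<omega> * BH t \<omega>)" by (intro continuous_intros)
    qed
    show "(0::real) \<le> 8" "\<gamma> + 2 > 1" using \<gamma> by auto
    have "((\<lambda>p. 2 * (fst p + snd p + 2)) \<longlongrightarrow> 2 * (-1/2 + \<gamma> + 2)) ?F" by (intro tendsto_intros r)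
    then have "\<forall>\<^sub>F p in ?F. \<gamma> + 2 < 2 * (fst p + snd p + 2)" by (rule order_tendstoD) (use \<gamma> in simp)
    with r(1) show "\<forall>\<^sub>F p in ?F. \<forall>s t. 0 \<le> s \<longrightarrow> s \<le> t \<longrightarrow> t \<le> 1 \<longrightarrow>
       sq_integral M (\<lambda>\<omega>. Z p t \<omega> - Z p s \<omega>) \<le> ennreal (8 * (t - s) powr (\<gamma> + 2))"
    proof (eventually_elim, intro allI impI)
      fix p s t assume p: "p \<in> rosenblatt_region" "\<gamma> + 2 < 2 * (fst p + snd p + 2)" and st: "0 \<le> s" "s \<le> t" "t \<le> (1::real)"
      have "sq_integral M (\<lambda>\<omega>. Z p t \<omega> - Z p s \<omega>) \<le> ennreal (8 * (t - s) powr (2 * (fst p + snd p + 2)))"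
        by (rule M.rosenblatt_moment_bound[OF _ Z[OF p(1)] st(1,2)]) (use p in simp)
      also have "\<dots> \<le> ennreal (8 * (t - s) powr (\<gamma> + 2))"
        using p(2) st by (intro ennreal_leI mult_left_mono powr_mono') auto
      finally show "sq_integral M (\<lambda>\<omega>. Z p t \<omega> - Z p s \<omega>) \<le> \<dots>" .
    qed
    fix m :: nat and g :: "(nat \<Rightarrow> real) \<Rightarrow> real" and L K
    assume g: "\<And>x y. \<bar>g x - g y\<bar> \<le> L * (\<Sum>i<2^m+1. \<bar>x i - y i\<bar>)" "\<And>x. \<bar>g x\<bar> \<le> K"
    define ts where "ts i = real i / 2^m" for i :: nat
    have ts: "0 \<le> ts i" for i by (simp add: ts_def)
    have ts1: "ts i \<le> 1" if "i < 2^m + 1" for i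
    proof -
      have "real i \<le> real (2^m)" using that by linarith
      then show ?thesis by (simp add: ts_def divide_le_eq)
    qed
    obtain ws ys where wy: "rosenblatt_limit M B \<gamma> Z ts ws ys"
      by (rule rosenblatt_approximation_choice[OF M.white_noise_axioms ts \<gamma> Z])
    show "((\<lambda>p. \<integral>\<omega>. g (\<lambda>i. Z p (real i / 2^m) \<omega>) \<partial>M) \<longlongrightarrow> (\<integral>\<omega>. g (\<lambda>i. W \<omega> * BH (real i / 2^m) \<omega>) \<partial>N)) ?F"
      using rosenblatt_fdd[OF wy NL Z ts1 g] unfolding ts_def .
  qed
qed

lemma converges_weakly_compose:
  assumes "converges_weakly T M X N Y F" "filterlim f F G"
  shows "converges_weakly T M (\<lambda>i. X (f i)) N Y G"
  using assms unfolding converges_weakly_def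
  by (auto intro: eventually_compose_filterlim filterlim_compose)

theorem theorem2p2:
  fixes \<gamma> :: real
    and M :: "'a measure" and B :: "real set \<Rightarrow> 'a \<Rightarrow> real"
    and Z :: "real \<times> real \<Rightarrow> real \<Rightarrow> 'a \<Rightarrow> real"
    and N :: "'b measure" and W :: "'b \<Rightarrow> real" and BH :: "real \<Rightarrow> 'b \<Rightarrow> real"
  assumes "-1 < \<gamma>" and "\<gamma> < -1/2"
    and "prob_space M"
    and "brownian_random_measure M B"
    and "\<And>\<gamma>1 \<gamma>2. (\<gamma>1, \<gamma>2) \<in> rosenblatt_region \<Longrightarrow>
           generalized_rosenblatt_process M B \<gamma>1 \<gamma>2 (Z (\<gamma>1, \<gamma>2))"
    and "prob_space N"
    and "distributed N lborel W (\<lambda>x. ennreal (std_normal_density x))"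
    and "fractional_brownian_motion N (\<gamma> + 3/2) BH"
    and "\<And>\<omega>. \<omega> \<in> space N \<Longrightarrow> continuous_on {0..} (\<lambda>t. BH t \<omega>)"
    and "independent_of_process N W BH"
  shows "converges_weakly (mtopology_of C01)
           M (\<lambda>p. path01 (Z p))
           N (path01 (\<lambda>t \<omega>. W \<omega> * BH t \<omega>))
           (at (-1/2, \<gamma>) within rosenblatt_region) \<and>
         converges_weakly (mtopology_of C01)
           M (\<lambda>p. path01 (Z p))
           N (path01 (\<lambda>t \<omega>. W \<omega> * BH t \<omega>))
           (at (\<gamma>, -1/2) within rosenblatt_region)"
proof
  show "converges_weakly (mtopology_of C01) M (\<lambda>p. path01 (Z p)) N (path01 (\<lambda>t \<omega>. W \<omega> * BH t \<omega>))
           (at (-1/2, \<gamma>) within rosenblatt_region)"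
    using assms by (intro rosenblatt_weak_limit) auto
  \<comment> \<open>Kernel and constant are symmetric in the two parameters, so the family with
    exchanged parameters is again admissible and the first limit applies to it.\<close>
  let ?sw = "\<lambda>p::real \<times> real. (snd p, fst p)"
  have "converges_weakly (mtopology_of C01) M (\<lambda>p. path01 (Z (?sw p))) N (path01 (\<lambda>t \<omega>. W \<omega> * BH t \<omega>))
           (at (-1/2, \<gamma>) within rosenblatt_region)"
  proof (rule rosenblatt_weak_limit[OF assms(1-4) _ assms(6-10)])
    fix p :: "real \<times> real" assume "p \<in> rosenblatt_region"
    then have "?sw p \<in> rosenblatt_region" by (cases p) (simp add: region_swap)
    then show "generalized_rosenblatt_process M B (fst p) (snd p) (Z (?sw p))"
      using assms(5) by (subst generalized_rosenblatt_process_swap) simp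
  qed
  moreover have "filterlim ?sw (at (-1/2, \<gamma>) within rosenblatt_region) (at (\<gamma>, -1/2) within rosenblatt_region)"
    unfolding filterlim_at
  proof
    show "\<forall>\<^sub>F p in at (\<gamma>, -1/2) within rosenblatt_region. ?sw p \<in> rosenblatt_region \<and> ?sw p \<noteq> (-1/2, \<gamma>)"
      unfolding eventually_at_filter by (rule always_eventually) (auto simp: region_swap)
    have i: "((\<lambda>p. p) \<longlongrightarrow> (\<gamma>, -1/2)) (at (\<gamma>, -1/2) within rosenblatt_region)" by (rule tendsto_ident_at)
    show "(?sw \<longlongrightarrow> (-1/2, \<gamma>)) (at (\<gamma>, -1/2) within rosenblatt_region)"
      using tendsto_Pair[OF tendsto_snd[OF i] tendsto_fst[OF i]] by simp
  qed
  ultimately show "converges_weakly (mtopology_of C01) M (\<lambda>p. path01 (Z p)) N (path01 (\<lambda>t \<omega>. W \<omega> * BH t \<omega>))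
           (at (\<gamma>, -1/2) within rosenblatt_region)"
    by (auto dest: converges_weakly_compose)
qed

end
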